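(* The processes $\{\zeta^o(t,y)\}_{t\ge0}$, $y\in\mathbb R_*$, generate a symmetric Markov semigroup $\{P^o_t\}_{t\ge0}$ on $L^2(\mathbb R)$ given by $$P_t^ou(y)=\mathbb E\big[u(\zeta^o(t,y)),\,t<\mathfrak t_{y,\mathfrak f}\big],\qquad t\ge0,\ y\in\mathbb R_*.$$
   Context: Notation. $\mathbb T$ is the unit torus, i.e. $[-1/2,1/2]$ with identified endpoints; $\mathbb T_*=\mathbb T\setminus\{0\}$, $\mathbb R_*=\mathbb R\setminus\{0\}$. $\mathbb E[X,A]$ means $\mathbb E[X\mathbf 1_A]$. For nonnegative $f,g$ on a set $A$, $f\approx g$ on $A$ means $C^{-1}g\le f\le Cg$ on $A$ for some constant $C>0$. A Markov semigroup here may be sub-Markovian (loss of mass is allowed: $0\le u\le1$ implies $0\le P_tu\le1$); symmetric means $\int_{\mathbb R}(P_tu)v\,dy=\int_{\mathbb R}u(P_tv)\,dy$ for $u,v\in L^2(\mathbb R)$. Standing assumptions on the model. $\gamma>0$ is given. (1) $p_+,p_-,p_0:\mathbb T\to[0,\infty)$ are continuous, even, $p_++p_-+p_0\equiv1$; for some $\kappa>0$, $\liminf_{k\to0}(\log|k|^{-1})^\kappa p_0(k)\in(0,+\infty)$ (so $p_0(0)=0$); $\inf_{k\in\mathbb T}p_+(k)>0$. (2) $\bar\omega:\mathbb T\to[0,\infty)$ is continuous, even, unimodal (exactly one local maximum, at $1/2$, and one local minimum, at $0$), of class $C^2(\mathbb T_* )$, and its first two derivatives have one-sided limits at $0$. (3)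 $R_1,R_2\ge0$ are even, in $C^2(\mathbb T)$, $\int_{\mathbb T}R_j\,dk=1$. There are $\beta_1,\beta_2,\beta_3>0$ with $\beta_1<1+\beta_2$ and $\alpha:=(1+\beta_2)/\beta_3\in(1,2)$; $R_j(k)\approx|k|^{\beta_j}$ on $\mathbb T_*$, the limits $R_j^*:=\lim_{k\to0}R_j(k)/|k|^{\beta_j}>0$ exist ($j=1,2$), and $\int_{\mathbb T}R_2(k)/R_1(k)\,dk\in(0,+\infty)$. (4) With $\bar t(k):=(\gamma R_1(k))^{-1}$, the function $S(k):=\bar\omega'(k)\bar t(k)$ is odd, $C^1$ on $[-1/2,1/2]\setminus\{0\}$, a bijection of $\mathbb T_*$ onto $\mathbb R$, decreasing on $(0,1/2]$; $|S(k)|\approx\cos(\pi k)/|k|^{\beta_3}$ and $|S'(k)|\approx|k|^{-1-\beta_3}$ on $\mathbb T_*$, and the limits $S_*:=\lim_{k\to0}|k|^{\beta_3}|S(k)|>0$, $S'_*:=\lim_{k\to0}|k|^{1+\beta_3}|S'(k)|>0$ exist. The process $\zeta^o$. Let $q_\alpha(y):=c_\alpha|y|^{-1-\alpha}$, $c_\alpha:=\frac{2^\alpha\Gamma((1+\alpha)/2)}{\sqrt\pi|\Gamma(-\alpha/2)|}$, $\bar r_*:=\frac{R_2^*S_*^{1+\alpha}\Gamma(\alpha+1)}{c_\alpha S'_*}$, and let $\zeta(t)$, $\zeta(0)=0$, be the symmetric $\alpha$-stable Lévy process with generator $\mathcal L_\alpha u(y)=\bar r_*\,\mathrm{p.v.}\int_{\mathbb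 R}[u(y')-u(y)]q_\alpha(y'-y)dy'$, $u\in C_c^2(\mathbb R)$. Put $\zeta(t,y):=y+\zeta(t)$, $\mathfrak t_{y,0}:=0$, $\mathfrak t_{y,m+1}:=\inf\{t>\mathfrak t_{y,m}:(-1)^my\,\zeta(t,y)<0\}$, $\mathfrak t_{y,\mathfrak f}:=\inf\{t>0:\zeta(t,y)=0\}$. Let $\sigma_0:=1$ and $\{\sigma_m\}_{m\ge1}$ be i.i.d., independent of $\zeta$, with $\mathbb P(\sigma_m=\pm1)=p_\pm(0)$. Then $\zeta^o(t,y):=\big(\prod_{j=0}^m\sigma_j\big)\zeta(t,y)$ for $t\in[\mathfrak t_{y,m},\mathfrak t_{y,m+1})$, $t<\mathfrak t_{y,\mathfrak f}$, and $\zeta^o(t,y):=0$ for $t\ge\mathfrak t_{y,\mathfrak f}$. *)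

theory Defs
  imports "HOL-Probability.Probability"
begin

section \<open>Function classes\<close>

text \<open>
  A function on the unit torus is a function on the real line of period 1. Thus
  \<open>C\<^sup>2\<close> on the torus is \<open>C\<^sup>2\<close> on \<open>UNIV\<close>, and \<open>C\<^sup>2\<close> on the punctured torus is \<open>C\<^sup>2\<close>
  on \<open>- \<int>\<close>. The fundamental domain is \<open>[-1/2, 1/2]\<close>.
\<close>

definition torus_fun :: "(real \<Rightarrow> real) \<Rightarrow> bool" where
  "torus_fun f \<longleftrightarrow> (\<forall>k. f (k + 1) = f k)"

definition even_fun :: "(real \<Rightarrow> real) \<Rightarrow> bool" where
  "even_fun f \<longleftrightarrow> (\<forall>k. f (- k) = f k)"

abbreviation torus :: "real set" where
  "torus \<equiv> {-1/2..1/2}"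

definition C1_on :: "real set \<Rightarrow> (real \<Rightarrow> real) \<Rightarrow> bool" where
  "C1_on A f \<longleftrightarrow>
    (\<exists>f'. (\<forall>x\<in>A. (f has_real_derivative f' x) (at x within A)) \<and> continuous_on A f')"

definition C2_on :: "real set \<Rightarrow> (real \<Rightarrow> real) \<Rightarrow> bool" where
  "C2_on A f \<longleftrightarrow>
    (\<exists>f'. (\<forall>x\<in>A. (f has_real_derivative f' x) (at x within A)) \<and> C1_on A f')"

definition C2_compact_support :: "(real \<Rightarrow> real) \<Rightarrow> bool" where
  "C2_compact_support u \<longleftrightarrow> C2_on UNIV u \<and> compact (closure {x. u x \<noteq> 0})"

definition comparable_on :: "real set \<Rightarrow> (real \<Rightarrow> real) \<Rightarrow> (real \<Rightarrow> real) \<Rightarrow> bool" where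
  "comparable_on A f g \<longleftrightarrow> (\<exists>C>0. \<forall>x\<in>A. inverse C * g x \<le> f x \<and> f x \<le> C * g x)"

definition local_max_at :: "(real \<Rightarrow> real) \<Rightarrow> real \<Rightarrow> bool" where
  "local_max_at f k \<longleftrightarrow> eventually (\<lambda>x. f x \<le> f k) (nhds k)"

definition local_min_at :: "(real \<Rightarrow> real) \<Rightarrow> real \<Rightarrow> bool" where
  "local_min_at f k \<longleftrightarrow> eventually (\<lambda>x. f k \<le> f x) (nhds k)"

text \<open>One point of each class modulo 1 is tested, so that \<open>-1/2\<close> and \<open>1/2\<close> count once.\<close>

definition unimodal_on_torus :: "(real \<Rightarrow> real) \<Rightarrow> bool" where
  "unimodal_on_torus f \<longleftrightarrow>
    (\<forall>k\<in>{-1/2<..1/2}. (local_max_at f k \<longleftrightarrow> k = 1/2) \<and> (local_min_at f k \<longleftrightarrow> k = 0))"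

definition has_one_sided_limits_at_0 :: "(real \<Rightarrow> real) \<Rightarrow> bool" where
  "has_one_sided_limits_at_0 f \<longleftrightarrow>
    (\<exists>l. (f \<longlongrightarrow> l) (at_left 0)) \<and> (\<exists>l. (f \<longlongrightarrow> l) (at_right 0))"


section \<open>The kinetic model\<close>

definition mean_free_time :: "real \<Rightarrow> (real \<Rightarrow> real) \<Rightarrow> real \<Rightarrow> real" where
  "mean_free_time \<gamma> R1 k = 1 / (\<gamma> * R1 k)"

definition jump_fun :: "real \<Rightarrow> (real \<Rightarrow> real) \<Rightarrow> (real \<Rightarrow> real) \<Rightarrow> real \<Rightarrow> real" where
  "jump_fun \<gamma> disp R1 k = deriv disp k * mean_free_time \<gamma> R1 k"

locale kinetic_model =
  fixes \<gamma> :: real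
    and p_plus p_minus p_zero :: "real \<Rightarrow> real"
    and disp :: "real \<Rightarrow> real"
    and R1 R2 :: "real \<Rightarrow> real"
    and \<beta>1 \<beta>2 \<beta>3 :: real
  assumes gamma_pos: "\<gamma> > 0"
    and p_torus: "\<And>p. p \<in> {p_plus, p_minus, p_zero} \<Longrightarrow>
          torus_fun p \<and> continuous_on UNIV p \<and> even_fun p \<and> (\<forall>k. p k \<ge> 0)"
    and p_sum: "\<And>k. p_plus k + p_minus k + p_zero k = 1"
    and p_zero_liminf: "\<exists>\<kappa>>0.
          Liminf (at 0) (\<lambda>k. ereal (ln (inverse \<bar>k\<bar>) powr \<kappa> * p_zero k)) \<in> {0<..<\<infinity>}"
    and p_plus_inf: "(INF k\<in>torus. p_plus k) > 0"
    and disp_torus: "torus_fun disp" "continuous_on UNIV disp" "even_fun disp" "\<And>k. disp k \<ge> 0"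
    and disp_unimodal: "unimodal_on_torus disp"
    and disp_C2: "C2_on (- \<int>) disp"
    and disp_one_sided: "has_one_sided_limits_at_0 (deriv disp)"
          "has_one_sided_limits_at_0 (deriv (deriv disp))"
    and R_torus: "\<And>R. R \<in> {R1, R2} \<Longrightarrow>
          torus_fun R \<and> even_fun R \<and> (\<forall>k. R k \<ge> 0) \<and> C2_on UNIV R \<and> (LBINT k:torus. R k) = 1"
    and beta_pos: "\<beta>1 > 0" "\<beta>2 > 0" "\<beta>3 > 0"
    and beta_less: "\<beta>1 < 1 + \<beta>2"
    and alpha_range: "(1 + \<beta>2) / \<beta>3 \<in> {1<..<2}"
    and R_comparable: "\<And>R \<beta>. (R, \<beta>) \<in> {(R1, \<beta>1), (R2, \<beta>2)} \<Longrightarrow>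
          comparable_on (torus - {0}) R (\<lambda>k. \<bar>k\<bar> powr \<beta>)"
    and R_limit: "\<And>R \<beta>. (R, \<beta>) \<in> {(R1, \<beta>1), (R2, \<beta>2)} \<Longrightarrow>
          \<exists>l>0. ((\<lambda>k. R k / \<bar>k\<bar> powr \<beta>) \<longlongrightarrow> l) (at 0)"
    and R_ratio: "set_integrable lborel torus (\<lambda>k. R2 k / R1 k)"
          "(LBINT k:torus. R2 k / R1 k) > 0"
    and S_odd: "\<And>k. k \<in> torus - {0} \<Longrightarrow> jump_fun \<gamma> disp R1 (- k) = - jump_fun \<gamma> disp R1 k"
    and S_C1: "C1_on (torus - {0}) (jump_fun \<gamma> disp R1)"
    and S_bij: "bij_betw (jump_fun \<gamma> disp R1) ({-1/2<..1/2} - {0}) UNIV"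
    and S_decreasing: "strict_antimono_on {0<..1/2} (jump_fun \<gamma> disp R1)"
    and S_comparable: "comparable_on (torus - {0}) (\<lambda>k. \<bar>jump_fun \<gamma> disp R1 k\<bar>)
          (\<lambda>k. cos (pi * k) / \<bar>k\<bar> powr \<beta>3)"
    and S_deriv_comparable: "comparable_on (torus - {0}) (\<lambda>k. \<bar>deriv (jump_fun \<gamma> disp R1) k\<bar>)
          (\<lambda>k. \<bar>k\<bar> powr (- 1 - \<beta>3))"
    and S_limit: "\<exists>l>0. ((\<lambda>k. \<bar>k\<bar> powr \<beta>3 * \<bar>jump_fun \<gamma> disp R1 k\<bar>) \<longlongrightarrow> l) (at 0)"
    and S_deriv_limit: "\<exists>l>0.
          ((\<lambda>k. \<bar>k\<bar> powr (1 + \<beta>3) * \<bar>deriv (jump_fun \<gamma> disp R1) k\<bar>) \<longlongrightarrow> l) (at 0)"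

definition stable_const :: "real \<Rightarrow> real" where
  "stable_const \<alpha> = 2 powr \<alpha> * Gamma ((1 + \<alpha>) / 2) / (sqrt pi * \<bar>Gamma (- \<alpha> / 2)\<bar>)"

text \<open>The intensity \<open>R\<^sub>2\<^sup>* S\<^sub>*\<^bsup>1+\<alpha>\<^esup> \<Gamma>(\<alpha>+1) / (c\<^sub>\<alpha> S'\<^sub>*)\<close>, with \<open>S\<close> the function \<open>jump_fun\<close>.\<close>

definition jump_intensity ::
    "real \<Rightarrow> (real \<Rightarrow> real) \<Rightarrow> (real \<Rightarrow> real) \<Rightarrow> (real \<Rightarrow> real) \<Rightarrow> real \<Rightarrow> real \<Rightarrow> real" where
  "jump_intensity \<gamma> disp R1 R2 \<beta>2 \<beta>3 =
    (let \<alpha> = (1 + \<beta>2) / \<beta>3;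
         S = jump_fun \<gamma> disp R1;
         R2_lim = Lim (at 0) (\<lambda>k. R2 k / \<bar>k\<bar> powr \<beta>2);
         S_lim = Lim (at 0) (\<lambda>k. \<bar>k\<bar> powr \<beta>3 * \<bar>S k\<bar>);
         S'_lim = Lim (at 0) (\<lambda>k. \<bar>k\<bar> powr (1 + \<beta>3) * \<bar>deriv S k\<bar>)
     in R2_lim * S_lim powr (1 + \<alpha>) * Gamma (\<alpha> + 1) / (stable_const \<alpha> * S'_lim))"


section \<open>The symmetric stable process\<close>

text \<open>\<open>r\<close> times the principal value integral against \<open>c\<^sub>\<alpha> |y' - y|\<^bsup>-1-\<alpha>\<^esup> dy'\<close>.\<close>

definition stable_generator :: "real \<Rightarrow> real \<Rightarrow> (real \<Rightarrow> real) \<Rightarrow> real \<Rightarrow> real" where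
  "stable_generator \<alpha> r u y =
    r * Lim (at_right 0) (\<lambda>\<epsilon>. LBINT y':{y'. \<bar>y' - y\<bar> > \<epsilon>}.
          (u y' - u y) * (stable_const \<alpha> * \<bar>y' - y\<bar> powr (- 1 - \<alpha>)))"

definition cadlag_path :: "(real \<Rightarrow> real) \<Rightarrow> bool" where
  "cadlag_path z \<longleftrightarrow>
    (\<forall>t\<ge>0. (z \<longlongrightarrow> z t) (at_right t)) \<and> (\<forall>t>0. \<exists>l. (z \<longlongrightarrow> l) (at_left t))"

text \<open>Time is a real number; only nonnegative times are constrained.\<close>

locale levy_process = prob_space M for M :: "'w measure" +
  fixes \<zeta> :: "real \<Rightarrow> 'w \<Rightarrow> real"
  assumes random_variable_\<zeta>: "\<And>t. t \<ge> 0 \<Longrightarrow> random_variable borel (\<zeta> t)"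
    and start_\<zeta>: "AE w in M. \<zeta> 0 w = 0"
    and indep_increments: "\<And>(t :: nat \<Rightarrow> real) n. 0 \<le> t 0 \<Longrightarrow> mono t \<Longrightarrow>
          indep_vars (\<lambda>_. borel) (\<lambda>i w. \<zeta> (t (Suc i)) w - \<zeta> (t i) w) {..<n}"
    and stationary_increments: "\<And>s h. s \<ge> 0 \<Longrightarrow> h \<ge> 0 \<Longrightarrow>
          distr M borel (\<lambda>w. \<zeta> (s + h) w - \<zeta> s w) = distr M borel (\<zeta> h)"
    and cadlag_\<zeta>: "AE w in M. cadlag_path (\<lambda>t. \<zeta> t w)"

locale symmetric_stable_process = levy_process M \<zeta>
  for M :: "'w measure" and \<zeta> :: "real \<Rightarrow> 'w \<Rightarrow> real" +
  fixes \<alpha> r :: real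
  assumes symmetric_law: "\<And>t. t \<ge> 0 \<Longrightarrow> distr M borel (\<lambda>w. - \<zeta> t w) = distr M borel (\<zeta> t)"
    and self_similar: "\<And>a t. a > 0 \<Longrightarrow> t \<ge> 0 \<Longrightarrow>
          distr M borel (\<zeta> (a * t)) = distr M borel (\<lambda>w. a powr (1 / \<alpha>) * \<zeta> t w)"
    and generator: "\<And>u. C2_compact_support u \<Longrightarrow>
          uniform_limit UNIV (\<lambda>h y. (expectation (\<lambda>w. u (y + \<zeta> h w)) - u y) / h)
            (stable_generator \<alpha> r u) (at_right 0)"


section \<open>Reflection and transmission at the interface\<close>

text \<open>
  In the following three definitions \<open>z\<close> is a path started at 0, \<open>y\<close> the starting point. Times are extended
  reals, so that the infimum of the empty set is \<open>\<infinity>\<close>.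
\<close>

primrec crossing_time :: "(real \<Rightarrow> real) \<Rightarrow> real \<Rightarrow> nat \<Rightarrow> ereal" where
  "crossing_time z y 0 = 0"
| "crossing_time z y (Suc m) =
    Inf {ereal t |t. crossing_time z y m < ereal t \<and> (- 1) ^ m * y * (y + z t) < 0}"

definition hitting_time :: "(real \<Rightarrow> real) \<Rightarrow> real \<Rightarrow> ereal" where
  "hitting_time z y = Inf {ereal t |t. 0 < t \<and> y + z t = 0}"

text \<open>
  \<open>s\<close> is the sequence of signs. The crossing intervals are disjoint. If \<open>t\<close> precedes the hitting
  time of 0 but lies in none of them (possible only with probability 0), the value is unspecified.
\<close>

definition interface_path :: "(real \<Rightarrow> real) \<Rightarrow> (nat \<Rightarrow> real) \<Rightarrow> real \<Rightarrow> real \<Rightarrow> real" where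
  "interface_path z s t y =
    (if ereal t < hitting_time z y
     then (let m = (THE m. crossing_time z y m \<le> ereal t \<and> ereal t < crossing_time z y (Suc m))
           in (\<Prod>j\<le>m. s j) * (y + z t))
     else 0)"

locale interface_signs = prob_space M for M :: "'w measure" +
  fixes \<zeta> :: "real \<Rightarrow> 'w \<Rightarrow> real" and \<sigma> :: "nat \<Rightarrow> 'w \<Rightarrow> real" and q_plus q_minus :: real
  assumes sign_0: "\<And>w. w \<in> space M \<Longrightarrow> \<sigma> 0 w = 1"
    and indep_signs: "indep_vars (\<lambda>_. borel) \<sigma> {1..}"
    and sign_law: "\<And>m. m \<ge> 1 \<Longrightarrow> prob {w \<in> space M. \<sigma> m w = 1} = q_plus"
          "\<And>m. m \<ge> 1 \<Longrightarrow> prob {w \<in> space M. \<sigma> m w = - 1} = q_minus"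
    and signs_indep_\<zeta>: "indep_set
          (sets (vimage_algebra (space M) (\<lambda>w. \<lambda>t\<in>{0..}. \<zeta> t w) (Pi\<^sub>M {0..} (\<lambda>_. borel))))
          (sets (vimage_algebra (space M) (\<lambda>w. \<lambda>m\<in>{1..}. \<sigma> m w) (Pi\<^sub>M {1..} (\<lambda>_. borel))))"


section \<open>Symmetric Markov semigroups\<close>

text \<open>
  Elements of \<open>L\<^sup>2(\<real>)\<close> are represented by Borel functions; every class contains one. Operators
  act on representatives and are required to respect equality almost everywhere.
\<close>

definition L2 :: "(real \<Rightarrow> real) set" where
  "L2 = {u. u \<in> borel_measurable borel \<and> integrable lborel (\<lambda>x. (u x)\<^sup>2)}"

text \<open>
  Strongly continuous semigroups of symmetric contractions on \<open>L\<^sup>2(\<real>)\<close> with the (sub-)Markov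
  property. Only nonnegative times are constrained.
\<close>

locale symmetric_markov_semigroup =
  fixes P :: "real \<Rightarrow> (real \<Rightarrow> real) \<Rightarrow> real \<Rightarrow> real"
  assumes maps_L2: "\<And>t u. t \<ge> 0 \<Longrightarrow> u \<in> L2 \<Longrightarrow> P t u \<in> L2"
    and respects_AE: "\<And>t u v. t \<ge> 0 \<Longrightarrow> u \<in> L2 \<Longrightarrow> v \<in> L2 \<Longrightarrow>
          (AE y in lborel. u y = v y) \<Longrightarrow> (AE y in lborel. P t u y = P t v y)"
    and linear: "\<And>t a b u v. t \<ge> 0 \<Longrightarrow> u \<in> L2 \<Longrightarrow> v \<in> L2 \<Longrightarrow>
          (AE y in lborel. P t (\<lambda>x. a * u x + b * v x) y = a * P t u y + b * P t v y)"
    and contraction: "\<And>t u. t \<ge> 0 \<Longrightarrow> u \<in> L2 \<Longrightarrow>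
          (LINT y|lborel. (P t u y)\<^sup>2) \<le> (LINT y|lborel. (u y)\<^sup>2)"
    and identity_0: "\<And>u. u \<in> L2 \<Longrightarrow> (AE y in lborel. P 0 u y = u y)"
    and semigroup: "\<And>s t u. s \<ge> 0 \<Longrightarrow> t \<ge> 0 \<Longrightarrow> u \<in> L2 \<Longrightarrow>
          (AE y in lborel. P (s + t) u y = P s (P t u) y)"
    and strongly_continuous: "\<And>u. u \<in> L2 \<Longrightarrow>
          ((\<lambda>t. LINT y|lborel. (P t u y - u y)\<^sup>2) \<longlongrightarrow> 0) (at_right 0)"
    and sub_markov: "\<And>t u. t \<ge> 0 \<Longrightarrow> u \<in> L2 \<Longrightarrow> (AE y in lborel. 0 \<le> u y \<and> u y \<le> 1) \<Longrightarrow>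
          (AE y in lborel. 0 \<le> P t u y \<and> P t u y \<le> 1)"
    and symmetric: "\<And>t u v. t \<ge> 0 \<Longrightarrow> u \<in> L2 \<Longrightarrow> v \<in> L2 \<Longrightarrow>
          (LINT y|lborel. P t u y * v y) = (LINT y|lborel. u y * P t v y)"

end

theory Submission
  imports Defs
begin

text \<open>
  Sampled on a time grid, the reflected process is a Markov chain. Its one-step kernel, killed within
  distance \<open>d\<close> of 0, is symmetric with respect to Lebesgue measure because the increments of \<open>\<zeta>\<close> are
  symmetric. A cadlag path that stays away from 0 crosses it finitely often, and fine grids see exactly
  these crossings. Hence symmetry and the semigroup law (from a grid of \<open>[0, s]\<close> followed by a grid of
  \<open>[s, s + t]\<close>) survive the limits mesh to 0 and then \<open>d\<close> to 0.

  The limit kills a path when it approaches 0, not only when it hits 0. The two differ by jumps out of a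
  left limit 0. These have probability zero by a union bound over a grid, as the law of \<open>\<zeta> t\<close> has a
  bounded density and \<open>P(\<bar>\<zeta> h\<bar> > e) = O(h)\<close>. The density is bounded because the characteristic function
  is multiplicative in time and self-similar, hence decays exponentially unless \<open>\<zeta>\<close> is degenerate, which
  the nonzero generator excludes. Contractivity on \<open>L\<^sup>2\<close> is Jensen's inequality together with symmetry;
  strong continuity comes from the right-continuity of paths at time 0 and density of compactly
  supported continuous functions.
\<close>

section \<open>Crossings of a cadlag path\<close>

text \<open>The killing distance is what makes grids usable. Near 0 a path may change sign
  infinitely often in finite time, and then no count of sign changes on a grid stabilises. For fixed
  \<open>d\<close> the count on a fine grid is eventually equal to the true number of crossings,
  path by path, so the limits need only dominated convergence and no continuity of the function that
  is evaluated.

  The signs matter only through the law of their partial products: a path with \<open>m\<close>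
  crossings keeps its end point with weight \<open>plus_prob p q m\<close> and is replaced by its
  mirror image with the remaining weight. That these weights add up to 1 rests on
  \<open>p_zero 0 = 0\<close>, which the finite lower limit in the model forces.

  Symmetry and the semigroup law are obtained for nonnegative functions, where limits and exchanges
  of integrals are free, and are carried to signed square-integrable functions by positive and
  negative parts. The operator is built with killing on approach to 0; the identification with
  killing at the hitting time is made for each starting point at the very end.\<close>

lemma crossing_time_Suc_le: "crossing_time z y m \<le> crossing_time z y (Suc m)"
  by (auto intro!: Inf_greatest)

lemma crossing_time_mono: "i \<le> j \<Longrightarrow> crossing_time z y i \<le> crossing_time z y j"
  by (rule lift_Suc_mono_le[of "crossing_time z y"]) (rule crossing_time_Suc_le)

lemma crossing_time_nonneg: "0 \<le> crossing_time z y m"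
  using crossing_time_mono[of 0 m z y] by simp

lemma sign_before_crossing:
  assumes "crossing_time z y i < ereal s" "ereal s < crossing_time z y (Suc i)"
  shows "0 \<le> (- 1) ^ i * y * (y + z s)"
proof (rule ccontr)
  assume "\<not> ?thesis"
  with assms(1) have "crossing_time z y (Suc i) \<le> ereal s"
    by (auto intro!: Inf_lower)
  with assms(2) show False by simp
qed

lemma cadlag_right: "cadlag_path z \<Longrightarrow> 0 \<le> s \<Longrightarrow> ((\<lambda>r. y + z r) \<longlongrightarrow> y + z s) (at_right s)"
  by (auto simp: cadlag_path_def intro!: tendsto_intros)

lemma cadlag_left:
  assumes "cadlag_path z" "0 < s"
  obtains l where "((\<lambda>r. y + z r) \<longlongrightarrow> l) (at_left s)"
proof -
  from assms obtain l where "(z \<longlongrightarrow> l) (at_left s)" by (auto simp: cadlag_path_def)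
  then have "((\<lambda>r. y + z r) \<longlongrightarrow> y + l) (at_left s)" by (intro tendsto_intros)
  then show thesis by (rule that)
qed

lemma right_ball:
  assumes "cadlag_path z" "0 \<le> s" "e > 0"
  obtains b where "b > s" "\<And>r. s \<le> r \<Longrightarrow> r < b \<Longrightarrow> \<bar>(y + z r) - (y + z s)\<bar> < e"
proof -
  from tendstoD[OF cadlag_right[OF assms(1,2), of y] assms(3)] obtain b where "b > s"
    "\<And>r. s < r \<Longrightarrow> r < b \<Longrightarrow> dist (y + z r) (y + z s) < e"
    by (auto simp: eventually_at_right_field)
  with assms(3) show thesis by (intro that[of b]) (auto simp: dist_real_def le_less)
qed

lemma left_ball:
  fixes z :: "real \<Rightarrow> real"
  assumes "((\<lambda>r. y + z r) \<longlongrightarrow> l) (at_left s)" "e > 0"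
  obtains a where "a < s" "\<And>r. a < r \<Longrightarrow> r < s \<Longrightarrow> \<bar>(y + z r) - l\<bar> < e"
proof -
  from assms(2) have "\<forall>\<^sub>F r in at_left s. dist (y + z r) l < e" by (rule tendstoD[OF assms(1)])
  then show thesis by (auto simp: eventually_at_left_field dist_real_def intro: that)
qed

text \<open>Right-continuity: were the old sign still present at the infimum, it would persist on an
  interval to the right and the infimum would be later. The lower bound \<open>d\<close> excludes
  the value 0.\<close>

lemma sign_at_crossing:
  assumes z: "cadlag_path z" "z 0 = 0" and d: "0 < d" "\<And>s. 0 \<le> s \<Longrightarrow> s \<le> t \<Longrightarrow> d \<le> \<bar>y + z s\<bar>"
    and s: "crossing_time z y i = ereal s" "s \<le> t"
  shows "0 < (- 1) ^ i * y * (y + z s)"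
proof (cases i)
  case 0
  with s have "s = 0" by (simp add: zero_ereal_def)
  moreover have "y \<noteq> 0" using d(2)[of 0] d(1) s z \<open>s = 0\<close> by auto
  ultimately show ?thesis using z 0 by (auto simp: zero_less_mult_iff linorder_neq_iff)
next
  case (Suc j)
  have s0: "0 \<le> s" using crossing_time_nonneg[of z y i] s by simp
  have nz: "y \<noteq> 0" "y + z s \<noteq> 0" using d(2)[of 0] d(2)[of s] d(1) s0 s(2) z(2) by auto
  have "\<not> 0 < (- 1) ^ j * y * (y + z s)"
  proof
    assume p: "0 < (- 1) ^ j * y * (y + z s)"
    obtain b where b: "b > s" "\<And>r. s \<le> r \<Longrightarrow> r < b \<Longrightarrow> \<bar>(y + z r) - (y + z s)\<bar> < \<bar>y + z s\<bar>"
      using right_ball[OF z(1) s0, of "\<bar>y + z s\<bar>" y] nz by auto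
    have pos: "0 < (- 1) ^ j * y * (y + z r)" if "s \<le> r" "r < b" for r
      using b(2)[OF that] p nz
      by (auto simp: zero_less_mult_iff abs_if split: if_splits)
    have "ereal b \<le> crossing_time z y (Suc j)"
      unfolding crossing_time.simps
    proof (intro Inf_greatest, clarify)
      fix r assume r: "crossing_time z y j < ereal r" "(- 1) ^ j * y * (y + z r) < 0"
      then have "crossing_time z y (Suc j) \<le> ereal r" by (auto intro!: Inf_lower)
      with s Suc have "s \<le> r" by simp
      with pos[of r] r(2) show "ereal b \<le> ereal r" by (cases "r < b") auto
    qed
    with s Suc b(1) show False by simp
  qed
  with nz have "(- 1) ^ j * y * (y + z s) < 0" by (auto simp: not_less le_less)
  then show ?thesis using Suc by simp
qed

text \<open>The sign taken at a crossing time persists for a while by right-continuity, so the next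
  crossing is strictly later.\<close>

lemma crossing_time_less_Suc:
  assumes z: "cadlag_path z" "z 0 = 0" and d: "0 < d" "\<And>s. 0 \<le> s \<Longrightarrow> s \<le> t \<Longrightarrow> d \<le> \<bar>y + z s\<bar>"
    and i: "crossing_time z y i \<le> ereal t"
  shows "crossing_time z y i < crossing_time z y (Suc i)"
proof -
  obtain s where s: "crossing_time z y i = ereal s" "s \<le> t" "0 \<le> s"
    using i crossing_time_nonneg[of z y i] by (cases "crossing_time z y i") auto
  have p: "0 < (- 1) ^ i * y * (y + z s)" by (rule sign_at_crossing[OF z d s(1,2)])
  then have nz: "y + z s \<noteq> 0" by auto
  obtain b where b: "b > s" "\<And>r. s \<le> r \<Longrightarrow> r < b \<Longrightarrow> \<bar>(y + z r) - (y + z s)\<bar> < \<bar>y + z s\<bar>"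
    using right_ball[OF z(1) s(3), of "\<bar>y + z s\<bar>" y] nz by auto
  have pos: "0 < (- 1) ^ i * y * (y + z r)" if "s \<le> r" "r < b" for r
    using b(2)[OF that] p nz
    by (auto simp: zero_less_mult_iff abs_if split: if_splits)
  have "ereal b \<le> crossing_time z y (Suc i)"
    unfolding crossing_time.simps
  proof (intro Inf_greatest, clarify)
    fix r assume r: "crossing_time z y i < ereal r" "(- 1) ^ i * y * (y + z r) < 0"
    with s have "s \<le> r" by simp
    with pos[of r] r(2) show "ereal b \<le> ereal r" by (cases "r < b") auto
  qed
  then show ?thesis using b(1) s(1) by (auto elim: less_le_trans[rotated])
qed

lemma sign_in_crossing_interval:
  assumes z: "cadlag_path z" "z 0 = 0" and d: "0 < d" "\<And>s. 0 \<le> s \<Longrightarrow> s \<le> t \<Longrightarrow> d \<le> \<bar>y + z s\<bar>"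
    and s: "crossing_time z y i \<le> ereal s" "ereal s < crossing_time z y (Suc i)" "0 \<le> s" "s \<le> t"
  shows "0 < (- 1) ^ i * y * (y + z s)"
proof (cases "crossing_time z y i = ereal s")
  case True
  then show ?thesis using sign_at_crossing[OF z d True s(4)] by simp
next
  case False
  with s have "0 \<le> (- 1) ^ i * y * (y + z s)" by (intro sign_before_crossing) auto
  moreover have "y \<noteq> 0" "y + z s \<noteq> 0" using d(2)[of 0] d(2)[of s] d(1) s z(2) by auto
  ultimately show ?thesis by (auto simp: le_less)
qed

text \<open>Infinitely many crossings before \<open>t\<close> would accumulate at some
  \<open>S\<close>, where the path has a left limit. Values at consecutive crossing times have
  opposite signs and modulus at least \<open>d\<close>, so they are at least \<open>2 * d\<close>
  apart and cannot both be within \<open>d\<close> of that limit.\<close>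

lemma finitely_many_crossings:
  assumes z: "cadlag_path z" "z 0 = 0" and d: "0 < d" "\<And>s. 0 \<le> s \<Longrightarrow> s \<le> t \<Longrightarrow> d \<le> \<bar>y + z s\<bar>"
    and "0 \<le> t"
  obtains m where "crossing_time z y m \<le> ereal t" "ereal t < crossing_time z y (Suc m)"
proof -
  have "\<exists>m. ereal t < crossing_time z y (Suc m)"
  proof (rule ccontr)
    assume "\<not> ?thesis"
    then have "crossing_time z y m \<le> ereal t" for m
      by (cases m) (auto simp: not_less assms simp del: crossing_time.simps(2))
    then have le: "crossing_time z y m \<le> ereal t" for m .
    have "\<exists>s. crossing_time z y m = ereal s \<and> 0 \<le> s \<and> s \<le> t" for m
      using crossing_time_nonneg[of z y m] le[of m] by (cases "crossing_time z y m") auto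
    then obtain T where T: "\<And>m. crossing_time z y m = ereal (T m)" "\<And>m. 0 \<le> T m" "\<And>m. T m \<le> t"
      by metis
    have inc: "T m < T (Suc m)" for m
      using crossing_time_less_Suc[where i=m, OF z d] T by (simp del: crossing_time.simps)
    then have "incseq T" by (intro incseq_SucI less_imp_le)
    then obtain S where S: "T \<longlonglongrightarrow> S" "\<And>m. T m \<le> S" using incseq_convergent[of T t] T by blast
    have less: "T m < S" for m using inc[of m] S(2)[of "Suc m"] by simp
    have "0 < S" using less[of 0] T(2)[of 0] by simp
    obtain l where l: "((\<lambda>r. y + z r) \<longlongrightarrow> l) (at_left S)" using cadlag_left[OF z(1) \<open>0 < S\<close>] .
    obtain a where a: "a < S" "\<And>r. a < r \<Longrightarrow> r < S \<Longrightarrow> \<bar>(y + z r) - l\<bar> < d"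
      using left_ball[OF l d(1)] by metis
    from order_tendstoD(1)[OF S(1) a(1)] obtain m where m: "\<And>n. n \<ge> m \<Longrightarrow> a < T n"
      by (auto simp: eventually_sequentially)
    have sg: "0 < (- 1) ^ n * y * (y + z (T n))" for n by (rule sign_at_crossing[OF z d T(1,3)])
    have *: "(0 < (- 1) ^ m * y * (y + z (T m)))" "(- 1) ^ m * y * (y + z (T (Suc m))) < 0"
      using sg[of m] sg[of "Suc m"] by auto
    have "\<bar>(y + z (T m)) - l\<bar> < d" "\<bar>(y + z (T (Suc m))) - l\<bar> < d"
      using a(2) less m by auto
    moreover have "d \<le> \<bar>y + z (T m)\<bar>" "d \<le> \<bar>y + z (T (Suc m))\<bar>" using d(2) T by auto
    ultimately show False using * by (auto simp: zero_less_mult_iff mult_less_0_iff abs_if split: if_splits)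
  qed
  then obtain m where m: "ereal t < crossing_time z y (Suc m)" "\<And>k. k < m \<Longrightarrow> crossing_time z y (Suc k) \<le> ereal t"
    using exists_least_iff[of "\<lambda>m. ereal t < crossing_time z y (Suc m)"] by (auto simp: not_less)
  have "crossing_time z y m \<le> ereal t"
    using m(2)[of "m - 1"] \<open>0 \<le> t\<close> by (cases m) (auto simp del: crossing_time.simps(2))
  with m(1) show thesis by (intro that)
qed

lemma crossing_index_unique:
  assumes "crossing_time z y m \<le> ereal t" "ereal t < crossing_time z y (Suc m)"
  shows "(THE m. crossing_time z y m \<le> ereal t \<and> ereal t < crossing_time z y (Suc m)) = m"
proof (rule the_equality)
  fix k assume k: "crossing_time z y k \<le> ereal t \<and> ereal t < crossing_time z y (Suc k)"
  show "k = m"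
  proof (rule ccontr)
    assume "k \<noteq> m"
    then consider "Suc k \<le> m" | "Suc m \<le> k" by linarith
    then show False
      using crossing_time_mono[of "Suc k" m z y] crossing_time_mono[of "Suc m" k z y] assms k
      by cases (auto simp del: crossing_time.simps)
  qed
qed (use assms in auto)

section \<open>Crossings seen by a grid\<close>

definition sign_changes :: "(nat \<Rightarrow> real) \<Rightarrow> nat \<Rightarrow> nat" where
  "sign_changes x N = (\<Sum>i<N. if x i * x (Suc i) < 0 then 1 else 0)"

text \<open>\<open>N n\<close> is the index of the last point of the \<open>n\<close>-th grid.
  Monotonicity is not strict, so that \<open>t = 0\<close> is a legal horizon; beyond
  \<open>N n\<close> a grid may run on.\<close>

definition mesh_to_0 :: "(nat \<Rightarrow> nat \<Rightarrow> real) \<Rightarrow> (nat \<Rightarrow> nat) \<Rightarrow> real \<Rightarrow> bool" where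
  "mesh_to_0 g N t \<longleftrightarrow> (\<forall>n. mono (g n) \<and> g n 0 = 0 \<and> 0 < N n \<and> g n (N n) = t) \<and>
     (\<forall>e>0. \<forall>\<^sub>F n in sequentially. \<forall>i<N n. g n (Suc i) - g n i < e)"

lemma mesh_in_interval:
  assumes "mesh_to_0 g N t" "i \<le> N n"
  shows "0 \<le> g n i" "g n i \<le> t"
  using assms monoD[of "g n" 0 i] monoD[of "g n" i "N n"] by (auto simp: mesh_to_0_def)

text \<open>Once the mesh is finer than the gaps between the crossing times up to the
  \<open>m\<close>-th, a grid step contains at most one crossing. By induction along the grid, the
  number of sign changes up to \<open>k\<close> is then the index of the crossing interval that
  contains \<open>g n k\<close>.\<close>

lemma sign_changes_eq:
  assumes z: "cadlag_path z" "z 0 = 0" and d: "0 < d" "\<And>s. 0 \<le> s \<Longrightarrow> s \<le> t \<Longrightarrow> d \<le> \<bar>y + z s\<bar>"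
    and m: "crossing_time z y m \<le> ereal t" "ereal t < crossing_time z y (Suc m)"
    and g: "mesh_to_0 g N t"
  shows "\<forall>\<^sub>F n in sequentially. sign_changes (\<lambda>i. y + z (g n i)) (N n) = m"
proof -
  have "\<exists>e>0. \<forall>i<m. crossing_time z y i + ereal e \<le> crossing_time z y (Suc i)"
  proof -
    have "\<exists>e>0. crossing_time z y i + ereal e \<le> crossing_time z y (Suc i)" if "i < m" for i
    proof -
      have "crossing_time z y (Suc i) \<le> ereal t"
        using crossing_time_mono[of "Suc i" m z y] that m by (auto simp del: crossing_time.simps)
      moreover have "crossing_time z y i \<le> ereal t"
        using crossing_time_mono[of "i" m z y] that m by (auto simp del: crossing_time.simps)
      ultimately show ?thesis
        using crossing_time_less_Suc[where i=i, OF z d] crossing_time_nonneg[of z y i] crossing_time_nonneg[of z y "Suc i"]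
        by (cases "crossing_time z y i"; cases "crossing_time z y (Suc i)")
           (auto simp del: crossing_time.simps intro!: exI[of _ "real_of_ereal (crossing_time z y (Suc i)) - real_of_ereal (crossing_time z y i)"])
    qed
    then obtain e where e: "\<And>i. i < m \<Longrightarrow> 0 < e i \<and> crossing_time z y i + ereal (e i) \<le> crossing_time z y (Suc i)"
      by metis
    \<comment> \<open>The element 1 keeps the set nonempty when there is no crossing at all.\<close>
    define E where "E = Min (insert 1 (e ` {..<m}))"
    have "E > 0" unfolding E_def using e by (subst Min_gr_iff) auto
    moreover have "crossing_time z y i + ereal E \<le> crossing_time z y (Suc i)" if "i < m" for i
    proof -
      have "E \<le> e i" using that unfolding E_def by (intro Min_le) auto
      then have "crossing_time z y i + ereal E \<le> crossing_time z y i + ereal (e i)"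
        by (intro add_left_mono) auto
      also have "\<dots> \<le> crossing_time z y (Suc i)" using e[OF that] by simp
      finally show ?thesis .
    qed
    ultimately show ?thesis by blast
  qed
  then obtain e where e: "e > 0" "\<And>i. i < m \<Longrightarrow> crossing_time z y i + ereal e \<le> crossing_time z y (Suc i)"
    by blast
  have "\<forall>\<^sub>F n in sequentially. \<forall>i<N n. g n (Suc i) - g n i < e"
    using g e(1) by (auto simp: mesh_to_0_def)
  then show ?thesis
  proof eventually_elim
    case (elim n)
    let ?C = "sign_changes (\<lambda>i. y + z (g n i))"
    have "crossing_time z y (?C k) \<le> ereal (g n k) \<and> ereal (g n k) < crossing_time z y (Suc (?C k))"
      if "k \<le> N n" for k
      using that
    proof (induction k)
      case 0
      have "crossing_time z y 0 \<le> ereal t"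
        using m(1) crossing_time_mono[of 0 m z y] by (meson order_trans le0)
      from crossing_time_less_Suc[OF z d this] show ?case
        using g by (simp add: sign_changes_def mesh_to_0_def zero_ereal_def del: crossing_time.simps(2))
    next
      case (Suc k)
      let ?c = "?C k"
      have IH: "crossing_time z y ?c \<le> ereal (g n k)" "ereal (g n k) < crossing_time z y (Suc ?c)"
        using Suc by auto
      have gk: "0 \<le> g n k" "g n k \<le> t" and gk': "0 \<le> g n (Suc k)" "g n (Suc k) \<le> t"
        using mesh_in_interval[OF g] Suc.prems by auto
      have le: "g n k \<le> g n (Suc k)" using g by (auto simp: mesh_to_0_def mono_def)
      have p: "0 < (- 1) ^ ?c * y * (y + z (g n k))"
        by (rule sign_in_crossing_interval[OF z d IH gk])
      show ?case
      proof (cases "ereal (g n (Suc k)) < crossing_time z y (Suc ?c)")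
        case True
        have low: "crossing_time z y ?c \<le> ereal (g n (Suc k))" using IH(1) le
          by (meson ereal_less_eq(3) order_trans)
        have "0 < (- 1) ^ ?c * y * (y + z (g n (Suc k)))"
          by (rule sign_in_crossing_interval[OF z d low True gk'])
        with p have "\<not> (y + z (g n k)) * (y + z (g n (Suc k))) < 0"
          by (auto simp: zero_less_mult_iff mult_less_0_iff)
        then have "?C (Suc k) = ?c" by (simp add: sign_changes_def)
        with True low show ?thesis by (simp del: crossing_time.simps)
      next
        case False
        then have low: "crossing_time z y (Suc ?c) \<le> ereal (g n (Suc k))" by simp
        \<comment> \<open>A second crossing inside the same step is excluded by the gap
          \<open>e\<close>, or, after the last crossing, by the end of the time interval.\<close>
        have up: "ereal (g n (Suc k)) < crossing_time z y (Suc (Suc ?c))"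
        proof (cases "Suc ?c < m")
          case True
          have "g n (Suc k) < g n k + e" using elim[rule_format, of k] Suc.prems by simp
          then have "ereal (g n (Suc k)) < ereal (g n k) + ereal e" by simp
          also have "\<dots> \<le> crossing_time z y (Suc ?c) + ereal e"
            using IH(2) by (intro add_right_mono) (auto simp del: crossing_time.simps)
          also have "\<dots> \<le> crossing_time z y (Suc (Suc ?c))" using e(2)[OF True] .
          finally show ?thesis .
        next
          case False
          then have "Suc m \<le> Suc (Suc ?c)" by simp
          from crossing_time_mono[OF this, of z y] m(2) gk'(2) show ?thesis
            by (meson ereal_less_eq(3) le_less_trans less_le_trans)
        qed
        have "0 < (- 1) ^ Suc ?c * y * (y + z (g n (Suc k)))"
          by (rule sign_in_crossing_interval[OF z d low up gk'])
        with p have "(y + z (g n k)) * (y + z (g n (Suc k))) < 0"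
          by (auto simp: zero_less_mult_iff mult_less_0_iff)
        then have "?C (Suc k) = Suc ?c" by (simp add: sign_changes_def)
        with low up show ?thesis by (simp del: crossing_time.simps)
      qed
    qed
    from this[of "N n"] have "crossing_time z y (?C (N n)) \<le> ereal t" "ereal t < crossing_time z y (Suc (?C (N n)))"
      using g by (auto simp: mesh_to_0_def simp del: crossing_time.simps)
    from crossing_index_unique[OF this] crossing_index_unique[OF m] show ?case by simp
  qed
qed

lemma mesh_point_between:
  assumes g: "mesh_to_0 g N t" and s: "0 \<le> s" "s < b" "s < t"
  shows "\<forall>\<^sub>F n in sequentially. \<exists>i\<le>N n. s \<le> g n i \<and> g n i < b"
proof -
  have "\<forall>\<^sub>F n in sequentially. \<forall>i<N n. g n (Suc i) - g n i < b - s"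
    using g s by (auto simp: mesh_to_0_def)
  then show ?thesis
  proof eventually_elim
    case (elim n)
    define i where "i = (LEAST i. s \<le> g n i)"
    have ex: "s \<le> g n (N n)" using g s by (auto simp: mesh_to_0_def)
    then have i: "s \<le> g n i" "i \<le> N n" unfolding i_def by (auto intro: LeastI Least_le)
    show ?case
    proof (cases i)
      case 0
      with i g s show ?thesis by (intro exI[of _ 0]) (auto simp: mesh_to_0_def)
    next
      case (Suc j)
      then have "\<not> s \<le> g n j" unfolding i_def using not_less_Least[of j "\<lambda>i. s \<le> g n i"] by auto
      with i elim[rule_format, of j] Suc show ?thesis by (intro exI[of _ i]) auto
    qed
  qed
qed

text \<open>A violation at time \<open>s\<close> persists on an interval to the right of
  \<open>s\<close>, into which fine grids put a point. At \<open>s = t\<close> there may be no room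
  to the right, but \<open>t\<close> itself is a grid point.\<close>

lemma eventually_near_0_iff:
  assumes z: "cadlag_path z" and g: "mesh_to_0 g N t" and "0 \<le> t"
  shows "\<forall>\<^sub>F n in sequentially. (\<forall>i\<le>N n. d \<le> \<bar>y + z (g n i)\<bar>) \<longleftrightarrow> (\<forall>s\<in>{0..t}. d \<le> \<bar>y + z s\<bar>)"
proof (cases "\<forall>s\<in>{0..t}. d \<le> \<bar>y + z s\<bar>")
  case True
  then have "\<And>n. \<forall>i\<le>N n. d \<le> \<bar>y + z (g n i)\<bar>" using mesh_in_interval[OF g] by auto
  with True show ?thesis by simp
next
  case False
  then obtain s where s: "0 \<le> s" "s \<le> t" "\<bar>y + z s\<bar> < d" by (auto simp: not_le)
  have "\<forall>\<^sub>F n in sequentially. \<exists>i\<le>N n. \<bar>y + z (g n i)\<bar> < d"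
  proof (cases "s = t")
    case True
    then show ?thesis using s g by (auto simp: mesh_to_0_def intro!: always_eventually exI[of _ "N _"])
  next
    case False
    obtain b where b: "b > s" "\<And>r. s \<le> r \<Longrightarrow> r < b \<Longrightarrow> \<bar>(y + z r) - (y + z s)\<bar> < d - \<bar>y + z s\<bar>"
      using right_ball[OF z s(1), of "d - \<bar>y + z s\<bar>" y] s by auto
    have "\<forall>\<^sub>F n in sequentially. \<exists>i\<le>N n. s \<le> g n i \<and> g n i < b"
      using False s(2) by (intro mesh_point_between[OF g s(1) b(1)]) auto
    then show ?thesis
    proof eventually_elim
      case (elim n)
      then obtain i where i: "i \<le> N n" "s \<le> g n i" "g n i < b" by blast
      from b(2)[OF i(2,3)] have "\<bar>y + z (g n i)\<bar> < d" by linarith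
      with i(1) show ?case by blast
    qed
  qed
  with False show ?thesis by (auto elim!: eventually_mono simp: not_le)
qed

section \<open>Approaching 0 without hitting it\<close>

lemma less_hitting_time:
  assumes z: "cadlag_path z" and d: "0 < d" "\<forall>s\<in>{0..t}. d \<le> \<bar>y + z s\<bar>" and "0 \<le> t"
  shows "ereal t < hitting_time z y"
proof -
  \<comment> \<open>Zeros may accumulate only after some \<open>b > t\<close>, since the path stays
    nonzero for a while after \<open>t\<close>. This makes the inequality strict.\<close>
  obtain b where b: "b > t" "\<And>r. t \<le> r \<Longrightarrow> r < b \<Longrightarrow> \<bar>(y + z r) - (y + z t)\<bar> < d"
    using right_ball[OF z \<open>0 \<le> t\<close> d(1), of y] by auto
  have "ereal b \<le> hitting_time z y"
    unfolding hitting_time_def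
  proof (intro Inf_greatest, clarify)
    fix r assume r: "0 < r" "y + z r = 0"
    have "d \<le> \<bar>y + z t\<bar>" using d \<open>0 \<le> t\<close> by auto
    moreover have "t < r"
    proof (rule ccontr)
      assume "\<not> t < r"
      with d(2)[rule_format, of r] r d(1) show False by auto
    qed
    ultimately show "ereal b \<le> ereal r" using b(2)[of r] r by (cases "r < b") auto
  qed
  with b(1) show ?thesis by (auto elim: less_le_trans[rotated])
qed

text \<open>Times at which the path is almost 0 accumulate at some \<open>S\<close>. The path is
  nonzero at \<open>S\<close>, so by right-continuity these times lie to the left of
  \<open>S\<close> eventually, and the left limit at \<open>S\<close> must be 0.\<close>

lemma jump_from_0_if_near_0:
  assumes z: "cadlag_path z" "z 0 = 0" and "y \<noteq> 0" "0 \<le> t"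
    and hit: "ereal t < hitting_time z y" and near: "\<And>d. d > 0 \<Longrightarrow> \<exists>s\<in>{0..t}. \<bar>y + z s\<bar> < d"
  shows "\<exists>s. 0 < s \<and> s \<le> t \<and> ((\<lambda>r. y + z r) \<longlongrightarrow> 0) (at_left s) \<and> y + z s \<noteq> 0"
proof -
  have nz: "y + z s \<noteq> 0" if "0 \<le> s" "s \<le> t" for s
  proof
    assume "y + z s = 0"
    with z assms(3) that have "hitting_time z y \<le> ereal s"
      unfolding hitting_time_def by (cases "s = 0") (auto intro!: Inf_lower)
    with hit that show False by (meson ereal_less_eq(3) leD order_trans)
  qed
  have "\<exists>s. s \<in> {0..t} \<and> \<bar>y + z s\<bar> < 1 / Suc n" for n using near[of "1 / Suc n"] by auto
  then obtain s where s: "\<And>n. s n \<in> {0..t}" "\<And>n. \<bar>y + z (s n)\<bar> < 1 / Suc n" by metis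
  obtain S r where S: "S \<in> {0..t}" "strict_mono r" "(s \<circ> r) \<longlonglongrightarrow> S"
    using compact_Icc[of 0 t] s(1) unfolding compact_def by metis
  have "(\<lambda>n. y + z (s n)) \<longlonglongrightarrow> 0"
    by (rule Lim_null_comparison[OF _ LIMSEQ_inverse_real_of_nat])
       (use s(2) in \<open>auto intro!: always_eventually simp: inverse_eq_divide less_imp_le\<close>)
  from LIMSEQ_subseq_LIMSEQ[OF this S(2)] have lim: "(\<lambda>n. y + z ((s \<circ> r) n)) \<longlonglongrightarrow> 0" by (simp add: o_def)
  have nzS: "y + z S \<noteq> 0" using nz S(1) by auto
  obtain b where b: "b > S" "\<And>r. S \<le> r \<Longrightarrow> r < b \<Longrightarrow> \<bar>(y + z r) - (y + z S)\<bar> < \<bar>y + z S\<bar> / 2"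
    using right_ball[OF z(1), of S "\<bar>y + z S\<bar> / 2" y] nzS S(1) by auto
  have "\<forall>\<^sub>F n in sequentially. \<bar>y + z ((s \<circ> r) n)\<bar> < \<bar>y + z S\<bar> / 2"
    using tendstoD[OF lim, of "\<bar>y + z S\<bar> / 2"] nzS by (simp add: dist_real_def)
  moreover have "\<forall>\<^sub>F n in sequentially. (s \<circ> r) n < b" using order_tendstoD(2)[OF S(3) b(1)] .
  ultimately have ev: "\<forall>\<^sub>F n in sequentially. (s \<circ> r) n < S"
    by eventually_elim (smt (verit) b(2) field_sum_of_halves)
  then obtain n where "(s \<circ> r) n < S" by (meson eventually_happens sequentially_bot)
  with s(1)[of "r n"] have S0: "0 < S" by auto
  obtain l where l: "((\<lambda>r. y + z r) \<longlongrightarrow> l) (at_left S)" using cadlag_left[OF z(1) S0] .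
  have "filterlim (s \<circ> r) (at_left S) sequentially"
    using S(3) ev by (auto simp: filterlim_at elim!: eventually_mono)
  from filterlim_compose[OF l this] have "(\<lambda>n. y + z ((s \<circ> r) n)) \<longlonglongrightarrow> l" .
  with lim have "l = 0" by (rule LIMSEQ_unique[rotated])
  with l nzS S0 S(1) show ?thesis by auto
qed

text \<open>The order of quantifiers serves the later union bound: the size of the jump and the
  lower bound on its time are fixed by \<open>k\<close>, while the distance to 0 before the jump can
  be made arbitrarily small through \<open>j\<close>.\<close>

lemma jump_from_0_on_grid:
  assumes z: "cadlag_path z" and s: "0 < s" "s \<le> t"
    and l: "((\<lambda>r. y + z r) \<longlongrightarrow> 0) (at_left s)" and nz: "y + z s \<noteq> 0"
  shows "\<exists>k::nat. \<forall>j::nat. \<forall>\<^sub>F n in sequentially. \<exists>i<n. 1 / Suc k \<le> real i * t / real n \<and>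
     \<bar>y + z (real i * t / real n)\<bar> < 1 / Suc j \<and>
     1 / Suc k < \<bar>z (real (Suc i) * t / real n) - z (real i * t / real n)\<bar>"
proof -
  have t: "0 < t" using s by simp
  \<comment> \<open>With a third of the jump, a value within \<open>\<epsilon>\<close> of 0 and the
    next one within \<open>\<epsilon>\<close> of \<open>y + z s\<close> differ by more than
    \<open>\<epsilon>\<close>. The bound \<open>s / 2\<close> keeps the grid time away from 0, where
    the density bound blows up.\<close>
  define \<epsilon> where "\<epsilon> = min (\<bar>y + z s\<bar> / 3) (s / 2)"
  have e0: "\<epsilon> > 0" "\<epsilon> \<le> \<bar>y + z s\<bar> / 3" "\<epsilon> \<le> s / 2" using nz s unfolding \<epsilon>_def min_less_iff_conj min_def by auto
  obtain k where k: "inverse (real (Suc k)) < \<epsilon>" using reals_Archimedean[OF e0(1)] by blast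
  show ?thesis
  proof (intro exI[of _ k] allI)
    fix j :: nat
    obtain b where b: "b > s" "\<And>r. s \<le> r \<Longrightarrow> r < b \<Longrightarrow> \<bar>(y + z r) - (y + z s)\<bar> < \<epsilon>"
      using right_ball[OF z _ e0(1), of s y] s by auto
    obtain a where a: "a < s" "\<And>r. a < r \<Longrightarrow> r < s \<Longrightarrow> \<bar>(y + z r) - 0\<bar> < min \<epsilon> (1 / Suc j)"
      using left_ball[OF l, of "min \<epsilon> (1 / Suc j)"] e0(1) by auto
    have "(\<lambda>n. t / real n) \<longlonglongrightarrow> 0" by (rule lim_const_over_n)
    from order_tendstoD(2)[OF this, of "min (s / 2) (min (b - s) (s - a))"] a(1) b(1) s(1)
    have "\<forall>\<^sub>F n in sequentially. t / real n < min (s / 2) (min (b - s) (s - a))" by auto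
    with eventually_gt_at_top[of 0]
    show "\<forall>\<^sub>F n in sequentially. \<exists>i<n. 1 / Suc k \<le> real i * t / real n \<and>
     \<bar>y + z (real i * t / real n)\<bar> < 1 / Suc j \<and>
     1 / Suc k < \<bar>z (real (Suc i) * t / real n) - z (real i * t / real n)\<bar>"
    proof eventually_elim
      case (elim n)
      define h where "h = t / real n"
      have h: "h > 0" "h < s / 2" "h < b - s" "h < s - a" "t = real n * h" using elim t by (auto simp: h_def)
      \<comment> \<open>The last grid point strictly before \<open>s\<close>; the jump at
        \<open>s\<close> then falls into the step from \<open>i\<close> to
        \<open>Suc i\<close>.\<close>
      define i where "i = nat (\<lceil>s / h\<rceil> - 1)"
      have c: "\<lceil>s / h\<rceil> \<ge> 1" using s h by simp
      have ri: "real i = of_int \<lceil>s / h\<rceil> - 1" using c by (simp add: i_def)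
      have 1: "real i < s / h" "s / h \<le> real (Suc i)" unfolding of_nat_Suc ri by linarith+
      have i: "real i * h < s" "s \<le> real (Suc i) * h"
        using 1 h(1) by (auto simp: field_simps)
      have "real i * h < real n * h" using i(1) s(2) h(5) by simp
      then have "i < n" using h(1) by simp
      have sh: "real (Suc i) * h = real i * h + h" by (simp add: algebra_simps)
      have bi: "\<bar>y + z (real i * h)\<bar> < min \<epsilon> (1 / Suc j)" using a(2)[of "real i * h"] i h sh by simp
      have 2: "\<bar>(y + z (real (Suc i) * h)) - (y + z s)\<bar> < \<epsilon>" using b(2) i h sh by simp
      have 3: "\<bar>y + z (real i * h)\<bar> < \<epsilon>" using bi by simp
      have "3 * \<epsilon> \<le> \<bar>y + z s\<bar>" using e0(2) by simp
      with 2 3 have "\<epsilon> < \<bar>z (real (Suc i) * h) - z (real i * h)\<bar>"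
        unfolding abs_less_iff abs_if by (auto split: if_splits)
      moreover have "\<epsilon> \<le> real i * h" using e0(3) i h sh by linarith
      ultimately show ?case using \<open>i < n\<close> bi k
        by (intro exI[of _ i]) (auto simp: h_def inverse_eq_divide)
    qed
  qed
qed

section \<open>Bump functions and bounded densities\<close>

text \<open>An exponent of at least 2 makes the derivative at the kink vanish: there the difference
  quotient is bounded by a positive power of the step.\<close>

lemma pos_part_power_deriv:
  "((\<lambda>v::real. max 0 v ^ Suc (Suc n)) has_real_derivative real (Suc (Suc n)) * max 0 v ^ Suc n) (at v)"
proof -
  consider "v > 0" | "v < 0" | "v = 0" by linarith
  then show ?thesis
  proof cases
    case 1
    have "((\<lambda>v::real. v ^ Suc (Suc n)) has_real_derivative real (Suc (Suc n)) * max 0 v ^ Suc n) (at v)"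
      using 1 DERIV_pow[of "Suc (Suc n)" v] by simp
    then show ?thesis
      by (rule has_field_derivative_transform_within_open[where S="{0<..}"]) (use 1 in auto)
  next
    case 2
    have "((\<lambda>v::real. 0) has_real_derivative real (Suc (Suc n)) * max 0 v ^ Suc n) (at v)"
      using 2 by auto
    then show ?thesis
      by (rule has_field_derivative_transform_within_open[where S="{..<0}"]) (use 2 in auto)
  next
    case 3
    have "((\<lambda>h::real. max 0 h ^ Suc (Suc n) / h) \<longlongrightarrow> 0) (at 0)"
    proof (rule Lim_null_comparison)
      have "norm (max 0 h ^ Suc (Suc n) / h) \<le> \<bar>h\<bar> ^ Suc n" for h :: real
      proof (cases "h > 0")
        case False
        then have "max 0 h = 0" by simp
        then show ?thesis by (simp del: power_Suc add: zero_power)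
      qed (simp add: max_def)
      then show "\<forall>\<^sub>F h in at 0. norm (max 0 h ^ Suc (Suc n) / h) \<le> \<bar>h::real\<bar> ^ Suc n"
        by (intro always_eventually allI)
      show "((\<lambda>h. \<bar>h::real\<bar> ^ Suc n) \<longlongrightarrow> 0) (at 0)"
        by (auto intro!: tendsto_eq_intros)
    qed
    then show ?thesis using 3 by (simp add: DERIV_def)
  qed
qed

text \<open>The third power of a positive part is the smallest natural power that is twice
  continuously differentiable; this gives explicit test functions for the generator, supported
  within \<open>e\<close> of \<open>a\<close>.\<close>

definition bump :: "real \<Rightarrow> real \<Rightarrow> real \<Rightarrow> real" where
  "bump a e x = max 0 (1 - ((x - a) / e)\<^sup>2) ^ 3"

lemma bump_range: "0 \<le> bump a e x" "bump a e x \<le> 1"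
  by (auto simp: bump_def intro!: power_le_one)

lemma bump_center: "bump a e a = 1"
  by (simp add: bump_def)

lemma bump_outside:
  assumes "0 < e" "e \<le> \<bar>x - a\<bar>"
  shows "bump a e x = 0"
proof -
  have "1 \<le> \<bar>(x - a) / e\<bar>" using assms by simp
  then have "1 \<le> \<bar>(x - a) / e\<bar>\<^sup>2" by (rule one_le_power)
  then show ?thesis unfolding bump_def by (simp only: power2_abs) (simp add: max_def)
qed

lemma C2_bump:
  assumes e: "0 < e"
  shows "C2_compact_support (bump a e)"
proof -
  define w where "w x = 1 - ((x - a) / e)\<^sup>2" for x
  have w: "(w has_real_derivative - (2 * (x - a) / e\<^sup>2)) (at x)" for x
    unfolding w_def using e
    by (auto intro!: derivative_eq_intros simp: power2_eq_square field_simps)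
  have cw: "continuous_on UNIV w" unfolding w_def by (intro continuous_intros) (use e in auto)
  define f1 where "f1 x = 3 * max 0 (w x) ^ 2 * (- (2 * (x - a) / e\<^sup>2))" for x
  define f2 where "f2 x = 6 * max 0 (w x) * (- (2 * (x - a) / e\<^sup>2)) * (- (2 * (x - a) / e\<^sup>2)) -
     3 * max 0 (w x) ^ 2 * (2 / e\<^sup>2)" for x
  have 3: "((\<lambda>x. max 0 (w x) ^ 3) has_real_derivative f1 x) (at x)" for x
    using DERIV_chain2[OF pos_part_power_deriv[of 1 "w x"] w]
    by (simp add: f1_def numeral_3_eq_3 numeral_2_eq_2 mult.assoc)
  have 2: "((\<lambda>x. max 0 (w x) ^ 2) has_real_derivative (2 * max 0 (w x)) * (- (2 * (x - a) / e\<^sup>2))) (at x)" for x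
    using DERIV_chain2[OF pos_part_power_deriv[of 0 "w x"] w]
    by (simp add: numeral_2_eq_2)
  have "((\<lambda>x. 3 * max 0 (w x) ^ 2 * (- (2 * (x - a) / e\<^sup>2))) has_real_derivative f2 x) (at x)" for x
  proof -
    have "((\<lambda>x. - (2 * (x - a) / e\<^sup>2)) has_real_derivative - (2 / e\<^sup>2)) (at x)"
      using e by (auto intro!: derivative_eq_intros simp: power2_eq_square power4_eq_xxxx field_simps)
    from DERIV_mult[OF DERIV_cmult[OF 2, of 3] this] show ?thesis
      by (rule DERIV_cong) (simp add: f2_def algebra_simps)
  qed
  then have 1: "(f1 has_real_derivative f2 x) (at x)" for x by (simp add: f1_def[abs_def])
  have "continuous_on UNIV f2" unfolding f2_def by (intro continuous_intros cw) (use e in auto)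
  then have "C1_on UNIV f1" unfolding C1_on_def using 1 by auto
  then have "C2_on UNIV (bump a e)" unfolding C2_on_def using 3 by (auto simp: bump_def[abs_def] w_def)
  moreover have "bounded {x. bump a e x \<noteq> 0}"
  proof (rule bounded_subset)
    show "{x. bump a e x \<noteq> 0} \<subseteq> cball a e"
      using bump_outside[OF e, of _ a] by (force simp: dist_real_def abs_minus_commute not_le)
  qed simp
  ultimately show ?thesis by (simp add: C2_compact_support_def compact_closure)
qed

lemma bump_measurable [measurable]: "bump a e \<in> borel_measurable borel"
  unfolding bump_def by measurable

section \<open>The generator of the stable process is not zero\<close>

lemma stable_const_pos:
  assumes "1 < \<alpha>" "\<alpha> < 2"
  shows "0 < stable_const \<alpha>"
proof -
  have "Gamma ((1 + \<alpha>) / 2) > 0" using assms by (intro Gamma_real_pos) auto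
  moreover have "Gamma (- \<alpha> / 2) \<noteq> 0"
  proof -
    \<comment> \<open>The argument lies strictly between -1 and 0 and so is no pole. At a pole
      \<open>Gamma\<close> would be 0 by convention, and with it the constant.\<close>
    have "- \<alpha> / 2 \<notin> \<int>\<^sub>\<le>\<^sub>0"
    proof
      assume "- \<alpha> / 2 \<in> \<int>\<^sub>\<le>\<^sub>0"
      then obtain n :: int where "- \<alpha> / 2 = of_int n" by (auto elim!: nonpos_Ints_cases)
      then have "real_of_int (- 1) < real_of_int n" "real_of_int n < real_of_int 0" using assms by auto
      then show False unfolding of_int_less_iff by linarith
    qed
    then show ?thesis by (simp add: Gamma_eq_zero_iff)
  qed
  ultimately show ?thesis by (auto simp: stable_const_def)
qed

text \<open>The bump around 2 vanishes within distance 1 of the origin, so for cut-offs below 1 the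
  principal value is already the plain integral of a nonnegative function over
  \<open>{1..3}\<close>, positive because the bump is.\<close>

lemma stable_generator_off_support:
  assumes "1 < \<alpha>" "\<alpha> < 2" "0 < r"
  shows "0 < stable_generator \<alpha> r (bump 2 1) 0"
proof -
  define k where "k x = bump 2 1 x * (stable_const \<alpha> * \<bar>x\<bar> powr (- 1 - \<alpha>))" for x
  have c: "0 < stable_const \<alpha>" using stable_const_pos assms by auto
  have k0: "k x = 0" if "x \<notin> {1..3}" for x
    using bump_outside[of 1 x 2] that by (cases "1 \<le> \<bar>x - 2\<bar>") (auto simp: k_def)
  have knn: "0 \<le> k x" for x using bump_range(1)[of 2 1 x] c by (auto simp: k_def)
  have int: "set_integrable lborel {1..3} k"
    unfolding k_def bump_def
    by (intro borel_integrable_atLeastAtMost' continuous_intros) auto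
  have eq: "(LBINT x:{x. \<bar>x - 0\<bar> > \<epsilon>}. (bump 2 1 x - bump 2 1 0) * (stable_const \<alpha> * \<bar>x - 0\<bar> powr (- 1 - \<alpha>)))
      = (LBINT x:{1..3}. k x)" if "0 < \<epsilon>" "\<epsilon> < 1" for \<epsilon>
    unfolding set_lebesgue_integral_def
    using that k0 bump_outside[of 1 0 2]
    by (intro Bochner_Integration.integral_cong) (auto simp: indicator_def k_def[symmetric])
  have pos: "0 < (LBINT x:{1..3}. k x)"
  proof -
    \<comment> \<open>On \<open>{3/2..5/2}\<close> the bump is at least \<open>(3 / 4) ^ 3\<close>,
      and the jump kernel at least its value at distance 3.\<close>
    define b where "b = (27 / 64) * (stable_const \<alpha> * 3 powr (- 1 - \<alpha>))"
    have b: "0 < b" using c by (auto simp: b_def)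
    have kb: "b \<le> k x" if "x \<in> {3/2..5/2}" for x
    proof -
      have "\<bar>x - 2\<bar> \<le> 1 / 2" using that by (intro abs_leI) auto
      then have "\<bar>x - 2\<bar>\<^sup>2 \<le> (1 / 2)\<^sup>2" by (intro power_mono) auto
      then have "((x - 2) / 1)\<^sup>2 \<le> 1 / 4" by (simp add: power_divide)
      then have "3 / 4 \<le> max 0 (1 - ((x - 2) / 1)\<^sup>2)" unfolding le_max_iff_disj by linarith
      then have "(3 / 4) ^ 3 \<le> bump 2 1 x" unfolding bump_def by (rule power_mono) simp
      moreover have "3 powr (- 1 - \<alpha>) \<le> \<bar>x\<bar> powr (- 1 - \<alpha>)"
        using that assms by (intro powr_mono2') auto
      ultimately show ?thesis unfolding b_def k_def using c
        by (intro mult_mono mult_left_mono) (auto simp: power3_eq_cube)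
    qed
    have "b = (LBINT x. b * indicator {3/2..5/2::real} x)" by simp
    also have "integrable lborel (\<lambda>x. b * indicator {3/2..5/2::real} x)"
      by (intro integrable_mult_right integrable_real_indicator) auto
    then have "(LBINT x. b * indicator {3/2..5/2::real} x) \<le> (LBINT x:{1..3}. k x)"
      unfolding set_lebesgue_integral_def
      using int kb knn
      by (intro integral_mono) (auto simp: set_integrable_def indicator_def)
    with b show ?thesis by simp
  qed
  have "Lim (at_right 0) (\<lambda>\<epsilon>. LBINT x:{x. \<bar>x - 0\<bar> > \<epsilon>}. (bump 2 1 x - bump 2 1 0) *
      (stable_const \<alpha> * \<bar>x - 0\<bar> powr (- 1 - \<alpha>))) = (LBINT x:{1..3}. k x)"
  proof (rule tendsto_Lim)
    show "((\<lambda>\<epsilon>. LBINT x:{x. \<bar>x - 0\<bar> > \<epsilon>}. (bump 2 1 x - bump 2 1 0) *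
      (stable_const \<alpha> * \<bar>x - 0\<bar> powr (- 1 - \<alpha>))) \<longlongrightarrow> (LBINT x:{1..3}. k x)) (at_right 0)"
    proof (rule tendsto_eventually)
      show "\<forall>\<^sub>F \<epsilon> in at_right 0. (LBINT x:{x. \<bar>x - 0\<bar> > \<epsilon>}. (bump 2 1 x - bump 2 1 0) *
         (stable_const \<alpha> * \<bar>x - 0\<bar> powr (- 1 - \<alpha>))) = (LBINT x:{1..3}. k x)"
        using eq unfolding eventually_at_right_field by (intro exI[of _ 1]) auto
    qed
  qed simp
  then show ?thesis using pos assms unfolding stable_generator_def by simp
qed

text \<open>The measure with distribution function \<open>B x - F x\<close>, where \<open>F\<close> is the distribution function of \<open>M\<close>,
  completes \<open>M\<close> to \<open>B\<close> times Lebesgue measure.\<close>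

lemma (in real_distribution) emeasure_le_lborel:
  assumes B: "0 \<le> B" "\<And>a b. a < b \<Longrightarrow> measure M {a<..b} \<le> B * (b - a)"
    and X: "X \<in> sets borel"
  shows "emeasure M X \<le> ennreal B * emeasure lborel X"
proof -
  define F where "F x = B * x - cdf M x" for x
  have F_mono: "F x \<le> F y" if "x \<le> y" for x y
    using B(2)[of x y] cdf_diff_eq[of x y] that by (cases "x = y") (auto simp: F_def algebra_simps)
  have F_cont: "continuous (at_right a) F" for a
    unfolding F_def by (intro continuous_intros cdf_is_right_cont)
  define \<kappa> where "\<kappa> = measure_of UNIV (sets borel) (\<lambda>X. emeasure M X + emeasure (interval_measure F) X)"
  have em: "emeasure \<kappa> X = emeasure M X + emeasure (interval_measure F) X" if "X \<in> sets borel" for X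
    unfolding \<kappa>_def
  proof (rule emeasure_measure_of_sigma)
    show "sigma_algebra UNIV (sets (borel :: real measure))"
      using sets.sigma_algebra_axioms[of borel] by simp
    show "positive (sets borel) (\<lambda>X. emeasure M X + emeasure (interval_measure F) X)"
      by (simp add: positive_def)
    show "countably_additive (sets borel) (\<lambda>X. emeasure M X + emeasure (interval_measure F) X)"
      by (auto simp: countably_additive_def suminf_add[symmetric] suminf_emeasure)
  qed fact
  have sk: "sets \<kappa> = sets borel" unfolding \<kappa>_def
    using sigma_algebra.sigma_sets_eq[OF sets.sigma_algebra_axioms[of "borel :: real measure"]]
    by (simp add: sets_measure_of)
  have Ioc: "emeasure M {a<..b} + emeasure (interval_measure F) {a<..b} = ennreal B * emeasure lborel {a<..b}" for a b
  proof (cases "a < b")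
    case True
    have "emeasure M {a<..b} + emeasure (interval_measure F) {a<..b} = ennreal (measure M {a<..b}) + ennreal (F b - F a)"
      using True by (simp add: emeasure_interval_measure_Ioc[OF _ F_mono F_cont] emeasure_eq_measure)
    also have "\<dots> = ennreal (measure M {a<..b} + (F b - F a))"
      using F_mono[of a b] True by (intro ennreal_plus[symmetric]) auto
    also have "measure M {a<..b} + (F b - F a) = B * (b - a)"
      using cdf_diff_eq[OF True] by (simp add: F_def algebra_simps)
    finally show ?thesis using True B(1) by (simp add: ennreal_mult)
  qed simp
  have "density lborel (\<lambda>_. ennreal B) = \<kappa>"
  proof (rule measure_eqI_generator_eq[where E="range (\<lambda>(a, b). {a<..b::real})" and \<Omega>=UNIV and A="\<lambda>n::nat. {- real n<..real n}"])
    show "Int_stable (range (\<lambda>(a, b). {a<..b::real}))"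
      by (auto simp: Int_stable_def)
    show "sets (density lborel (\<lambda>_. ennreal B)) = sigma_sets UNIV (range (\<lambda>(a, b). {a<..b::real}))"
      by (simp, subst borel_sigma_sets_Ioc, simp)
    show "sets \<kappa> = sigma_sets UNIV (range (\<lambda>(a, b). {a<..b::real}))"
      by (simp add: sk, subst borel_sigma_sets_Ioc, simp)
    show "emeasure (density lborel (\<lambda>_. ennreal B)) X = emeasure \<kappa> X"
      if "X \<in> range (\<lambda>(a, b). {a<..b::real})" for X
      using that Ioc by (auto simp: em emeasure_density nn_integral_cmult)
    show "(\<Union>n::nat. {- real n<..real n}) = UNIV"
      by (auto, metis abs_le_iff abs_less_iff minus_less_iff reals_Archimedean2 less_imp_le)
    show "emeasure (density lborel (\<lambda>_. ennreal B)) {- real n<..real n} \<noteq> \<infinity>" for n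
      by (simp add: emeasure_density nn_integral_cmult ennreal_mult_eq_top_iff)
  qed auto
  then have "ennreal B * emeasure lborel X = emeasure \<kappa> X"
    using X by (metis emeasure_density_const sets_lborel)
  then show ?thesis using em[OF X] by simp
qed

text \<open>The kernel in the inversion formula has modulus at most \<open>b - a\<close>, so an
  integrable bound on the characteristic function bounds the mass of \<open>{a<..b}\<close> by a
  multiple of its length. The formula wants end points without mass. An atom is excluded afterwards:
  all but countably many points are admissible, so it can be enclosed in arbitrarily short intervals
  with such end points.\<close>

lemma (in real_distribution) bounded_by_lborel_if_char_decays:
  assumes K: "\<And>t. cmod (char M t) \<le> K * inverse (1 + t\<^sup>2)"
  obtains B where "0 \<le> B" "\<And>X. X \<in> sets borel \<Longrightarrow> emeasure M X \<le> ennreal B * emeasure lborel X"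
proof -
  have K0: "0 \<le> K" using order_trans[OF norm_ge_zero K[of 0]] by simp
  have int1: "integrable lborel (\<lambda>t::real. inverse (1 + t\<^sup>2))"
    using integrable_inverse_1_plus_square by (simp add: set_integrable_def einterval_def)
  define I where "I = (LINT t|lborel. K * inverse (1 + t\<^sup>2))"
  have I0: "0 \<le> I" unfolding I_def using K0 by (intro Bochner_Integration.integral_nonneg) auto
  have bd: "measure M {a<..b} \<le> (I / (2 * pi)) * (b - a)" if ab: "a < b" and at: "measure M {a} = 0" "measure M {b} = 0" for a b
  proof -
    have lim: "(\<lambda>T. cmod (1 / (2*pi) * (CLBINT t=-T..T. (iexp (-(t * a)) - iexp (-(t * b))) / (\<i> * t) * char M t)))
        \<longlonglongrightarrow> cmod (measure M {a<..b})"
      using Levy_Inversion[of a b] ab at by (intro tendsto_norm) auto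
    have "cmod (CLBINT t=-real T..real T. (iexp (-(t * a)) - iexp (-(t * b))) / (\<i> * t) * char M t) \<le> I * (b - a)" for T :: nat
    proof -
      have "(CLBINT t=-real T..real T. f t) = (CLBINT t. indicator {-real T<..<real T} t *\<^sub>R f t)" for f
        by (simp add: interval_lebesgue_integral_def set_lebesgue_integral_def)
      then have "cmod (CLBINT t=-real T..real T. (iexp (-(t * a)) - iexp (-(t * b))) / (\<i> * t) * char M t) \<le>
         (LINT t|lborel. norm (indicator {-real T<..<real T} t *\<^sub>R ((iexp (-(t * a)) - iexp (-(t * b))) / (\<i> * t) * char M t)))"
        by (simp only: integral_norm_bound)
      also have "\<dots> \<le> (LINT t|lborel. (b - a) * (K * inverse (1 + t\<^sup>2)))"
      proof (rule integral_mono_AE')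
        show "integrable lborel (\<lambda>t. (b - a) * (K * inverse (1 + t\<^sup>2)))" using int1 by simp
        have "AE t in lborel. t \<noteq> (0::real)" by (rule AE_lborel_singleton)
        then show "AE t in lborel. norm (indicator {-real T<..<real T} t *\<^sub>R ((iexp (-(t * a)) - iexp (-(t * b))) / (\<i> * t) * char M t)) \<le> (b - a) * (K * inverse (1 + t\<^sup>2))"
        proof eventually_elim
          case (elim t)
          have "cmod ((iexp (t * (-a)) - iexp (t * (-b))) / (\<i> * t)) \<le> (- a) - (- b)"
            by (rule Levy_Inversion_aux2) (use ab elim in auto)
          then have 1: "cmod ((iexp (-(t * a)) - iexp (-(t * b))) / (\<i> * t)) \<le> b - a" by simp
          have "norm (indicator {-real T<..<real T} t *\<^sub>R ((iexp (-(t * a)) - iexp (-(t * b))) / (\<i> * t) * char M t)) \<le>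
             norm ((iexp (-(t * a)) - iexp (-(t * b))) / (\<i> * t) * char M t)"
            by (auto simp: indicator_def)
          also have "\<dots> \<le> (b - a) * (K * inverse (1 + t\<^sup>2))"
            unfolding norm_mult by (intro mult_mono 1 K) (use ab in auto)
          finally show ?case .
        qed
      qed (use ab K0 in auto)
      also have "\<dots> = I * (b - a)" by (simp add: I_def)
      finally show ?thesis .
    qed
    then have "cmod (1 / (2*pi) * (CLBINT t=-real T..real T. (iexp (-(t * a)) - iexp (-(t * b))) / (\<i> * t) * char M t))
       \<le> (I / (2 * pi)) * (b - a)" for T :: nat
      by (simp add: norm_mult norm_divide field_simps)
    then have "cmod (measure M {a<..b}) \<le> (I / (2 * pi)) * (b - a)"
      by (intro LIMSEQ_le_const2[OF lim]) auto
    then show ?thesis by simp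
  qed
  have C: "0 \<le> I / (2 * pi)" using I0 by simp
  \<comment> \<open>The summand 1 makes the constant positive, so that it can be divided by.\<close>
  define c where "c = I / (2 * pi) + 1"
  have c: "0 < c" using C by (simp add: c_def)
  have noatom: "measure M {x} = 0" for x
  proof (rule ccontr)
    assume "measure M {x} \<noteq> 0"
    then have p: "measure M {x} > 0" by (simp add: zero_less_measure_iff)
    \<comment> \<open>Chosen so that the interval bound \<open>c * (2 * e)\<close> is half the mass
      of the atom.\<close>
    define e where "e = measure M {x} / (4 * c)"
    have e: "e > 0" using p c by (simp add: e_def)
    obtain a where a: "a \<in> {x - e<..<x} - {x. measure M {x} > 0}"
      using real_interval_avoid_countable_set[of "x - e" x, OF _ countable_atoms] e by auto
    obtain b where b: "b \<in> {x<..<x + e} - {x. measure M {x} > 0}"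
      using real_interval_avoid_countable_set[of x "x + e", OF _ countable_atoms] e by auto
    have "measure M {x} \<le> measure M {a<..b}" by (rule finite_measure_mono) (use a b in auto)
    also have "\<dots> \<le> (I / (2 * pi)) * (b - a)"
      using a b by (intro bd) (auto simp: zero_less_measure_iff)
    also have "\<dots> \<le> c * (2 * e)"
      using a b C by (intro mult_mono) (auto simp: c_def)
    also have "\<dots> = measure M {x} / 2" using c by (simp add: e_def)
    finally show False using p by simp
  qed
  show thesis
    by (rule that[OF C emeasure_le_lborel[OF C]]) (use bd noatom in auto)
qed

section \<open>The law of the stable process\<close>

locale nondegenerate_stable_process = symmetric_stable_process +
  assumes alpha: "1 < \<alpha>" "\<alpha> < 2" and r_pos: "0 < r"
begin

lemma random_variable_\<zeta>' [measurable (raw)]: "0 \<le> t \<Longrightarrow> \<zeta> t \<in> borel_measurable M"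
  by (rule random_variable_\<zeta>)

definition law :: "real \<Rightarrow> real measure" where
  "law t = distr M borel (\<zeta> t)"

lemma sets_law [simp, measurable_cong]: "sets (law t) = sets borel"
  and space_law [simp]: "space (law t) = UNIV"
  by (auto simp: law_def)

lemma prob_space_law: "0 \<le> t \<Longrightarrow> prob_space (law t)"
  unfolding law_def by (intro prob_space_distr) simp

lemma real_distribution_law: "0 \<le> t \<Longrightarrow> real_distribution (law t)"
  unfolding law_def by (intro real_distribution_distr) simp

lemma law_symmetric: "0 \<le> t \<Longrightarrow> distr (law t) borel uminus = law t"
  using symmetric_law[of t] by (simp add: law_def distr_distr o_def)

lemma increment_law: "0 \<le> s \<Longrightarrow> s \<le> t \<Longrightarrow> distr M borel (\<lambda>w. \<zeta> t w - \<zeta> s w) = law (t - s)"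
  using stationary_increments[of s "t - s"] by (simp add: law_def)

lemma indep_consecutive:
  assumes "0 \<le> s" "s \<le> t"
  shows "indep_var borel (\<lambda>w. \<zeta> s w - \<zeta> 0 w) borel (\<lambda>w. \<zeta> t w - \<zeta> s w)"
proof -
  \<comment> \<open>The times continue constantly, because the hypothesis on increments speaks of
    infinite monotone sequences.\<close>
  define T where "T i = (if i = 0 then 0 else if i = 1 then s else t)" for i :: nat
  have "mono T" using assms by (auto simp: mono_def T_def)
  from indep_increments[OF _ this, of 2]
  have "indep_vars (\<lambda>_. borel) (\<lambda>i w. \<zeta> (T (Suc i)) w - \<zeta> (T i) w) (insert 0 {1})"
    by (simp add: T_def lessThan_Suc numeral_2_eq_2 insert_commute)
  \<comment> \<open>The sum runs over the singleton \<open>{1}\<close>; this turns independence of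
    the family into independence of a pair.\<close>
  from indep_vars_sum[OF _ _ this] show ?thesis by (simp add: T_def)
qed

definition charf :: "real \<Rightarrow> real \<Rightarrow> complex" where "charf t x = char (law t) x"

lemma charf_eq: "0 \<le> t \<Longrightarrow> charf t x = (CLINT w|M. iexp (x * \<zeta> t w))"
  unfolding charf_def law_def char_def by (simp add: integral_distr)

lemma charf_add:
  assumes "0 \<le> s" "s \<le> t"
  shows "charf t x = charf s x * charf (t - s) x"
  using char_distr_add[OF indep_consecutive[OF assms], of x] assms
    increment_law[of 0 s] increment_law[of s t] increment_law[of 0 t]
  by (simp add: charf_def)

lemma charf_cnj: "0 \<le> t \<Longrightarrow> cnj (charf t x) = charf t x" "0 \<le> t \<Longrightarrow> charf t (- x) = charf t x"
proof -
  assume t: "0 \<le> t"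
  have "charf t x = char (distr M borel (\<lambda>w. - \<zeta> t w)) x"
    by (simp add: charf_def law_def symmetric_law t)
  also have "\<dots> = (CLINT w|M. iexp (x * - \<zeta> t w))"
    unfolding char_def using t by (subst integral_distr) auto
  also have "\<dots> = charf t (- x)" using t by (simp add: charf_eq)
  finally show 1: "charf t (- x) = charf t x" by simp
  have "cnj (charf t x) = (CLINT w|M. cnj (iexp (x * \<zeta> t w)))"
    unfolding charf_eq[OF t] by (rule Bochner_Integration.integral_cnj[symmetric])
  also have "\<dots> = charf t (- x)" unfolding charf_eq[OF t] by (simp add: exp_cnj)
  finally show "cnj (charf t x) = charf t x" using 1 by simp
qed

text \<open>Self-similarity trades frequency for time: the values at frequency 1, as a function of
  time, determine all others.\<close>

lemma charf_scale:
  assumes "0 < x" "0 \<le> t"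
  shows "charf t x = charf (x powr \<alpha> * t) 1"
proof -
  have "charf (x powr \<alpha> * t) 1 = char (distr M borel (\<lambda>w. (x powr \<alpha>) powr (1 / \<alpha>) * \<zeta> t w)) 1"
    using self_similar[of "x powr \<alpha>" t] assms by (simp add: charf_def law_def)
  also have "(x powr \<alpha>) powr (1 / \<alpha>) = x" using assms alpha by (simp add: powr_powr)
  also have "char (distr M borel (\<lambda>w. x * \<zeta> t w)) 1 = charf t x"
    unfolding char_def charf_eq[OF assms(2)] using assms by (subst integral_distr) auto
  finally show ?thesis by simp
qed

text \<open>Symmetry of the law makes the characteristic function real, so the real part loses
  nothing.\<close>

definition char1 :: "real \<Rightarrow> real" where "char1 t = Re (charf t 1)"

lemma charf_1: "0 \<le> t \<Longrightarrow> charf t 1 = of_real (char1 t)"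
  using charf_cnj(1)[of t 1] unfolding char1_def by (metis complex_cnj_cancel_iff complex_is_Real_iff Reals_cnj_iff of_real_Re)

lemma char1_add: "0 \<le> s \<Longrightarrow> s \<le> t \<Longrightarrow> char1 t = char1 s * char1 (t - s)"
  using charf_add[of s t 1] charf_1[of s] charf_1[of t] charf_1[of "t - s"]
  by (simp flip: of_real_mult)

text \<open>It is the square of its value at half the time.\<close>

lemma char1_nonneg: "0 \<le> t \<Longrightarrow> 0 \<le> char1 t"
  using char1_add[of "t / 2" t] by (simp add: field_simps)

lemma char1_le_1: "0 \<le> t \<Longrightarrow> char1 t \<le> 1"
  using real_distribution.cmod_char_le_1[OF real_distribution_law, of t 1] complex_Re_le_cmod[of "charf t 1"]
  by (simp add: char1_def charf_def)

lemma char1_antimono: "0 \<le> s \<Longrightarrow> s \<le> t \<Longrightarrow> char1 t \<le> char1 s"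
  using char1_add[of s t] char1_le_1[of "t - s"] char1_nonneg[of s] by (simp add: mult_left_le)

lemma char1_power: "0 \<le> t \<Longrightarrow> char1 (real n * t) \<le> char1 t ^ n"
proof (induction n)
  case 0
  then show ?case using char1_le_1[of 0] by simp
next
  case (Suc n)
  have "char1 (real (Suc n) * t) = char1 t * char1 (real n * t)"
    using char1_add[of t "real (Suc n) * t"] Suc by (simp add: algebra_simps)
  then show ?case using Suc char1_nonneg[of t] by (simp add: mult_left_mono)
qed

text \<open>Otherwise scaling makes the characteristic function 1 at all frequencies, so the process
  stays at 0 almost surely at each time. Then the difference quotients of a bump away from 0 vanish
  at the origin, although the generator is positive there.\<close>

lemma char1_less_1: "\<exists>t>0. char1 t < 1"
proof (rule ccontr)
  assume "\<not> ?thesis"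
  then have g1: "char1 t = 1" if "0 < t" for t using char1_le_1[of t] that by force
  have "charf h x = 1" if h: "0 < h" for h x
  proof -
    have pos: "charf h x = 1" if "0 < x" for x
      using charf_scale[of x h] g1[of "x powr \<alpha> * h"] charf_1[of "x powr \<alpha> * h"] h that by simp
    consider "0 < x" | "x = 0" | "0 < - x" by linarith
    then show ?thesis
    proof cases
      case 2
      then show ?thesis using real_distribution.char_zero[OF real_distribution_law, of h] h by (simp add: charf_def)
    next
      case 3
      then show ?thesis using pos[OF 3] charf_cnj(2)[of h x] h by simp
    qed (rule pos)
  qed
  moreover have "char (return borel 0) x = 1" for x :: real
    unfolding char_def by (subst integral_return) auto
  ultimately have "law h = return borel 0" if "0 < h" for h
  proof (intro Levy_uniqueness real_distribution_law ext)
    show "real_distribution (return borel 0)"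
      unfolding real_distribution_def real_distribution_axioms_def by (auto intro: prob_space_return)
  qed (use that in \<open>auto simp: charf_def\<close>)
  then have E: "expectation (\<lambda>w. bump 2 1 (0 + \<zeta> h w)) = 0" if "0 < h" for h
  proof -
    have "expectation (\<lambda>w. bump 2 1 (0 + \<zeta> h w)) = (LINT x|law h. bump 2 1 x)"
      unfolding law_def using that by (subst integral_distr) auto
    also have "\<dots> = bump 2 1 0" using that \<open>\<And>h. 0 < h \<Longrightarrow> law h = _\<close> by (simp add: integral_return)
    finally show ?thesis using bump_outside[of 1 0 2] by simp
  qed
  have "((\<lambda>h. (expectation (\<lambda>w. bump 2 1 (0 + \<zeta> h w)) - bump 2 1 0) / h) \<longlongrightarrow> stable_generator \<alpha> r (bump 2 1) 0) (at_right 0)"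
    by (rule tendsto_uniform_limitI[OF generator[OF C2_bump]]) auto
  moreover have "\<forall>\<^sub>F h in at_right 0. (expectation (\<lambda>w. bump 2 1 (0 + \<zeta> h w)) - bump 2 1 0) / h = 0"
    using E bump_outside[of 1 0 2] unfolding eventually_at_right_field by (intro exI[of _ 1]) auto
  ultimately have "((\<lambda>h::real. 0) \<longlongrightarrow> stable_generator \<alpha> r (bump 2 1) 0) (at_right 0)"
    by (rule Lim_transform_eventually)
  then have "stable_generator \<alpha> r (bump 2 1) 0 = 0" by (simp add: tendsto_const_iff)
  with stable_generator_off_support[OF alpha r_pos] show False by simp
qed

lemma char1_exponential_decay:
  obtains c K where "0 < c" "0 \<le> K" "\<And>t. 0 \<le> t \<Longrightarrow> char1 t \<le> K * exp (- c * t)"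
proof -
  obtain t0 where t0: "0 < t0" "char1 t0 < 1" using char1_less_1 by blast
  \<comment> \<open>\<open>char1 t0\<close> might be 0; the maximum with 1/2 keeps the logarithm
    meaningful.\<close>
  define \<theta> where "\<theta> = max (char1 t0) (1 / 2)"
  have th: "0 < \<theta>" "\<theta> < 1" "char1 t0 \<le> \<theta>" using t0 by (auto simp: \<theta>_def)
  define c where "c = - ln \<theta> / t0"
  have c: "0 < c" using th t0 ln_less_zero[of \<theta>] by (simp add: c_def divide_neg_pos)
  have eth: "\<theta> = exp (- c * t0)" using th t0 by (simp add: c_def)
  \<comment> \<open>The factor \<open>exp (c * t0)\<close> pays for rounding \<open>t\<close> down
    to a multiple of \<open>t0\<close>.\<close>
  have "char1 t \<le> exp (c * t0) * exp (- c * t)" if t: "0 \<le> t" for t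
  proof -
    define n where "n = nat \<lfloor>t / t0\<rfloor>"
    have "real n = of_int \<lfloor>t / t0\<rfloor>" using t t0 by (simp add: n_def)
    then have n: "real n \<le> t / t0" "t / t0 < real n + 1" by linarith+
    then have n': "real n * t0 \<le> t" "t \<le> real n * t0 + t0" using t0 by (auto simp: field_simps)
    have "char1 t \<le> char1 (real n * t0)" using n' t0 by (intro char1_antimono) auto
    also have "\<dots> \<le> char1 t0 ^ n" using t0 by (intro char1_power) auto
    also have "\<dots> \<le> \<theta> ^ n" using th char1_nonneg[of t0] t0 by (intro power_mono) auto
    also have "\<dots> = exp (- c * (real n * t0))" unfolding eth by (simp flip: exp_of_nat_mult add: algebra_simps)
    also have "\<dots> \<le> exp (c * t0 + - c * t)" using mult_left_mono[OF n'(2), of c] c by (simp add: algebra_simps)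
    also have "\<dots> = exp (c * t0) * exp (- c * t)" by (rule exp_add)
    finally show ?thesis .
  qed
  with c show thesis by (intro that[of c "exp (c * t0)"]) auto
qed

text \<open>At frequency \<open>x > 1\<close> the value is \<open>char1 (x powr \<alpha>)\<close>,
  which is at most \<open>char1 x\<close> because \<open>\<alpha> > 1\<close> and
  \<open>char1\<close> decreases. Exponential decay in time thus becomes exponential decay in
  frequency, more than the inversion bound asks for.\<close>

lemma law_1_bounded:
  obtains B where "0 \<le> B" "\<And>X. X \<in> sets borel \<Longrightarrow> emeasure (law 1) X \<le> ennreal B * emeasure lborel X"
proof -
  obtain c K where cK: "0 < c" "0 \<le> K" "\<And>t. 0 \<le> t \<Longrightarrow> char1 t \<le> K * exp (- c * t)"
    using char1_exponential_decay by blast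
  \<comment> \<open>The factor \<open>1 + 2 / c\<^sup>2\<close> compares
    \<open>1 + x\<^sup>2\<close> with the quadratic Taylor bound of \<open>exp (c * x)\<close>. The
    two additions of 1 give \<open>D \<ge> 2\<close>, which settles frequencies in
    \<open>{0<..1}\<close>.\<close>
  define D where "D = (K + 1) * (1 + 2 / c\<^sup>2) + 1"
  have D: "2 \<le> D" using cK by (auto simp: D_def algebra_simps)
  have main: "cmod (charf 1 x) \<le> D * inverse (1 + x\<^sup>2)" if x: "0 < x" for x
  proof (cases "x \<le> 1")
    case True
    have "cmod (charf 1 x) \<le> 1"
      using real_distribution.cmod_char_le_1[OF real_distribution_law, of 1] by (simp add: charf_def)
    also have "1 \<le> D * inverse (1 + x\<^sup>2)"
    proof -
      have "x\<^sup>2 \<le> 1" using True x by (simp add: power_le_one)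
      then have "1 + x\<^sup>2 \<le> D" using D by simp
      then show ?thesis by (simp add: field_simps add_pos_nonneg)
    qed
    finally show ?thesis .
  next
    case False
    have "x powr 1 \<le> x powr \<alpha>" using False alpha by (intro powr_mono) auto
    then have xa: "x \<le> x powr \<alpha>" using x by simp
    have "cmod (charf 1 x) = char1 (x powr \<alpha>)"
      using charf_scale[of x 1] charf_1[of "x powr \<alpha>"] char1_nonneg[of "x powr \<alpha>"] x by simp
    also have "\<dots> \<le> char1 x" using xa x by (intro char1_antimono) auto
    also have "\<dots> \<le> K * exp (- c * x)" using cK x by simp
    also have "\<dots> \<le> D * inverse (1 + x\<^sup>2)"
    proof -
      have cx: "1 + c * x + (c * x)\<^sup>2 / 2 \<le> exp (c * x)"
        using cK x by (intro exp_lower_Taylor_quadratic) auto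
      have "1 + x\<^sup>2 \<le> (1 + 2 / c\<^sup>2) * (1 + (c * x)\<^sup>2 / 2)"
        using cK by (simp add: field_simps power2_eq_square)
      also have "\<dots> \<le> (1 + 2 / c\<^sup>2) * exp (c * x)"
        using cx cK x by (intro mult_left_mono) (auto intro: order_trans[rotated] simp: add_nonneg_nonneg)
      finally have "K * (1 + x\<^sup>2) \<le> K * ((1 + 2 / c\<^sup>2) * exp (c * x))"
        using cK(2) by (rule mult_left_mono)
      also have "\<dots> \<le> D * exp (c * x)"
      proof -
        have "K * (1 + 2 / c\<^sup>2) \<le> D" 
          unfolding D_def by (intro add_increasing2 mult_right_mono add_nonneg_nonneg) auto
        from mult_right_mono[OF this, of "exp (c * x)"] show ?thesis by (simp add: mult.assoc)
      qed
      finally show ?thesis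
        by (simp add: exp_minus divide_simps add_pos_nonneg)
    qed
    finally show ?thesis .
  qed
  have "cmod (char (law 1) x) \<le> D * inverse (1 + x\<^sup>2)" for x
  proof -
    consider "0 < x" | "x = 0" | "0 < - x" by linarith
    then show ?thesis
    proof cases
      case 1
      then show ?thesis using main by (simp add: charf_def)
    next
      case 2
      then show ?thesis using real_distribution.char_zero[OF real_distribution_law, of 1] D by simp
    next
      case 3
      then show ?thesis using main[OF 3] charf_cnj(2)[of 1 x] by (simp add: charf_def)
    qed
  qed
  then show thesis
    using real_distribution.bounded_by_lborel_if_char_decays[OF real_distribution_law[of 1], of D] that
    by auto
qed

text \<open>A bound on the density at time 1, chosen once so that all later estimates share
  it.\<close>

definition density_bound :: real where
  "density_bound = (SOME B. 0 \<le> B \<and> (\<forall>X\<in>sets borel. emeasure (law 1) X \<le> ennreal B * emeasure lborel X))"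

lemma density_bound:
  "0 \<le> density_bound" "X \<in> sets borel \<Longrightarrow> emeasure (law 1) X \<le> ennreal density_bound * emeasure lborel X"
  using law_1_bounded someI_ex[of "\<lambda>B. 0 \<le> B \<and> (\<forall>X\<in>sets borel. emeasure (law 1) X \<le> ennreal B * emeasure lborel X)"]
  unfolding density_bound_def[symmetric] by metis+

text \<open>The law at time \<open>t\<close> is the law at time 1 dilated by
  \<open>t powr (1 / \<alpha>)\<close>, so its density shrinks by that factor. The bound blows up as
  \<open>t\<close> tends to 0.\<close>

lemma law_bounded:
  assumes t: "0 < t" and X: "X \<in> sets borel"
  shows "emeasure (law t) X \<le> ennreal (density_bound * t powr (- 1 / \<alpha>)) * emeasure lborel X"
proof -
  define a where "a = t powr (1 / \<alpha>)"
  have a: "0 < a" using t by (simp add: a_def)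
  have "law t = distr M borel (\<lambda>w. a * \<zeta> 1 w)" using self_similar[of t 1] t by (simp add: law_def a_def)
  also have "\<dots> = distr (law 1) borel (\<lambda>x. a * x)"
    unfolding law_def by (subst distr_distr) (auto simp: o_def)
  finally have "emeasure (law t) X = emeasure (law 1) ((\<lambda>x. a * x) -` X)"
    using X by (simp add: emeasure_distr)
  also have "\<dots> \<le> ennreal density_bound * emeasure lborel ((\<lambda>x. a * x) -` X)"
    using X by (intro density_bound(2)) (auto intro: measurable_sets_borel[where M=borel])
  also have "emeasure lborel ((\<lambda>x. a * x) -` X) = ennreal (1 / a) * emeasure lborel X"
  proof -
    have "emeasure lborel X = emeasure (density (distr lborel borel (\<lambda>x. 0 + a * x)) (\<lambda>_. ennreal \<bar>a\<bar>)) X"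
      by (subst lborel_real_affine[of a 0]) (use a in auto)
    also have "\<dots> = ennreal a * emeasure lborel ((\<lambda>x. a * x) -` X)"
      using X a by (simp add: emeasure_density_const emeasure_distr)
    finally show ?thesis using a
      by (simp add: mult.assoc[symmetric] ennreal_mult[symmetric])
  qed
  also have "ennreal density_bound * (ennreal (1 / a) * emeasure lborel X) = ennreal (density_bound * t powr (- 1 / \<alpha>)) * emeasure lborel X"
    using density_bound(1) a
    by (simp add: mult.assoc[symmetric] ennreal_mult[symmetric] a_def powr_minus_divide)
  finally show ?thesis .
qed

lemma nn_integral_law_le:
  assumes t: "0 < t" and [measurable]: "f \<in> borel_measurable borel"
  shows "(\<integral>\<^sup>+x. f x \<partial>law t) \<le> ennreal (density_bound * t powr (- 1 / \<alpha>)) * (\<integral>\<^sup>+x. f x \<partial>lborel)"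
proof -
  let ?c = "ennreal (density_bound * t powr (- 1 / \<alpha>))"
  have "law t \<le> density lborel (\<lambda>_. ?c)"
    using law_bounded[OF t] by (auto simp: le_measure emeasure_density_const)
  from nn_integral_mono_measure[OF _ this, of f]
  have "(\<integral>\<^sup>+x. f x \<partial>law t) \<le> (\<integral>\<^sup>+x. f x \<partial>density lborel (\<lambda>_. ?c))" by simp
  also have "\<dots> = ?c * (\<integral>\<^sup>+x. f x \<partial>lborel)" by (simp add: nn_integral_density nn_integral_cmult)
  finally show ?thesis .
qed

text \<open>The indicator of \<open>e < \<bar>x\<bar>\<close> is at most
  \<open>1 - bump 0 e x\<close>, which vanishes at 0. The expectation of the latter grows at a rate
  given by the generator, hence linearly for small \<open>h\<close>.\<close>

lemma tail_bound:
  assumes e: "0 < e"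
  obtains C h0 where "0 \<le> C" "0 < h0" "\<And>h. 0 < h \<Longrightarrow> h < h0 \<Longrightarrow> prob {w \<in> space M. e < \<bar>\<zeta> h w\<bar>} \<le> C * h"
proof -
  define L where "L = stable_generator \<alpha> r (bump 0 e) 0"
  have "((\<lambda>h. (expectation (\<lambda>w. bump 0 e (0 + \<zeta> h w)) - bump 0 e 0) / h) \<longlongrightarrow> L) (at_right 0)"
    unfolding L_def by (rule tendsto_uniform_limitI[OF generator[OF C2_bump[OF e]]]) auto
  then have "\<forall>\<^sub>F h in at_right 0. dist ((expectation (\<lambda>w. bump 0 e (0 + \<zeta> h w)) - bump 0 e 0) / h) L < 1"
    by (rule tendstoD) simp
  then obtain h0 where h0: "0 < h0" "\<And>h. 0 < h \<Longrightarrow> h < h0 \<Longrightarrow> \<bar>(expectation (\<lambda>w. bump 0 e (\<zeta> h w)) - 1) / h - L\<bar> < 1"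
    unfolding eventually_at_right_field by (auto simp: dist_real_def bump_center)
  have "prob {w \<in> space M. e < \<bar>\<zeta> h w\<bar>} \<le> (\<bar>L\<bar> + 1) * h" if h: "0 < h" "h < h0" for h
  proof -
    have [measurable]: "\<zeta> h \<in> borel_measurable M" using h by simp
    have int: "integrable M (\<lambda>w. bump 0 e (\<zeta> h w))"
      by (rule integrable_const_bound[where B=1]) (auto simp: bump_range)
    have "prob {w \<in> space M. e < \<bar>\<zeta> h w\<bar>} = expectation (indicator {w \<in> space M. e < \<bar>\<zeta> h w\<bar>})" by simp
    also have "\<dots> \<le> expectation (\<lambda>w. 1 - bump 0 e (\<zeta> h w))"
    proof (rule integral_mono)
      show "integrable M (indicator {w \<in> space M. e < \<bar>\<zeta> h w\<bar>} :: _ \<Rightarrow> real)"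
        by (rule integrable_real_indicator) (auto simp: emeasure_eq_measure)
      fix w
      show "indicator {w \<in> space M. e < \<bar>\<zeta> h w\<bar>} w \<le> 1 - bump 0 e (\<zeta> h w)"
        using bump_outside[of e "\<zeta> h w" 0] bump_range[of 0 e "\<zeta> h w"] e by (auto simp: indicator_def)
    qed (use int in auto)
    also have "\<dots> = 1 - expectation (\<lambda>w. bump 0 e (\<zeta> h w))" using int by (simp add: prob_space)
    also have "\<dots> \<le> (\<bar>L\<bar> + 1) * h"
    proof -
      have "- (\<bar>L\<bar> + 1) < (expectation (\<lambda>w. bump 0 e (\<zeta> h w)) - 1) / h" using h0(2)[OF h] by linarith
      then have "- (\<bar>L\<bar> + 1) * h < expectation (\<lambda>w. bump 0 e (\<zeta> h w)) - 1"
        using h(1) by (simp only: pos_less_divide_eq)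
      then show ?thesis by linarith
    qed
    finally show ?thesis .
  qed
  with h0(1) show thesis by (intro that[of "\<bar>L\<bar> + 1" h0]) auto
qed

end

section \<open>The transition kernel of one step\<close>

text \<open>One step with increment law \<open>\<mu>\<close>: killed if it starts or ends within
  \<open>d\<close> of 0, free if it stays on one side, and otherwise transmitted with weight
  \<open>p\<close> or reflected to the mirror image with weight \<open>q\<close>. For
  \<open>d > 0\<close> the product \<open>y * (y + x)\<close> is nonzero on surviving steps, so the
  inner else-branch is a genuine crossing.\<close>

definition interface_kernel ::
    "real \<Rightarrow> real \<Rightarrow> real \<Rightarrow> real measure \<Rightarrow> (real \<Rightarrow> ennreal) \<Rightarrow> real \<Rightarrow> ennreal" where
  "interface_kernel p q d \<mu> f y =
    (\<integral>\<^sup>+x. (if d \<le> \<bar>y\<bar> \<and> d \<le> \<bar>y + x\<bar>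
       then (if 0 < y * (y + x) then f (y + x) else ennreal p * f (y + x) + ennreal q * f (- (y + x)))
       else 0) \<partial>\<mu>)"

lemma interface_kernel_measurable [measurable]:
  assumes \<mu>: "prob_space \<mu>" "sets \<mu> = sets borel" and [measurable]: "f \<in> borel_measurable borel"
  shows "interface_kernel p q d \<mu> f \<in> borel_measurable borel"
proof -
  interpret prob_space \<mu> by fact
  note \<mu>(2)[measurable_cong]
  show ?thesis unfolding interface_kernel_def by measurable
qed

lemma nn_integral_uminus_law:
  assumes "distr \<mu> borel uminus = \<mu>" "sets \<mu> = sets (borel :: real measure)" and f: "f \<in> borel_measurable borel"
  shows "(\<integral>\<^sup>+x. f (- x) \<partial>\<mu>) = (\<integral>\<^sup>+x. f x \<partial>\<mu>)"
proof -
  note assms(2)[measurable_cong] f[measurable]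
  have "(\<integral>\<^sup>+x. f x \<partial>distr \<mu> borel uminus) = (\<integral>\<^sup>+x. f (- x) \<partial>\<mu>)"
    by (subst nn_integral_distr) auto
  then show ?thesis by (simp add: assms(1))
qed

lemma nn_integral_translate:
  fixes f :: "real \<Rightarrow> ennreal"
  assumes "f \<in> borel_measurable borel"
  shows "(\<integral>\<^sup>+y. f (y + x) \<partial>lborel) = (\<integral>\<^sup>+y. f y \<partial>lborel)"
  using nn_integral_real_affine[OF assms, of 1 x] by (simp add: add.commute)

lemma nn_integral_reflect:
  fixes f :: "real \<Rightarrow> ennreal"
  assumes "f \<in> borel_measurable borel"
  shows "(\<integral>\<^sup>+y. f (- (y + x)) \<partial>lborel) = (\<integral>\<^sup>+y. f y \<partial>lborel)"
  using nn_integral_real_affine[OF assms, of "-1" "- x"] by (simp add: algebra_simps)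

text \<open>The kernel splits into a part \<open>A\<close> without reflection and a reflected part
  \<open>B\<close>. In the first, start and end are exchanged by a translation together with
  \<open>x\<close> becoming \<open>- x\<close>. In the second, the map from \<open>y\<close> to
  \<open>- (y + x)\<close> is, for fixed \<open>x\<close>, a measure-preserving involution that
  exchanges the start with the reflected end.\<close>

lemma interface_kernel_symmetric:
  assumes \<mu>: "prob_space \<mu>" "sets \<mu> = sets borel" "distr \<mu> borel uminus = \<mu>"
    and [measurable]: "f \<in> borel_measurable borel" "g \<in> borel_measurable borel"
  shows "(\<integral>\<^sup>+y. interface_kernel p q d \<mu> f y * g y \<partial>lborel) = (\<integral>\<^sup>+y. f y * interface_kernel p q d \<mu> g y \<partial>lborel)"
proof -
  interpret prob_space \<mu> by fact
  interpret P: pair_sigma_finite lborel \<mu> ..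
  note \<mu>(2)[measurable_cong]
  define A :: "real \<Rightarrow> real \<Rightarrow> ennreal" where
    "A a b = (if d \<le> \<bar>a\<bar> \<and> d \<le> \<bar>b\<bar> then (if 0 < a * b then 1 else ennreal p) else 0)" for a b
  define B :: "real \<Rightarrow> real \<Rightarrow> ennreal" where
    "B a b = (if d \<le> \<bar>a\<bar> \<and> d \<le> \<bar>b\<bar> then (if 0 < a * b then 0 else ennreal q) else 0)" for a b
  have [measurable]: "case_prod A \<in> borel_measurable (borel \<Otimes>\<^sub>M borel)" "case_prod B \<in> borel_measurable (borel \<Otimes>\<^sub>M borel)"
    unfolding A_def[abs_def] B_def[abs_def] by measurable
  have A: "A a b = A b a" for a b by (simp add: A_def mult.commute)
  have B: "B (- b) (- a) = B a b" for a b by (auto simp add: B_def mult.commute)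
  have K: "interface_kernel p q d \<mu> f y = (\<integral>\<^sup>+x. A y (y + x) * f (y + x) + B y (y + x) * f (- (y + x)) \<partial>\<mu>)"
    for f y unfolding interface_kernel_def A_def B_def by (intro nn_integral_cong) auto
  define I1 where "I1 f g = (\<integral>\<^sup>+y. \<integral>\<^sup>+x. A y (y + x) * f (y + x) * g y \<partial>\<mu> \<partial>lborel)" for f g
  define I2 where "I2 f g = (\<integral>\<^sup>+y. \<integral>\<^sup>+x. B y (y + x) * f (- (y + x)) * g y \<partial>\<mu> \<partial>lborel)" for f g
  have split: "(\<integral>\<^sup>+y. interface_kernel p q d \<mu> f y * g y \<partial>lborel) = I1 f g + I2 f g"
    if [measurable]: "f \<in> borel_measurable borel" "g \<in> borel_measurable borel" for f g
    unfolding K I1_def I2_def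
    by (subst nn_integral_add[symmetric], measurable)
       (simp add: nn_integral_add[symmetric] nn_integral_multc[symmetric] distrib_right)
  have 1: "I1 f g = I1 g f"
  proof -
    have "I1 f g = (\<integral>\<^sup>+x. \<integral>\<^sup>+y. A y (y + x) * f (y + x) * g y \<partial>lborel \<partial>\<mu>)"
      unfolding I1_def by (rule P.Fubini'[symmetric]) measurable
    also have "\<dots> = (\<integral>\<^sup>+x. \<integral>\<^sup>+y. A (y - x) y * f y * g (y - x) \<partial>lborel \<partial>\<mu>)"
    proof (rule nn_integral_cong)
      fix x :: real
      show "(\<integral>\<^sup>+y. A y (y + x) * f (y + x) * g y \<partial>lborel) = (\<integral>\<^sup>+y. A (y - x) y * f y * g (y - x) \<partial>lborel)"
        using nn_integral_translate[of "\<lambda>y. A (y - x) y * f y * g (y - x)" x] by simp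
    qed
    also have "\<dots> = (\<integral>\<^sup>+y. \<integral>\<^sup>+x. A (y - x) y * f y * g (y - x) \<partial>\<mu> \<partial>lborel)"
      by (rule P.Fubini') measurable
    also have "\<dots> = (\<integral>\<^sup>+y. \<integral>\<^sup>+x. A (y + x) y * f y * g (y + x) \<partial>\<mu> \<partial>lborel)"
    proof (rule nn_integral_cong)
      fix y :: real
      show "(\<integral>\<^sup>+x. A (y - x) y * f y * g (y - x) \<partial>\<mu>) = (\<integral>\<^sup>+x. A (y + x) y * f y * g (y + x) \<partial>\<mu>)"
        using nn_integral_uminus_law[OF \<mu>(3,2), of "\<lambda>x. A (y + x) y * f y * g (y + x)"] by simp
    qed
    also have "\<dots> = I1 g f"
      unfolding I1_def
    proof (rule nn_integral_cong, rule nn_integral_cong)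
      fix x y :: real
      show "A (y + x) y * f y * g (y + x) = A y (y + x) * g (y + x) * f y"
        unfolding A[of "y + x" y] by (simp only: mult_ac)
    qed
    finally show ?thesis .
  qed
  have 2: "I2 f g = I2 g f"
  proof -
    have "I2 f g = (\<integral>\<^sup>+x. \<integral>\<^sup>+y. B y (y + x) * f (- (y + x)) * g y \<partial>lborel \<partial>\<mu>)"
      unfolding I2_def by (rule P.Fubini'[symmetric]) measurable
    \<comment> \<open>Substitution of \<open>- (y + x)\<close> for \<open>y\<close>; the unreflected
      end point becomes \<open>- y\<close>.\<close>
    also have "\<dots> = (\<integral>\<^sup>+x. \<integral>\<^sup>+y. B (- (y + x)) (- (y + x) + x) * f (- (- (y + x) + x)) * g (- (y + x)) \<partial>lborel \<partial>\<mu>)"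
    proof (rule nn_integral_cong)
      fix x :: real
      show "(\<integral>\<^sup>+y. B y (y + x) * f (- (y + x)) * g y \<partial>lborel) =
         (\<integral>\<^sup>+y. B (- (y + x)) (- (y + x) + x) * f (- (- (y + x) + x)) * g (- (y + x)) \<partial>lborel)"
        by (rule nn_integral_reflect[symmetric]) measurable
    qed
    also have "\<dots> = (\<integral>\<^sup>+x. \<integral>\<^sup>+y. B y (y + x) * g (- (y + x)) * f y \<partial>lborel \<partial>\<mu>)"
    proof (rule nn_integral_cong, rule nn_integral_cong)
      fix x y :: real
      have "- (y + x) + x = - y" by simp
      then show "B (- (y + x)) (- (y + x) + x) * f (- (- (y + x) + x)) * g (- (y + x)) = B y (y + x) * g (- (y + x)) * f y"
        by (simp only: B minus_minus mult_ac)
    qed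
    also have "\<dots> = I2 g f"
      unfolding I2_def by (rule P.Fubini') measurable
    finally show ?thesis .
  qed
  show ?thesis using split[of f g] split[of g f] 1 2 by (simp add: mult.commute)
qed

lemma interface_kernel_le:
  assumes \<mu>: "prob_space \<mu>" and pq: "0 \<le> p" "0 \<le> q" "p + q = 1" and f: "\<And>y. f y \<le> c"
  shows "interface_kernel p q d \<mu> f y \<le> c"
proof -
  interpret prob_space \<mu> by fact
  have "ennreal p * f a + ennreal q * f b \<le> c" for a b
  proof -
    have "ennreal p * f a + ennreal q * f b \<le> ennreal p * c + ennreal q * c"
      by (intro add_mono mult_left_mono f) auto
    also have "\<dots> = ennreal (p + q) * c" using pq(1,2) by (simp add: distrib_right)
    finally show ?thesis unfolding pq(3) by simp
  qed
  then have "interface_kernel p q d \<mu> f y \<le> (\<integral>\<^sup>+x. c \<partial>\<mu>)"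
    unfolding interface_kernel_def using f by (intro nn_integral_mono) auto
  then show ?thesis by (simp add: emeasure_space_1)
qed

lemma interface_kernel_near_0: "\<bar>y\<bar> < d \<Longrightarrow> interface_kernel p q d \<mu> f y = 0"
  by (simp add: interface_kernel_def)

section \<open>Absence of jumps from the interface\<close>

context nondegenerate_stable_process
begin

text \<open>Position and next increment are independent. The first has bounded density and must lie
  in an interval of length \<open>2 * a\<close>; the second has the law of
  \<open>\<zeta> (s' - s)\<close>.\<close>

lemma near_0_then_jump_prob:
  assumes s: "0 < s" "s < s'" and a: "0 \<le> a"
  shows "prob {w \<in> space M. \<bar>y + \<zeta> s w\<bar> < a \<and> b < \<bar>\<zeta> s' w - \<zeta> s w\<bar>} \<le>
    (density_bound * s powr (- 1 / \<alpha>) * (2 * a)) * prob {w \<in> space M. b < \<bar>\<zeta> (s' - s) w\<bar>}"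
proof -
  have [measurable]: "\<zeta> s \<in> borel_measurable M" "\<zeta> s' \<in> borel_measurable M" "\<zeta> 0 \<in> borel_measurable M"
    "\<zeta> (s' - s) \<in> borel_measurable M"
    using s by auto
  define X where "X = {x::real. \<bar>y + x\<bar> < a}"
  define Z where "Z = {x::real. b < \<bar>x\<bar>}"
  have [measurable]: "X \<in> sets borel" "Z \<in> sets borel" by (auto simp: X_def Z_def)
  \<comment> \<open>\<open>\<zeta> 0\<close> is 0 only almost surely; subtracting it makes the
    position an increment, to which independence applies.\<close>
  have "prob {w \<in> space M. \<bar>y + \<zeta> s w\<bar> < a \<and> b < \<bar>\<zeta> s' w - \<zeta> s w\<bar>} =
      prob ((\<lambda>w. (\<zeta> s w - \<zeta> 0 w, \<zeta> s' w - \<zeta> s w)) -` (X \<times> Z) \<inter> space M)"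
    using start_\<zeta> by (intro finite_measure_eq_AE) (auto simp: X_def Z_def)
  also have "\<dots> = prob ((\<lambda>w. \<zeta> s w - \<zeta> 0 w) -` X \<inter> space M) * prob ((\<lambda>w. \<zeta> s' w - \<zeta> s w) -` Z \<inter> space M)"
    using s by (intro indep_varD[OF indep_consecutive]) auto
  also have "prob ((\<lambda>w. \<zeta> s w - \<zeta> 0 w) -` X \<inter> space M) = measure (law s) X"
    using increment_law[of 0 s] s measure_distr[of "\<lambda>w. \<zeta> s w - \<zeta> 0 w" M borel X] by simp
  also have "prob ((\<lambda>w. \<zeta> s' w - \<zeta> s w) -` Z \<inter> space M) = measure (law (s' - s)) Z"
    using increment_law[of s s'] s measure_distr[of "\<lambda>w. \<zeta> s' w - \<zeta> s w" M borel Z] by simp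
  also have "measure (law (s' - s)) Z = prob {w \<in> space M. b < \<bar>\<zeta> (s' - s) w\<bar>}"
    unfolding law_def by (subst measure_distr) (auto simp: Z_def intro!: arg_cong[where f=prob])
  also have "measure (law s) X \<le> density_bound * s powr (- 1 / \<alpha>) * (2 * a)"
  proof -
    interpret L: prob_space "law s" using s by (intro prob_space_law) auto
    have "X = {- y - a<..<- y + a}" by (auto simp: X_def)
    then have "emeasure lborel X = ennreal (2 * a)" using a by simp
    then have "ennreal (measure (law s) X) \<le> ennreal (density_bound * s powr (- 1 / \<alpha>)) * ennreal (2 * a)"
      using law_bounded[of s X] s by (simp add: L.emeasure_eq_measure)
    also have "\<dots> = ennreal (density_bound * s powr (- 1 / \<alpha>) * (2 * a))"
      using density_bound(1) by (intro ennreal_mult''[symmetric]) (use a in auto)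
    finally show ?thesis using a density_bound(1) by (subst (asm) ennreal_le_iff) auto
  qed
  finally show ?thesis by (simp add: mult_right_mono)
qed

text \<open>On a grid of \<open>n\<close> steps each step contributes at most a constant times
  \<open>1 / Suc j\<close> from the position and \<open>t / n\<close> from the increment. The number
  of steps cancels in the union bound, which leaves a bound uniform in \<open>n\<close> that
  vanishes as \<open>j\<close> grows.\<close>

lemma no_jump_from_0:
  assumes t: "0 < t"
  shows "AE w in M. \<not> (\<exists>s. 0 < s \<and> s \<le> t \<and> ((\<lambda>r. y + \<zeta> r w) \<longlongrightarrow> 0) (at_left s) \<and> y + \<zeta> s w \<noteq> 0)"
proof -
  define E where "E k j n = {w \<in> space M. \<exists>i<n. 1 / real (Suc k) \<le> real i * t / real n \<and>
     \<bar>y + \<zeta> (real i * t / real n) w\<bar> < 1 / real (Suc j) \<and>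
     1 / real (Suc k) < \<bar>\<zeta> (real (Suc i) * t / real n) w - \<zeta> (real i * t / real n) w\<bar>}" for k j n :: nat
  have m [measurable]: "\<zeta> (real i * t / real n) \<in> borel_measurable M" for i n using t by simp
  have E_sets: "E k j n \<in> sets M" for k j n unfolding E_def by measurable
  \<comment> \<open>For every \<open>j\<close>, all sufficiently fine grids show a jump of size more
    than \<open>1 / Suc k\<close> from within \<open>1 / Suc j\<close> of 0. A path that jumps out
    of a left limit 0 lies in some \<open>N k\<close>.\<close>
  define N where "N k = (\<Inter>j. \<Union>m. \<Inter>n\<in>{m..}. E k j n)" for k
  have N_null: "N k \<in> null_sets M" for k
  proof -
    obtain C h0 where C: "0 \<le> C" "0 < h0"
      "\<And>h. 0 < h \<Longrightarrow> h < h0 \<Longrightarrow> prob {w \<in> space M. 1 / real (Suc k) < \<bar>\<zeta> h w\<bar>} \<le> C * h"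
      using tail_bound[of "1 / real (Suc k)"] by auto
    \<comment> \<open>Grid times in \<open>E\<close> are at least \<open>1 / Suc k\<close>, where
      the density bound is largest.\<close>
    define D where "D = density_bound * (1 / real (Suc k)) powr (- 1 / \<alpha>)"
    have D: "0 \<le> D" using density_bound(1) by (simp add: D_def)
    define b where "b j = D * (2 * (1 / real (Suc j))) * (C * t)" for j
    have b: "0 \<le> b j" for j using D C t by (simp add: b_def)
    have PE: "prob (E k j n) \<le> b j" if n: "0 < n" "t / real n < h0" for j n
    proof -
      define G where "G i = {w \<in> space M. 1 / real (Suc k) \<le> real i * t / real n \<and>
        \<bar>y + \<zeta> (real i * t / real n) w\<bar> < 1 / real (Suc j) \<and>
        1 / real (Suc k) < \<bar>\<zeta> (real (Suc i) * t / real n) w - \<zeta> (real i * t / real n) w\<bar>}" for i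
      have [measurable]: "G i \<in> sets M" for i unfolding G_def by measurable
      have "prob (G i) \<le> D * (2 * (1 / real (Suc j))) * (C * (t / real n))" for i
      proof (cases "1 / real (Suc k) \<le> real i * t / real n")
        case True
        define s where "s = real i * t / real n"
        have s0: "0 < s" using True unfolding s_def[symmetric] by (rule less_le_trans[rotated]) simp
        have d: "real (Suc i) * t / real n - s = t / real n" by (simp add: s_def field_simps diff_divide_distrib[symmetric])
        have tn: "0 < t / real n" using t n by simp
        have "prob (G i) = prob {w \<in> space M. \<bar>y + \<zeta> s w\<bar> < 1 / real (Suc j) \<and> 1 / real (Suc k) < \<bar>\<zeta> (real (Suc i) * t / real n) w - \<zeta> s w\<bar>}"
          using True unfolding G_def s_def by simp
        also have "\<dots> \<le> (density_bound * s powr (- 1 / \<alpha>) * (2 * (1 / real (Suc j)))) * prob {w \<in> space M. 1 / real (Suc k) < \<bar>\<zeta> (t / real n) w\<bar>}"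
          using near_0_then_jump_prob[of s "real (Suc i) * t / real n" "1 / real (Suc j)" y "1 / real (Suc k)"] s0 d tn by simp
        also have "\<dots> \<le> (D * (2 * (1 / real (Suc j)))) * (C * (t / real n))"
        proof (intro mult_mono C(3))
          show "density_bound * s powr (- 1 / \<alpha>) \<le> D"
            unfolding D_def using True density_bound(1) alpha
            by (intro mult_left_mono powr_mono2') (auto simp: s_def)
        qed (use tn n D density_bound(1) C in auto)
        finally show ?thesis .
      next
        case False
        then have "G i = {}" by (auto simp: G_def)
        then show ?thesis using D C t by simp
      qed
      then have "(\<Sum>i<n. prob (G i)) \<le> (\<Sum>i<n. D * (2 * (1 / real (Suc j))) * (C * (t / real n)))"
        by (intro sum_mono)
      also have "\<dots> = b j" using n by (simp add: b_def)
      finally have "(\<Sum>i<n. prob (G i)) \<le> b j" .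
      moreover have "E k j n = (\<Union>i\<in>{..<n}. G i)" by (auto simp: E_def G_def)
      ultimately show ?thesis using measure_UNION_le[of "{..<n}" G M] by (auto intro: order_trans)
    qed
    have "emeasure M (N k) \<le> ennreal (b j)" for j
    proof -
      have "(\<lambda>n. t / real n) \<longlonglongrightarrow> 0" by (rule lim_const_over_n)
      from order_tendstoD(2)[OF this C(2)] obtain n0 where n0: "\<And>n. n \<ge> n0 \<Longrightarrow> t / real n < h0"
        by (auto simp: eventually_sequentially)
      \<comment> \<open>The union over \<open>m\<close> is increasing, and each of its members lies
        in a single \<open>E k j n\<close> with \<open>n\<close> large enough for the union
        bound.\<close>
      have "emeasure M (N k) \<le> emeasure M (\<Union>m. \<Inter>n\<in>{m..}. E k j n)"
        using E_sets by (intro emeasure_mono) (auto simp: N_def)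
      also have "\<dots> = (SUP m. emeasure M (\<Inter>n\<in>{m..}. E k j n))"
        using E_sets by (intro SUP_emeasure_incseq[symmetric]) (auto simp: incseq_def)
      also have "\<dots> \<le> ennreal (b j)"
      proof (intro SUP_least)
        fix m :: nat
        define n where "n = Suc (max m n0)"
        have "emeasure M (\<Inter>n\<in>{m..}. E k j n) \<le> emeasure M (E k j n)"
          using E_sets by (intro emeasure_mono) (auto simp: n_def)
        also have "\<dots> \<le> ennreal (b j)" using PE[of n j] n0[of n] b[of j]
          by (simp add: emeasure_eq_measure n_def)
        finally show "emeasure M (\<Inter>n\<in>{m..}. E k j n) \<le> ennreal (b j)" .
      qed
      finally show ?thesis .
    qed
    moreover have "(\<lambda>j. ennreal (b j)) \<longlonglongrightarrow> ennreal (D * (2 * 0) * (C * t))"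
      unfolding b_def by (intro tendsto_intros LIMSEQ_Suc lim_1_over_n)
    ultimately have "emeasure M (N k) \<le> 0"
      by (intro LIMSEQ_le_const[of "\<lambda>j. ennreal (b j)"]) auto
    moreover have "N k \<in> sets M" unfolding N_def using E_sets by auto
    ultimately show ?thesis by auto
  qed
  have "AE w in M. \<forall>k. w \<notin> N k"
    unfolding AE_all_countable using N_null by (auto intro: AE_not_in)
  with cadlag_\<zeta> AE_space show ?thesis
  proof eventually_elim
    case (elim w)
    show ?case
    proof
      assume "\<exists>s. 0 < s \<and> s \<le> t \<and> ((\<lambda>r. y + \<zeta> r w) \<longlongrightarrow> 0) (at_left s) \<and> y + \<zeta> s w \<noteq> 0"
      then obtain s where s: "0 < s" "s \<le> t" "((\<lambda>r. y + \<zeta> r w) \<longlongrightarrow> 0) (at_left s)" "y + \<zeta> s w \<noteq> 0"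
        by blast
      from jump_from_0_on_grid[OF elim(1) s] obtain k where "\<forall>j. \<forall>\<^sub>F n in sequentially. w \<in> E k j n"
        using elim(2) by (auto simp: E_def)
      then have "w \<in> N k" by (simp add: N_def eventually_sequentially) blast
      with elim(3) show False by blast
    qed
  qed
qed

end

section \<open>The chain of signs and positions\<close>

text \<open>Backward recursion: the law \<open>\<nu> (N - 1)\<close> of the last step acts on
  \<open>f\<close> first, and the outermost argument is the starting point.\<close>

primrec chain :: "real \<Rightarrow> real \<Rightarrow> real \<Rightarrow> (nat \<Rightarrow> real measure) \<Rightarrow> nat \<Rightarrow> (real \<Rightarrow> ennreal) \<Rightarrow> real \<Rightarrow> ennreal" where
  "chain p q d \<nu> 0 f = f"
| "chain p q d \<nu> (Suc N) f = chain p q d \<nu> N (interface_kernel p q d (\<nu> N) f)"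

text \<open>The probability that the product of the first \<open>m\<close> signs is 1.\<close>

primrec plus_prob :: "real \<Rightarrow> real \<Rightarrow> nat \<Rightarrow> real" where
  "plus_prob p q 0 = 1"
| "plus_prob p q (Suc m) = p * plus_prob p q m + q * (1 - plus_prob p q m)"

lemma plus_prob_bounds:
  assumes "0 \<le> p" "0 \<le> q" "p + q = 1"
  shows "0 \<le> plus_prob p q m" "plus_prob p q m \<le> 1"
proof (induction m)
  case (Suc m)
  { case 1 then show ?case using Suc assms by simp }
  { case 2
    have "p * plus_prob p q m + q * (1 - plus_prob p q m) \<le> p * 1 + q * 1"
      using Suc assms by (intro add_mono mult_left_mono) auto
    then show ?case using assms by simp }
qed auto

definition position :: "real \<Rightarrow> (nat \<Rightarrow> real) \<Rightarrow> nat \<Rightarrow> real" where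
  "position y X i = y + (\<Sum>j<i. X j)"

lemma position_fun_upd: "i \<le> N \<Longrightarrow> position y (X(N := h)) i = position y X i"
  by (simp add: position_def)

lemma position_fun_upd_Suc: "position y (X(N := h)) (Suc N) = position y X N + h"
  by (simp add: position_def)

text \<open>Off the index set a coordinate is the constant \<open>undefined\<close>; positions of
  any index can thus be formed without side conditions.\<close>

lemma measurable_component_PiM: "(\<lambda>X. X i :: real) \<in> borel_measurable (Pi\<^sub>M I (\<lambda>_. borel))"
proof (cases "i \<in> I")
  case False
  then show ?thesis
    by (subst measurable_cong[where g="\<lambda>X. undefined"]) (auto simp: space_PiM PiE_def extensional_def)
qed simp

lemma measurable_position [measurable]: "(\<lambda>X. position y X i) \<in> borel_measurable (Pi\<^sub>M I (\<lambda>_. borel))"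
  unfolding position_def
  by (intro borel_measurable_add borel_measurable_sum borel_measurable_const measurable_component_PiM)

lemma measurable_sign_changes [measurable (raw)]:
  assumes [measurable]: "\<And>i. (\<lambda>w. x w i) \<in> borel_measurable M"
  shows "(\<lambda>w. sign_changes (x w) N) \<in> measurable M (count_space UNIV)"
  unfolding sign_changes_def by measurable

text \<open>The value of \<open>f\<close> at the reflected end point, averaged over the signs for a
  given unreflected path \<open>x\<close>.\<close>

definition reflected_value :: "real \<Rightarrow> real \<Rightarrow> real \<Rightarrow> nat \<Rightarrow> (real \<Rightarrow> ennreal) \<Rightarrow> (nat \<Rightarrow> real) \<Rightarrow> ennreal" where
  "reflected_value p q d N f x = (if \<forall>i\<le>N. d \<le> \<bar>x i\<bar>
     then ennreal (plus_prob p q (sign_changes x N)) * f (x N) + ennreal (1 - plus_prob p q (sign_changes x N)) * f (- x N)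
     else 0)"

lemma measurable_reflected_value [measurable (raw)]:
  assumes [measurable]: "\<And>i. (\<lambda>w. x w i) \<in> borel_measurable M" "f \<in> borel_measurable borel"
  shows "(\<lambda>w. reflected_value p q d N f (x w)) \<in> borel_measurable M"
  unfolding reflected_value_def by measurable

text \<open>One step of the chain, conditionally on the past: reflecting the past reflects the future,
  because the increment is symmetric.\<close>

lemma reflected_value_step:
  assumes \<mu>: "prob_space \<mu>" "sets \<mu> = sets borel" "distr \<mu> borel uminus = \<mu>"
    and pq: "0 \<le> p" "0 \<le> q" "p + q = 1" and d: "0 < d"
    and f [measurable]: "f \<in> borel_measurable borel"
  shows "(\<integral>\<^sup>+h. reflected_value p q d (Suc N) f (position y (X(N := h))) \<partial>\<mu>) =
    reflected_value p q d N (interface_kernel p q d \<mu> f) (position y X)"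
proof -
  interpret prob_space \<mu> by fact
  note \<mu>(2)[measurable_cong]
  define s where "s = position y X N"
  define c where "c = sign_changes (position y X) N"
  define a where "a = plus_prob p q c"
  have a: "0 \<le> a" "a \<le> 1" using plus_prob_bounds[OF pq] by (auto simp: a_def)
  have c': "sign_changes (position y (X(N := h))) (Suc N) = (if s * (s + h) < 0 then Suc c else c)" for h
    by (simp add: sign_changes_def position_fun_upd position_fun_upd_Suc c_def s_def)
  show ?thesis
  proof (cases "\<forall>i\<le>N. d \<le> \<bar>position y X i\<bar>")
    case False
    then have "\<not> (\<forall>i\<le>Suc N. d \<le> \<bar>position y (X(N := h)) i\<bar>)" for h
      by (auto simp: position_fun_upd le_Suc_eq)
    then have "reflected_value p q d (Suc N) f (position y (X(N := h))) = 0" for h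
      unfolding reflected_value_def by (rule if_not_P)
    moreover have "reflected_value p q d N (interface_kernel p q d \<mu> f) (position y X) = 0"
      unfolding reflected_value_def using False by (rule if_not_P)
    ultimately show ?thesis by simp
  next
    case True
    then have ds: "d \<le> \<bar>s\<bar>" by (auto simp: s_def)
    \<comment> \<open>\<open>F\<close> and \<open>G\<close> are the integrands of the kernel at
      \<open>s\<close> and at \<open>- s\<close>, both expressed by the increment \<open>h\<close>
      from \<open>s\<close>. For the start \<open>- s\<close> the increment is \<open>- h\<close>,
      which has the same law.\<close>
    define F where "F h = (if d \<le> \<bar>s + h\<bar> then (if 0 < s * (s + h) then f (s + h) else ennreal p * f (s + h) + ennreal q * f (- (s + h))) else 0)" for h
    define G where "G h = (if d \<le> \<bar>s + h\<bar> then (if 0 < s * (s + h) then f (- (s + h)) else ennreal p * f (- (s + h)) + ennreal q * f (s + h)) else 0)" for h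
    have [measurable]: "F \<in> borel_measurable borel" "G \<in> borel_measurable borel"
      unfolding F_def G_def by measurable
    have Ks: "interface_kernel p q d \<mu> f s = (\<integral>\<^sup>+h. F h \<partial>\<mu>)"
      unfolding interface_kernel_def F_def using ds by simp
    have "interface_kernel p q d \<mu> f (- s) = (\<integral>\<^sup>+h. G (- h) \<partial>\<mu>)"
      unfolding interface_kernel_def G_def
    proof (rule nn_integral_cong)
      fix h
      have "- s * (- s + h) = s * (s + - h)" "- s + h = - (s + - h)" by (simp_all add: algebra_simps)
      then show "(if d \<le> \<bar>- s\<bar> \<and> d \<le> \<bar>- s + h\<bar>
          then if 0 < - s * (- s + h) then f (- s + h) else ennreal p * f (- s + h) + ennreal q * f (- (- s + h)) else 0) =
        (if d \<le> \<bar>s + - h\<bar> then if 0 < s * (s + - h) then f (- (s + - h)) else ennreal p * f (- (s + - h)) + ennreal q * f (s + - h) else 0)"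
        using ds by (simp only: abs_minus_cancel minus_minus simp_thms)
    qed
    also have "\<dots> = (\<integral>\<^sup>+h. G h \<partial>\<mu>)" by (rule nn_integral_uminus_law[OF \<mu>(3,2)]) measurable
    finally have Kms: "interface_kernel p q d \<mu> f (- s) = (\<integral>\<^sup>+h. G h \<partial>\<mu>)" .
    have "reflected_value p q d (Suc N) f (position y (X(N := h))) = ennreal a * F h + ennreal (1 - a) * G h" for h
    proof (cases "d \<le> \<bar>s + h\<bar>")
      case False
      then have "\<not> (\<forall>i\<le>Suc N. d \<le> \<bar>position y (X(N := h)) i\<bar>)"
        by (auto simp: position_fun_upd_Suc s_def intro!: exI[of _ "Suc N"])
      then have "reflected_value p q d (Suc N) f (position y (X(N := h))) = 0"
        unfolding reflected_value_def by (rule if_not_P)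
      with False show ?thesis by (simp add: F_def G_def)
    next
      case dh: True
      with True have all: "\<forall>i\<le>Suc N. d \<le> \<bar>position y (X(N := h)) i\<bar>"
        by (auto simp: le_Suc_eq position_fun_upd position_fun_upd_Suc s_def)
      have R: "reflected_value p q d (Suc N) f (position y (X(N := h))) =
          ennreal (plus_prob p q (if s * (s + h) < 0 then Suc c else c)) * f (s + h)
        + ennreal (1 - plus_prob p q (if s * (s + h) < 0 then Suc c else c)) * f (- (s + h))"
        unfolding reflected_value_def c' position_fun_upd_Suc s_def[symmetric] using all by simp
      have nz: "s * (s + h) \<noteq> 0" using ds dh d by auto
      show ?thesis
      proof (cases "s * (s + h) < 0")
        case False
        with nz have "0 < s * (s + h)" using linorder_less_linear[of "s * (s + h)" 0] by blast
        with False dh show ?thesis by (simp add: R F_def G_def a_def)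
      next
        case neg: True
        \<comment> \<open>At a crossing the two weights are mixed by \<open>p\<close> and
          \<open>q\<close>; \<open>p1\<close> is the recursion of \<open>plus_prob\<close>,
          \<open>p2\<close> that of its complement.\<close>
        have p1: "ennreal (p * a + q * (1 - a)) = ennreal p * ennreal a + ennreal q * ennreal (1 - a)"
          using pq a by (simp add: ennreal_plus ennreal_mult)
        have "1 - (p * a + q * (1 - a)) = q * a + p * (1 - a)"
        proof -
          have "q = 1 - p" using pq by simp
          then show ?thesis by (simp add: algebra_simps)
        qed
        then have p2: "ennreal (1 - (p * a + q * (1 - a))) = ennreal q * ennreal a + ennreal p * ennreal (1 - a)"
          using pq a by (simp add: ennreal_plus ennreal_mult)
        show ?thesis using neg dh
          by (simp add: R F_def G_def p1 p2 flip: a_def) (simp add: algebra_simps)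
      qed
    qed
    then have "(\<integral>\<^sup>+h. reflected_value p q d (Suc N) f (position y (X(N := h))) \<partial>\<mu>) =
       ennreal a * (\<integral>\<^sup>+h. F h \<partial>\<mu>) + ennreal (1 - a) * (\<integral>\<^sup>+h. G h \<partial>\<mu>)"
      by (simp add: nn_integral_add nn_integral_cmult)
    also have "\<dots> = reflected_value p q d N (interface_kernel p q d \<mu> f) (position y X)"
      using True by (simp add: reflected_value_def Ks Kms flip: a_def s_def c_def)
    finally show ?thesis .
  qed
qed

text \<open>The last increment is integrated out and absorbed into \<open>f\<close> as one
  application of the kernel, so the induction runs over arbitrary \<open>f\<close>. The condition on
  \<open>y\<close> serves the chain without steps, which does not kill.\<close>

lemma chain_eq_PiM_integral:
  assumes \<nu>: "\<And>i. prob_space (\<nu> i)" "\<And>i. sets (\<nu> i) = sets borel" "\<And>i. distr (\<nu> i) borel uminus = \<nu> i"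
    and pq: "0 \<le> p" "0 \<le> q" "p + q = 1" and d: "0 < d" "d \<le> \<bar>y\<bar>"
    and f: "f \<in> borel_measurable borel"
  shows "(\<integral>\<^sup>+X. reflected_value p q d N f (position y X) \<partial>Pi\<^sub>M {..<N} \<nu>) = chain p q d \<nu> N f y"
  using f
proof (induction N arbitrary: f)
  case 0
  then show ?case
    by (simp add: PiM_empty reflected_value_def position_def sign_changes_def d)
next
  case (Suc N)
  note [measurable] = Suc.prems
  interpret product_sigma_finite \<nu>
    by (auto simp: product_sigma_finite_def \<nu> prob_space_imp_sigma_finite)
  have s: "sets (Pi\<^sub>M I \<nu>) = sets (Pi\<^sub>M I (\<lambda>_. borel))" for I
    using \<nu>(2) by (intro sets_PiM_cong) auto
  have "(\<integral>\<^sup>+X. reflected_value p q d (Suc N) f (position y X) \<partial>Pi\<^sub>M {..<Suc N} \<nu>) =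
     (\<integral>\<^sup>+X. (\<integral>\<^sup>+h. reflected_value p q d (Suc N) f (position y (X(N := h))) \<partial>\<nu> N) \<partial>Pi\<^sub>M {..<N} \<nu>)"
    unfolding lessThan_Suc
    by (rule product_nn_integral_insert) (auto simp: measurable_cong_sets[OF s refl])
  also have "\<dots> = (\<integral>\<^sup>+X. reflected_value p q d N (interface_kernel p q d (\<nu> N) f) (position y X) \<partial>Pi\<^sub>M {..<N} \<nu>)"
    by (intro nn_integral_cong reflected_value_step \<nu> pq d Suc.prems)
  also have "\<dots> = chain p q d \<nu> (Suc N) f y"
    by (simp add: Suc.IH interface_kernel_measurable \<nu> Suc.prems)
  finally show ?case .
qed

lemma chain_add: "chain p q d \<nu> (N + N') f = chain p q d \<nu> N (chain p q d (\<lambda>i. \<nu> (N + i)) N' f)"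
  by (induction N' arbitrary: f) auto

lemma chain_cong: "(\<And>i. i < N \<Longrightarrow> \<nu> i = \<nu>' i) \<Longrightarrow> chain p q d \<nu> N f = chain p q d \<nu>' N f"
  by (induction N arbitrary: f) auto

lemma chain_measurable:
  assumes "\<And>i. prob_space (\<nu> i)" "\<And>i. sets (\<nu> i) = sets borel" "f \<in> borel_measurable borel"
  shows "chain p q d \<nu> N f \<in> borel_measurable borel"
  using assms(3) by (induction N arbitrary: f) (auto intro!: interface_kernel_measurable assms(1,2))

lemma chain_le:
  assumes "\<And>i. prob_space (\<nu> i)" and pq: "0 \<le> p" "0 \<le> q" "p + q = 1" and f: "\<And>y. f y \<le> c"
  shows "chain p q d \<nu> N f y \<le> c"
  using f by (induction N arbitrary: f) (auto intro!: interface_kernel_le assms)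

lemma chain_near_0: "\<bar>y\<bar> < d \<Longrightarrow> 0 < N \<Longrightarrow> chain p q d \<nu> N f y = 0"
proof (induction N arbitrary: f)
  case (Suc N)
  then show ?case by (cases N) (auto simp: interface_kernel_near_0)
qed simp

text \<open>With one common step law the kernel commutes with its own powers, so symmetry of one
  step can be applied on either end of the chain.\<close>

lemma chain_const_symmetric:
  assumes \<mu>: "prob_space \<mu>" "sets \<mu> = sets borel" "distr \<mu> borel uminus = \<mu>"
    and f: "f \<in> borel_measurable borel" "g \<in> borel_measurable borel"
  shows "(\<integral>\<^sup>+y. chain p q d (\<lambda>_. \<mu>) N f y * g y \<partial>lborel) = (\<integral>\<^sup>+y. f y * chain p q d (\<lambda>_. \<mu>) N g y \<partial>lborel)"
  using f
proof (induction N arbitrary: f g)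
  case (Suc N)
  let ?K = "interface_kernel p q d \<mu>" and ?c = "chain p q d (\<lambda>_. \<mu>) N"
  have Kc: "?K (?c g) = ?c (?K g)" for g
    by (induction N arbitrary: g) auto
  have "(\<integral>\<^sup>+y. chain p q d (\<lambda>_. \<mu>) (Suc N) f y * g y \<partial>lborel) = (\<integral>\<^sup>+y. ?K f y * ?c g y \<partial>lborel)"
    using Suc by (simp add: interface_kernel_measurable \<mu>)
  also have "\<dots> = (\<integral>\<^sup>+y. f y * ?K (?c g) y \<partial>lborel)"
    by (intro interface_kernel_symmetric \<mu> Suc.prems chain_measurable)
  finally show ?case by (simp add: Kc)
qed simp

section \<open>The process on a grid\<close>

locale interface_process =
  nondegenerate_stable_process M \<zeta> \<alpha> r + interface_signs M \<zeta> \<sigma> p q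
  for M :: "'w measure" and \<zeta> \<alpha> r \<sigma> p q +
  assumes pq_sum: "p + q = 1"
begin

lemma pq_nonneg: "0 \<le> p" "0 \<le> q"
  using sign_law(1)[of 1, symmetric] sign_law(2)[of 1, symmetric] by auto

lemmas pq = pq_nonneg pq_sum

section \<open>Integrating out the signs\<close>

definition sigma_\<zeta> :: "'w measure" where
  "sigma_\<zeta> = vimage_algebra (space M) (\<lambda>w. \<lambda>t\<in>{0..}. \<zeta> t w) (Pi\<^sub>M {0..} (\<lambda>_. borel))"

definition sigma_signs :: "'w measure" where
  "sigma_signs = vimage_algebra (space M) (\<lambda>w. \<lambda>m\<in>{1..}. \<sigma> m w) (Pi\<^sub>M {1..} (\<lambda>_. borel))"

lemma space_sigma [simp]: "space sigma_\<zeta> = space M" "space sigma_signs = space M"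
  by (auto simp: sigma_\<zeta>_def sigma_signs_def)

lemma sets_sigma: "sets sigma_\<zeta> \<subseteq> sets M" "sets sigma_signs \<subseteq> sets M"
  using indep_setD_ev1[OF signs_indep_\<zeta>] indep_setD_ev2[OF signs_indep_\<zeta>]
  by (auto simp: sigma_\<zeta>_def sigma_signs_def)

lemma measurable_sigma_imp: "X \<in> measurable sigma_\<zeta> N \<Longrightarrow> X \<in> measurable M N"
    "X \<in> measurable sigma_signs N \<Longrightarrow> X \<in> measurable M N"
  using sets_sigma by (auto simp: measurable_def)

lemma measurable_\<zeta>_sigma: "0 \<le> t \<Longrightarrow> \<zeta> t \<in> borel_measurable sigma_\<zeta>"
proof -
  assume t: "0 \<le> t"
  have "(\<lambda>w. \<lambda>t\<in>{0..}. \<zeta> t w) \<in> measurable sigma_\<zeta> (Pi\<^sub>M {0..} (\<lambda>_. borel))"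
    unfolding sigma_\<zeta>_def by (rule measurable_vimage_algebra1) (auto simp: space_PiM)
  from measurable_compose[OF this measurable_component_singleton[of t]] t show ?thesis by simp
qed

lemma measurable_\<sigma>_sigma: "\<sigma> m \<in> borel_measurable sigma_signs"
proof (cases "m = 0")
  case True
  have "(\<sigma> 0 \<in> borel_measurable sigma_signs) \<longleftrightarrow> ((\<lambda>_. 1 :: real) \<in> borel_measurable sigma_signs)"
    by (intro measurable_cong) (auto simp: sign_0)
  with True show ?thesis by simp
next
  case False
  have "(\<lambda>w. \<lambda>m\<in>{1..}. \<sigma> m w) \<in> measurable sigma_signs (Pi\<^sub>M {1..} (\<lambda>_. borel))"
    unfolding sigma_signs_def by (rule measurable_vimage_algebra1) (auto simp: space_PiM)
  from measurable_compose[OF this measurable_component_singleton[of m]] False show ?thesis by simp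
qed

lemma measurable_\<sigma> [measurable]: "\<sigma> m \<in> borel_measurable M"
  by (rule measurable_sigma_imp(2)[OF measurable_\<sigma>_sigma])

text \<open>Induction over measurable functions extends the product rule from path events to
  nonnegative path functions.\<close>

lemma nn_integral_indep_signs:
  assumes X: "X \<in> borel_measurable sigma_\<zeta>" and B: "B \<in> sets sigma_signs"
  shows "(\<integral>\<^sup>+w. X w * indicator B w \<partial>M) = (\<integral>\<^sup>+w. X w \<partial>M) * emeasure M B"
  using X
proof (induction rule: borel_measurable_induct)
  case (cong f g)
  have "(\<integral>\<^sup>+w. f w * indicator B w \<partial>M) = (\<integral>\<^sup>+w. g w * indicator B w \<partial>M)"
    and "(\<integral>\<^sup>+w. f w \<partial>M) = (\<integral>\<^sup>+w. g w \<partial>M)"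
    using cong(3) by (auto intro!: nn_integral_cong)
  then show ?case using cong(4) by (simp only:)
next
  case (set A)
  have [measurable]: "A \<in> sets M" "B \<in> sets M" using set B sets_sigma by auto
  have "prob (A \<inter> B) = prob A * prob B"
    using indep_setD[OF signs_indep_\<zeta>] set B by (auto simp: sigma_\<zeta>_def sigma_signs_def)
  then show ?case
    by (simp add: indicator_inter_arith[symmetric] emeasure_eq_measure ennreal_mult')
next
  case (mult u c)
  have [measurable]: "u \<in> borel_measurable M" "B \<in> sets M"
    using mult B sets_sigma by (auto intro: measurable_sigma_imp)
  show ?case using mult by (simp add: mult.assoc nn_integral_cmult)
next
  case (add u v)
  have [measurable]: "u \<in> borel_measurable M" "v \<in> borel_measurable M" "B \<in> sets M"
    using add B sets_sigma by (auto intro: measurable_sigma_imp)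
  show ?case using add by (simp add: distrib_right nn_integral_add)
next
  case (seq U)
  have [measurable]: "U i \<in> borel_measurable M" "B \<in> sets M" for i
    using seq B sets_sigma by (auto intro: measurable_sigma_imp)
  have "(\<integral>\<^sup>+w. (SUP i. U i) w * indicator B w \<partial>M) = (\<integral>\<^sup>+w. (SUP i. U i w * indicator B w) \<partial>M)"
    by (simp add: SUP_mult_right_ennreal image_comp)
  also have "\<dots> = (SUP i. \<integral>\<^sup>+w. U i w * indicator B w \<partial>M)"
    using seq by (intro nn_integral_monotone_convergence_SUP)
      (auto simp: incseq_def le_fun_def intro!: mult_right_mono)
  also have "\<dots> = (SUP i. (\<integral>\<^sup>+w. U i w \<partial>M) * emeasure M B)" using seq by simp
  also have "\<dots> = (SUP i. (\<integral>\<^sup>+w. U i w \<partial>M)) * emeasure M B" by (simp add: SUP_mult_right_ennreal)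
  also have "(SUP i. (\<integral>\<^sup>+w. U i w \<partial>M)) = (\<integral>\<^sup>+w. (SUP i. U i w) \<partial>M)"
    using seq by (intro nn_integral_monotone_convergence_SUP[symmetric]) auto
  finally show ?case by (simp add: image_comp)
qed

definition sign_prod :: "nat \<Rightarrow> 'w \<Rightarrow> real" where
  "sign_prod m w = (\<Prod>j\<le>m. \<sigma> j w)"

lemma measurable_sign_prod_sigma: "sign_prod m \<in> borel_measurable sigma_signs"
  unfolding sign_prod_def by (intro borel_measurable_prod measurable_\<sigma>_sigma)

lemma measurable_sign_prod [measurable]: "sign_prod m \<in> borel_measurable M"
  by (rule measurable_sigma_imp(2)[OF measurable_sign_prod_sigma])

lemma AE_sign: "1 \<le> m \<Longrightarrow> AE w in M. \<sigma> m w = 1 \<or> \<sigma> m w = - 1"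
proof -
  assume m: "1 \<le> m"
  have "prob ({w \<in> space M. \<sigma> m w = 1} \<union> {w \<in> space M. \<sigma> m w = - 1}) = p + q"
    using sign_law[OF m] by (subst finite_measure_Union) auto
  then have "prob {w \<in> space M. \<sigma> m w = 1 \<or> \<sigma> m w = - 1} = 1"
    by (simp add: pq Collect_disj_eq[symmetric] conj_disj_distribL)
  then show ?thesis by (subst (asm) prob_eq_1) auto
qed

lemma AE_sign_prod: "AE w in M. sign_prod m w = 1 \<or> sign_prod m w = - 1"
proof (induction m)
  case 0
  show ?case using AE_space by eventually_elim (simp add: sign_prod_def sign_0)
next
  case (Suc m)
  from Suc AE_sign[of "Suc m", simplified] show ?case
    by eventually_elim (auto simp: sign_prod_def)
qed

lemma indep_next_sign: "indep_var borel (\<sigma> (Suc m)) borel (sign_prod m)"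
proof -
  have "indep_vars (\<lambda>_. borel) \<sigma> (insert (Suc m) {1..m})"
    by (rule indep_vars_subset[OF indep_signs]) auto
  from indep_vars_prod[OF _ _ this] have "indep_var borel (\<sigma> (Suc m)) borel (\<lambda>w. \<Prod>j\<in>{1..m}. \<sigma> j w)" by simp
  moreover have "(\<Prod>j\<in>{1..m}. \<sigma> j w) = sign_prod m w" if "w \<in> space M" for w
  proof -
    have "{..m} = insert 0 {1..m}" by auto
    then show ?thesis using sign_0[OF that] by (simp add: sign_prod_def)
  qed
  ultimately show ?thesis
    unfolding indep_var_eq by (auto cong: vimage_inter_cong measurable_cong)
qed

lemma sign_prod_law:
  "prob {w \<in> space M. sign_prod m w = 1} = plus_prob p q m"
  "prob {w \<in> space M. sign_prod m w = - 1} = 1 - plus_prob p q m"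
proof (induction m)
  case 0
  have "{w \<in> space M. sign_prod 0 w = 1} = space M" "{w \<in> space M. sign_prod 0 w = - 1} = {}"
    by (auto simp: sign_prod_def sign_0)
  then show "prob {w \<in> space M. sign_prod 0 w = 1} = plus_prob p q 0"
    "prob {w \<in> space M. sign_prod 0 w = - 1} = 1 - plus_prob p q 0"
    by (simp_all only: prob_space measure_empty plus_prob.simps diff_self)
next
  case (Suc m)
  have ind: "prob {w \<in> space M. \<sigma> (Suc m) w = a \<and> sign_prod m w = b} =
      prob {w \<in> space M. \<sigma> (Suc m) w = a} * prob {w \<in> space M. sign_prod m w = b}" for a b
  proof -
    have "{w \<in> space M. \<sigma> (Suc m) w = a \<and> sign_prod m w = b} = (\<lambda>w. (\<sigma> (Suc m) w, sign_prod m w)) -` ({a} \<times> {b}) \<inter> space M"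
      "{w \<in> space M. \<sigma> (Suc m) w = a} = \<sigma> (Suc m) -` {a} \<inter> space M"
      "{w \<in> space M. sign_prod m w = b} = sign_prod m -` {b} \<inter> space M" by auto
    then show ?thesis using indep_varD[OF indep_next_sign, of "{a}" "{b}" m] by simp
  qed
  have "AE w in M. sign_prod (Suc m) w = 1 \<longleftrightarrow> (\<sigma> (Suc m) w = 1 \<and> sign_prod m w = 1) \<or> (\<sigma> (Suc m) w = - 1 \<and> sign_prod m w = - 1)"
    using AE_sign[of "Suc m", simplified] AE_sign_prod[of m]
    by eventually_elim (auto simp: sign_prod_def)
  then have "prob {w \<in> space M. sign_prod (Suc m) w = 1} =
    prob ({w \<in> space M. \<sigma> (Suc m) w = 1 \<and> sign_prod m w = 1} \<union> {w \<in> space M. \<sigma> (Suc m) w = - 1 \<and> sign_prod m w = - 1})"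
    by (intro finite_measure_eq_AE) auto
  also have "\<dots> = p * plus_prob p q m + q * (1 - plus_prob p q m)"
    using Suc by (subst finite_measure_Union) (auto simp: ind sign_law)
  finally show 1: "prob {w \<in> space M. sign_prod (Suc m) w = 1} = plus_prob p q (Suc m)" by simp
  have "prob ({w \<in> space M. sign_prod (Suc m) w = 1} \<union> {w \<in> space M. sign_prod (Suc m) w = - 1}) = 1"
    using AE_sign_prod[of "Suc m"] by (subst prob_eq_1) auto
  then show "prob {w \<in> space M. sign_prod (Suc m) w = - 1} = 1 - plus_prob p q (Suc m)"
    using 1 by (subst (asm) finite_measure_Union) auto
qed

text \<open>The number \<open>C\<close> of signs used is itself random, but it depends on the path
  alone. Splitting by its value \<open>m\<close> and by the value of the product turns each term
  into a path function times a sign event, and these are independent.\<close>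

lemma nn_integral_random_sign:
  assumes Y: "Y \<in> borel_measurable sigma_\<zeta>" and C: "C \<in> measurable sigma_\<zeta> (count_space UNIV)"
    and A: "{w \<in> space sigma_\<zeta>. A w} \<in> sets sigma_\<zeta>" and f [measurable]: "f \<in> borel_measurable borel"
  shows "(\<integral>\<^sup>+w. (if A w then f (sign_prod (C w) w * Y w) else 0) \<partial>M) =
    (\<integral>\<^sup>+w. (if A w then ennreal (plus_prob p q (C w)) * f (Y w) + ennreal (1 - plus_prob p q (C w)) * f (- Y w) else 0) \<partial>M)"
proof -
  note YC[measurable] = Y C A
  have suminf_if: "(\<Sum>m. if c = m then g m else 0) = (g c :: ennreal)" for c :: nat and g
    using sums_unique[OF sums_single[where i=c and f=g]] by (simp add: eq_commute)
  have Y_M [measurable]: "Y \<in> borel_measurable M" and C_M [measurable]: "C \<in> measurable M (count_space UNIV)"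
    and A_M [measurable]: "{w \<in> space M. A w} \<in> sets M"
    using measurable_sigma_imp(1)[OF Y] measurable_sigma_imp(1)[OF C] A sets_sigma by auto
  define X where "X s m w = (if A w \<and> C w = m then f (s * Y w) else 0)" for s m w
  have X [measurable]: "X s m \<in> borel_measurable sigma_\<zeta>" for s m unfolding X_def by measurable
  have X_M [measurable]: "X s m \<in> borel_measurable M" for s m by (rule measurable_sigma_imp(1)[OF X])
  define B where "B s m = {w \<in> space M. sign_prod m w = s}" for s m
  have B: "B s m \<in> sets sigma_signs" for s m
    using measurable_sets[OF measurable_sign_prod_sigma[of m], of "{s}"] by (simp add: B_def vimage_def Collect_conj_eq Int_commute)
  have [measurable]: "B s m \<in> sets M" for s m using B sets_sigma by auto
  have signs: "AE w in M. \<forall>m. sign_prod m w = 1 \<or> sign_prod m w = - 1"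
    unfolding AE_all_countable using AE_sign_prod by blast
  have "(\<integral>\<^sup>+w. (if A w then f (sign_prod (C w) w * Y w) else 0) \<partial>M) =
     (\<integral>\<^sup>+w. (\<Sum>m. X 1 m w * indicator (B 1 m) w + X (- 1) m w * indicator (B (- 1) m) w) \<partial>M)"
  proof (rule nn_integral_cong_AE, use AE_space signs in eventually_elim)
    case (elim w)
    have "(\<Sum>m. X 1 m w * indicator (B 1 m) w + X (- 1) m w * indicator (B (- 1) m) w) =
       (\<Sum>m. if C w = m then (if A w then f (sign_prod m w * Y w) else 0) else 0)"
    proof (intro suminf_cong)
      fix m
      show "X 1 m w * indicator (B 1 m) w + X (- 1) m w * indicator (B (- 1) m) w =
         (if C w = m then (if A w then f (sign_prod m w * Y w) else 0) else 0)"
        using elim(2)[rule_format, of m] elim(1) by (auto simp: X_def B_def)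
    qed
    also have "\<dots> = (if A w then f (sign_prod (C w) w * Y w) else 0)" by (rule suminf_if)
    finally show ?case by simp
  qed
  also have "\<dots> = (\<Sum>m. (\<integral>\<^sup>+w. X 1 m w * indicator (B 1 m) w \<partial>M) + (\<integral>\<^sup>+w. X (- 1) m w * indicator (B (- 1) m) w \<partial>M))"
    by (simp add: nn_integral_suminf nn_integral_add)
  also have "\<dots> = (\<Sum>m. (\<integral>\<^sup>+w. ennreal (plus_prob p q m) * X 1 m w + ennreal (1 - plus_prob p q m) * X (- 1) m w \<partial>M))"
    by (simp add: nn_integral_indep_signs[OF X B] nn_integral_add nn_integral_cmult emeasure_eq_measure)
       (simp add: B_def sign_prod_law mult.commute)
  also have "\<dots> = (\<integral>\<^sup>+w. (\<Sum>m. ennreal (plus_prob p q m) * X 1 m w + ennreal (1 - plus_prob p q m) * X (- 1) m w) \<partial>M)"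
    by (simp add: nn_integral_suminf)
  also have "\<dots> = (\<integral>\<^sup>+w. (if A w then ennreal (plus_prob p q (C w)) * f (Y w) + ennreal (1 - plus_prob p q (C w)) * f (- Y w) else 0) \<partial>M)"
  proof (intro nn_integral_cong)
    fix w
    have "(\<Sum>m. ennreal (plus_prob p q m) * X 1 m w + ennreal (1 - plus_prob p q m) * X (- 1) m w) =
       (\<Sum>m. if C w = m then (if A w then ennreal (plus_prob p q m) * f (Y w) + ennreal (1 - plus_prob p q m) * f (- Y w) else 0) else 0)"
      by (intro suminf_cong) (auto simp: X_def)
    then show "(\<Sum>m. ennreal (plus_prob p q m) * X 1 m w + ennreal (1 - plus_prob p q m) * X (- 1) m w) =
      (if A w then ennreal (plus_prob p q (C w)) * f (Y w) + ennreal (1 - plus_prob p q (C w)) * f (- Y w) else 0)"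
      by (simp only: suminf_if)
  qed
  finally show ?thesis .
qed

definition step_laws :: "(nat \<Rightarrow> real) \<Rightarrow> nat \<Rightarrow> real measure" where
  "step_laws g i = law (g (Suc i) - g i)"

lemma step_laws:
  assumes "mono g"
  shows "prob_space (step_laws g i)" "sets (step_laws g i) = sets borel"
    "distr (step_laws g i) borel uminus = step_laws g i"
  using monoD[OF assms, of i "Suc i"] by (auto simp: step_laws_def intro: prob_space_law law_symmetric)

definition grid_value :: "(nat \<Rightarrow> real) \<Rightarrow> nat \<Rightarrow> real \<Rightarrow> (real \<Rightarrow> ennreal) \<Rightarrow> real \<Rightarrow> 'w \<Rightarrow> ennreal" where
  "grid_value g N d f y w = (if \<forall>i\<le>N. d \<le> \<bar>y + \<zeta> (g i) w\<bar>
     then f (sign_prod (sign_changes (\<lambda>i. y + \<zeta> (g i) w) N) w * (y + \<zeta> (g N) w)) else 0)"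

lemma grid_nonneg: "mono g \<Longrightarrow> g 0 = 0 \<Longrightarrow> 0 \<le> (g i :: real)" for g :: "nat \<Rightarrow> real"
  using monoD[of g 0 i] by simp

lemma measurable_random_sign_prod:
  assumes C [measurable]: "C \<in> measurable M (count_space UNIV)"
  shows "(\<lambda>w. sign_prod (C w) w) \<in> borel_measurable M"
  by (rule measurable_compose_countable) auto

lemma measurable_grid_value:
  assumes g: "mono g" "g 0 = 0" and [measurable]: "f \<in> borel_measurable borel"
  shows "grid_value g N d f y \<in> borel_measurable M"
proof -
  have [measurable]: "\<zeta> (g i) \<in> borel_measurable M" for i using grid_nonneg[OF g] by simp
  have [measurable]: "(\<lambda>w. sign_prod (sign_changes (\<lambda>i. y + \<zeta> (g i) w) N) w) \<in> borel_measurable M"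
    by (rule measurable_random_sign_prod) measurable
  show ?thesis unfolding grid_value_def by measurable
qed

text \<open>Once the signs are integrated out, what remains depends on the increments only, and
  their joint law is the product of the step laws.\<close>

lemma nn_integral_grid_value:
  assumes g: "mono g" "g 0 = 0" and N: "0 < N" and d: "0 < d" "d \<le> \<bar>y\<bar>"
    and f [measurable]: "f \<in> borel_measurable borel"
  shows "(\<integral>\<^sup>+w. grid_value g N d f y w \<partial>M) = chain p q d (step_laws g) N f y"
proof -
  have g0: "0 \<le> g i" for i by (rule grid_nonneg[OF g])
  have [measurable]: "\<zeta> (g i) \<in> borel_measurable sigma_\<zeta>" for i using measurable_\<zeta>_sigma[OF g0] .
  have \<zeta>_M [measurable]: "\<zeta> (g i) \<in> borel_measurable M" for i using g0 by simp
  define X where "X w = (\<lambda>i\<in>{..<N}. \<zeta> (g (Suc i)) w - \<zeta> (g i) w)" for w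
  have "(\<integral>\<^sup>+w. grid_value g N d f y w \<partial>M) = (\<integral>\<^sup>+w. reflected_value p q d N f (\<lambda>i. y + \<zeta> (g i) w) \<partial>M)"
    unfolding grid_value_def reflected_value_def
    by (rule nn_integral_random_sign) measurable
  also have "\<dots> = (\<integral>\<^sup>+w. reflected_value p q d N f (position y (X w)) \<partial>M)"
  proof (rule nn_integral_cong_AE, use start_\<zeta> in eventually_elim)
    case (elim w)
    have pos: "position y (X w) i = y + \<zeta> (g i) w" if "i \<le> N" for i
    proof -
      have "(\<Sum>j<i. X w j) = (\<Sum>j<i. \<zeta> (g (Suc j)) w - \<zeta> (g j) w)"
        using that by (intro sum.cong) (auto simp: X_def)
      also have "\<dots> = \<zeta> (g i) w - \<zeta> (g 0) w" by (rule sum_lessThan_telescope)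
      finally show ?thesis using elim g(2) by (simp add: position_def)
    qed
    then have "sign_changes (position y (X w)) N = sign_changes (\<lambda>i. y + \<zeta> (g i) w) N"
      unfolding sign_changes_def by (intro sum.cong) auto
    moreover have "(\<forall>i\<le>N. d \<le> \<bar>position y (X w) i\<bar>) = (\<forall>i\<le>N. d \<le> \<bar>y + \<zeta> (g i) w\<bar>)" using pos by auto
    ultimately show ?case unfolding reflected_value_def pos[OF order_refl] by (simp only:)
  qed
  also have "\<dots> = (\<integral>\<^sup>+x. reflected_value p q d N f (position y x) \<partial>distr M (Pi\<^sub>M {..<N} (\<lambda>_. borel)) X)"
  proof (rule nn_integral_distr[symmetric])
    show "X \<in> measurable M (Pi\<^sub>M {..<N} (\<lambda>_. borel))"
      unfolding X_def by (intro measurable_restrict) measurable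
  qed measurable
  also have "distr M (Pi\<^sub>M {..<N} (\<lambda>_. borel)) X = Pi\<^sub>M {..<N} (step_laws g)"
  proof -
    have iv: "indep_vars (\<lambda>_. borel) (\<lambda>i w. \<zeta> (g (Suc i)) w - \<zeta> (g i) w) {..<N}"
      by (rule indep_increments) (use g in auto)
    have "distr M (Pi\<^sub>M {..<N} (\<lambda>_. borel)) X = Pi\<^sub>M {..<N} (\<lambda>i. distr M borel (\<lambda>w. \<zeta> (g (Suc i)) w - \<zeta> (g i) w))"
      unfolding X_def
      by (rule indep_vars_iff_distr_eq_PiM'[THEN iffD1, OF _ _ iv]) (use N in auto)
    also have "\<dots> = Pi\<^sub>M {..<N} (step_laws g)"
      using g0 monoD[OF g(1)] by (intro PiM_cong) (auto simp: step_laws_def increment_law)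
    finally show ?thesis .
  qed
  also have "(\<integral>\<^sup>+x. reflected_value p q d N f (position y x) \<partial>Pi\<^sub>M {..<N} (step_laws g)) = chain p q d (step_laws g) N f y"
    by (intro chain_eq_PiM_integral step_laws g pq d f)
  finally show ?thesis .
qed

end

section \<open>Refinement of the grid\<close>

text \<open>Preimages under the two functions differ by null sets, and these are measurable in the
  completion.\<close>

lemma measurable_completion_AE_eq:
  assumes X: "X \<in> measurable (completion M) N" and eq: "AE w in M. X w = Y w" and Y: "Y \<in> space M \<rightarrow> space N"
  shows "Y \<in> measurable (completion M) N"
proof (rule measurableI)
  fix A assume A [measurable]: "A \<in> sets N"
  note X[measurable]
  have "AE w in M. \<not> (X w \<in> A \<and> Y w \<notin> A)" "AE w in M. \<not> (Y w \<in> A \<and> X w \<notin> A)"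
    using eq by (eventually_elim, simp)+
  then have [measurable]: "Measurable.pred (completion M) (\<lambda>w. X w \<in> A \<and> Y w \<notin> A)"
    "Measurable.pred (completion M) (\<lambda>w. Y w \<in> A \<and> X w \<notin> A)"
    by (auto intro: sets_completion_AE)
  have "{w \<in> space (completion M). (X w \<in> A \<and> \<not> (X w \<in> A \<and> Y w \<notin> A)) \<or> (Y w \<in> A \<and> X w \<notin> A)} \<in> sets (completion M)"
    by measurable
  also have "{w \<in> space (completion M). (X w \<in> A \<and> \<not> (X w \<in> A \<and> Y w \<notin> A)) \<or> (Y w \<in> A \<and> X w \<notin> A)} =
     Y -` A \<inter> space (completion M)"
    by auto
  finally show "Y -` A \<inter> space (completion M) \<in> sets (completion M)" .
qed (use Y in auto)

lemma borel_measurable_completion_AE_limit: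
  fixes X :: "nat \<Rightarrow> 'a \<Rightarrow> real"
  assumes [measurable]: "\<And>n. X n \<in> borel_measurable M" and lim: "AE w in M. (\<lambda>n. X n w) \<longlonglongrightarrow> Y w"
  shows "Y \<in> borel_measurable (completion M)"
proof (rule measurable_completion_AE_eq)
  show "AE w in M. lim (\<lambda>n. X n w) = Y w"
    using lim by eventually_elim (rule limI)
  show "(\<lambda>w. lim (\<lambda>n. X n w)) \<in> borel_measurable (completion M)"
    by (intro measurable_completion) measurable
qed simp

text \<open>Only the restriction of \<open>z\<close> to \<open>A\<close> need be measurable. It is
  meant for the reflected path, which is controlled only as long as it has not been killed.\<close>

lemma measurable_if_compose:
  assumes A [measurable]: "Measurable.pred N A" and [measurable]: "(\<lambda>w. if A w then z w else 0 :: real) \<in> borel_measurable N"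
    and [measurable]: "f \<in> measurable borel K" and c: "c \<in> space K"
  shows "(\<lambda>w. if A w then f (z w) else c) \<in> measurable N K"
proof -
  have "(\<lambda>w. if A w then f (if A w then z w else 0) else c) \<in> measurable N K"
    using c by measurable
  then show ?thesis by (rule measurable_cong[THEN iffD1, rotated]) simp
qed

section \<open>Uniform grids and their concatenation\<close>

definition uniform_grid :: "real \<Rightarrow> nat \<Rightarrow> nat \<Rightarrow> real" where
  "uniform_grid t n i = real i * t / real (Suc n)"

text \<open>Both halves have \<open>Suc n\<close> equal steps, so the step laws are those of the two
  uniform grids and the chain factorises at time \<open>s\<close>.\<close>

definition joined_grid :: "real \<Rightarrow> real \<Rightarrow> nat \<Rightarrow> nat \<Rightarrow> real" where
  "joined_grid s t n i = (if i \<le> Suc n then uniform_grid s n i else s + uniform_grid t n (i - Suc n))"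

lemma mono_uniform_grid: "0 \<le> t \<Longrightarrow> mono (uniform_grid t n)"
  by (auto simp: mono_def uniform_grid_def intro!: divide_right_mono mult_right_mono)

lemma uniform_grid_end: "uniform_grid t n (Suc n) = t"
  by (simp add: uniform_grid_def)

lemma uniform_grid_diff: "uniform_grid t n (Suc i) - uniform_grid t n i = t / real (Suc n)"
  by (simp add: uniform_grid_def diff_divide_distrib[symmetric] algebra_simps)

lemma eventually_step_less: "0 < e \<Longrightarrow> \<forall>\<^sub>F n in sequentially. t / real (Suc n) < e"
  by (rule order_tendstoD(2)[OF LIMSEQ_Suc[OF lim_const_over_n]])

lemma mesh_uniform_grid:
  assumes "0 \<le> t"
  shows "mesh_to_0 (uniform_grid t) Suc t"
  unfolding mesh_to_0_def uniform_grid_diff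
proof (intro conjI allI impI)
  fix e :: real assume "0 < e"
  from eventually_step_less[OF this, of t]
  show "\<forall>\<^sub>F n in sequentially. \<forall>i<Suc n. t / real (Suc n) < e" by eventually_elim auto
qed (use mono_uniform_grid uniform_grid_end assms in \<open>auto simp: uniform_grid_def[of _ _ 0]\<close>)

lemma joined_grid_diff:
  "joined_grid s t n (Suc i) - joined_grid s t n i = (if i < Suc n then s / real (Suc n) else t / real (Suc n))"
proof -
  consider "i < Suc n" | "i = Suc n" | "Suc n < i" by linarith
  then show ?thesis
  proof cases
    case 1
    then show ?thesis using uniform_grid_diff[of s n i] by (simp add: joined_grid_def)
  next
    case 2
    then show ?thesis using uniform_grid_diff[of t n 0] uniform_grid_end[of s n]
      by (simp add: joined_grid_def) (simp add: uniform_grid_def)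
  next
    case 3
    then have "Suc i - Suc n = Suc (i - Suc n)" by simp
    with 3 show ?thesis using uniform_grid_diff[of t n "i - Suc n"] by (simp add: joined_grid_def)
  qed
qed

lemma mono_joined_grid: "0 \<le> s \<Longrightarrow> 0 \<le> t \<Longrightarrow> mono (joined_grid s t n)"
proof -
  assume "0 \<le> s" "0 \<le> t"
  then have "0 \<le> joined_grid s t n (Suc i) - joined_grid s t n i" for i unfolding joined_grid_diff by simp
  then show ?thesis unfolding mono_iff_le_Suc by simp
qed

lemma mesh_joined_grid:
  assumes "0 \<le> s" "0 \<le> t"
  shows "mesh_to_0 (joined_grid s t) (\<lambda>n. Suc n + Suc n) (s + t)"
  unfolding mesh_to_0_def joined_grid_diff
proof (intro conjI allI impI)
  fix e :: real assume "0 < e"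
  from eventually_step_less[OF this, of s] eventually_step_less[OF this, of t]
  show "\<forall>\<^sub>F n in sequentially. \<forall>i<Suc n + Suc n. (if i < Suc n then s / real (Suc n) else t / real (Suc n)) < e"
    by eventually_elim auto
next
  show "joined_grid s t n (Suc n + Suc n) = s + t" for n
    using uniform_grid_end[of t n] by (simp add: joined_grid_def)
qed (use assms mono_joined_grid in \<open>auto simp: joined_grid_def uniform_grid_def\<close>)

context interface_process
begin

definition good_path :: "'w \<Rightarrow> bool" where
  "good_path w \<longleftrightarrow> w \<in> space M \<and> cadlag_path (\<lambda>t. \<zeta> t w) \<and> \<zeta> 0 w = 0 \<and> (\<forall>m. sign_prod m w = 1 \<or> sign_prod m w = - 1)"

lemma AE_good_path: "AE w in M. good_path w"
proof -
  have "AE w in M. \<forall>m. sign_prod m w = 1 \<or> sign_prod m w = - 1"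
    unfolding AE_all_countable using AE_sign_prod by blast
  with AE_space cadlag_\<zeta> start_\<zeta> show ?thesis by eventually_elim (simp add: good_path_def)
qed

definition zo :: "real \<Rightarrow> real \<Rightarrow> 'w \<Rightarrow> real" where
  "zo t y w = interface_path (\<lambda>s. \<zeta> s w) (\<lambda>m. \<sigma> m w) t y"

definition away :: "real \<Rightarrow> real \<Rightarrow> real \<Rightarrow> 'w \<Rightarrow> bool" where
  "away d t y w \<longleftrightarrow> (\<forall>s\<in>{0..t}. d \<le> \<bar>y + \<zeta> s w\<bar>)"

text \<open>Stronger than not having hit 0: a cadlag path can have left limit 0 at a jump without
  ever taking the value 0.\<close>

definition alive :: "real \<Rightarrow> real \<Rightarrow> 'w \<Rightarrow> bool" where
  "alive t y w \<longleftrightarrow> (\<exists>d>0. away d t y w)"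

lemma alive_iff: "alive t y w \<longleftrightarrow> (\<exists>k. away (1 / real (Suc k)) t y w)"
proof
  assume "alive t y w"
  then obtain d where d: "0 < d" "away d t y w" by (auto simp: alive_def)
  from reals_Archimedean[OF d(1)] obtain k where "inverse (real (Suc k)) < d" by blast
  with d(2) show "\<exists>k. away (1 / real (Suc k)) t y w"
    by (intro exI[of _ k]) (auto simp: away_def inverse_eq_divide intro: order_trans less_imp_le)
next
  show "\<exists>k. away (1 / real (Suc k)) t y w \<Longrightarrow> alive t y w"
    unfolding alive_def by (metis zero_less_divide_1_iff of_nat_0_less_iff zero_less_Suc)
qed

lemma away_antimono: "d \<le> d' \<Longrightarrow> away d' t y w \<Longrightarrow> away d t y w"
  by (auto simp: away_def)

lemma away_start: "good_path w \<Longrightarrow> 0 \<le> t \<Longrightarrow> away d t y w \<Longrightarrow> d \<le> \<bar>y\<bar>"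
  by (auto simp: away_def good_path_def dest: bspec[of _ _ 0])

lemma zo_eq:
  assumes w: "good_path w" and "0 < d" "away d t y w" "0 \<le> t"
    and m: "crossing_time (\<lambda>s. \<zeta> s w) y m \<le> ereal t" "ereal t < crossing_time (\<lambda>s. \<zeta> s w) y (Suc m)"
  shows "zo t y w = sign_prod m w * (y + \<zeta> t w)"
proof -
  have "ereal t < hitting_time (\<lambda>s. \<zeta> s w) y"
    by (rule less_hitting_time[of _ d]) (use assms in \<open>auto simp: good_path_def away_def\<close>)
  then show ?thesis
    unfolding zo_def interface_path_def
    by (simp only: crossing_index_unique[OF m] if_True Let_def sign_prod_def)
qed

lemma away_crossing_index:
  assumes w: "good_path w" and "0 < d" "away d t y w" "0 \<le> t"
  obtains m where "crossing_time (\<lambda>s. \<zeta> s w) y m \<le> ereal t" "ereal t < crossing_time (\<lambda>s. \<zeta> s w) y (Suc m)"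
  using finitely_many_crossings[of "\<lambda>s. \<zeta> s w" d t y] assms unfolding good_path_def away_def by auto

lemma zo_abs:
  assumes "good_path w" "alive t y w" "0 \<le> t"
  shows "zo t y w = y + \<zeta> t w \<or> zo t y w = - (y + \<zeta> t w)"
proof -
  from assms(2) obtain d where d: "0 < d" "away d t y w" by (auto simp: alive_def)
  obtain m where "crossing_time (\<lambda>s. \<zeta> s w) y m \<le> ereal t" "ereal t < crossing_time (\<lambda>s. \<zeta> s w) y (Suc m)"
    using away_crossing_index[OF assms(1) d assms(3)] .
  from zo_eq[OF assms(1) d assms(3) this] assms(1) show ?thesis
    by (auto simp: good_path_def)
qed

text \<open>Killing is decided by \<open>eventually_near_0_iff\<close>, and the sign index by the
  exact count of crossings. Equality from some \<open>n\<close> on, rather than convergence, allows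
  any \<open>f\<close> to be applied to the sampled value.\<close>

lemma grid_eventually_exact:
  assumes w: "good_path w" and d: "0 < d" and t: "0 \<le> t" and g: "mesh_to_0 g N t"
  shows "\<forall>\<^sub>F n in sequentially. ((\<forall>i\<le>N n. d \<le> \<bar>y + \<zeta> (g n i) w\<bar>) \<longleftrightarrow> away d t y w) \<and>
    (away d t y w \<longrightarrow> sign_prod (sign_changes (\<lambda>i. y + \<zeta> (g n i) w) (N n)) w * (y + \<zeta> (g n (N n)) w) = zo t y w)"
proof -
  have z: "cadlag_path (\<lambda>t. \<zeta> t w)" "\<zeta> 0 w = 0" using w by (auto simp: good_path_def)
  have 1: "\<forall>\<^sub>F n in sequentially. (\<forall>i\<le>N n. d \<le> \<bar>y + \<zeta> (g n i) w\<bar>) \<longleftrightarrow> away d t y w"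
    using eventually_near_0_iff[OF z(1) g t, of d y] by (simp add: away_def)
  show ?thesis
  proof (cases "away d t y w")
    case True
    obtain m where m: "crossing_time (\<lambda>s. \<zeta> s w) y m \<le> ereal t" "ereal t < crossing_time (\<lambda>s. \<zeta> s w) y (Suc m)"
      using away_crossing_index[OF w d True t] .
    have "\<forall>\<^sub>F n in sequentially. sign_changes (\<lambda>i. y + \<zeta> (g n i) w) (N n) = m"
      by (rule sign_changes_eq[OF z d _ m g]) (use True in \<open>auto simp: away_def\<close>)
    with 1 show ?thesis
    proof eventually_elim
      case (elim n)
      have "g n (N n) = t" using g by (simp add: mesh_to_0_def)
      with elim zo_eq[OF w d True t m] show ?case by simp
    qed
  next
    case False
    with 1 show ?thesis by (auto elim: eventually_mono)
  qed
qed

lemma grid_value_eventually: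
  assumes "good_path w" "0 < d" "0 \<le> t" "mesh_to_0 g N t"
  shows "\<forall>\<^sub>F n in sequentially. \<forall>f. grid_value (g n) (N n) d f y w = (if away d t y w then f (zo t y w) else 0)"
  using grid_eventually_exact[OF assms, of y] by eventually_elim (auto simp: grid_value_def)

text \<open>Both are almost sure limits of quantities that depend on finitely many times.\<close>

lemma measurable_away [measurable]:
  assumes "0 < d" "0 \<le> t"
  shows "Measurable.pred (completion M) (away d t y)"
    and "(\<lambda>w. if away d t y w then zo t y w else 0) \<in> borel_measurable (completion M)"
proof -
  let ?g = "uniform_grid t"
  have [measurable]: "\<zeta> (?g n i) \<in> borel_measurable M" for n i
    using assms by (intro random_variable_\<zeta>) (simp add: uniform_grid_def)
  have [measurable]: "(\<lambda>w. sign_prod (sign_changes (\<lambda>i. y + \<zeta> (?g n i) w) (Suc n)) w) \<in> borel_measurable M" for n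
    by (rule measurable_random_sign_prod) measurable
  have ev: "AE w in M. \<forall>\<^sub>F n in sequentially. ((\<forall>i\<le>Suc n. d \<le> \<bar>y + \<zeta> (?g n i) w\<bar>) \<longleftrightarrow> away d t y w) \<and>
    (away d t y w \<longrightarrow> sign_prod (sign_changes (\<lambda>i. y + \<zeta> (?g n i) w) (Suc n)) w * (y + \<zeta> (?g n (Suc n)) w) = zo t y w)"
    using AE_good_path
  proof eventually_elim
    case (elim w)
    from grid_eventually_exact[OF elim assms mesh_uniform_grid[OF assms(2)]] show ?case .
  qed
  have "(\<lambda>w. if away d t y w then 1 else 0 :: real) \<in> borel_measurable (completion M)"
  proof (rule borel_measurable_completion_AE_limit)
    show "(\<lambda>w. if \<forall>i\<le>Suc n. d \<le> \<bar>y + \<zeta> (?g n i) w\<bar> then 1 else 0 :: real) \<in> borel_measurable M" for n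
      by measurable
    show "AE w in M. (\<lambda>n. if \<forall>i\<le>Suc n. d \<le> \<bar>y + \<zeta> (?g n i) w\<bar> then 1 else 0 :: real) \<longlonglongrightarrow> (if away d t y w then 1 else 0)"
      using ev by eventually_elim (rule tendsto_eventually, auto elim!: eventually_mono)
  qed
  from measurable_sets[OF this, of "{1}"] show "Measurable.pred (completion M) (away d t y)"
    unfolding pred_def by (rule back_subst[of "\<lambda>A. A \<in> sets (completion M)"]) (auto split: if_splits)
  show "(\<lambda>w. if away d t y w then zo t y w else 0) \<in> borel_measurable (completion M)"
  proof (rule borel_measurable_completion_AE_limit)
    show "(\<lambda>w. if \<forall>i\<le>Suc n. d \<le> \<bar>y + \<zeta> (?g n i) w\<bar>
       then sign_prod (sign_changes (\<lambda>i. y + \<zeta> (?g n i) w) (Suc n)) w * (y + \<zeta> (?g n (Suc n)) w) else 0) \<in> borel_measurable M" for n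
      by measurable
    show "AE w in M. (\<lambda>n. if \<forall>i\<le>Suc n. d \<le> \<bar>y + \<zeta> (?g n i) w\<bar>
       then sign_prod (sign_changes (\<lambda>i. y + \<zeta> (?g n i) w) (Suc n)) w * (y + \<zeta> (?g n (Suc n)) w) else 0)
        \<longlonglongrightarrow> (if away d t y w then zo t y w else 0)"
      using ev by eventually_elim (rule tendsto_eventually, auto elim!: eventually_mono)
  qed
qed

lemma measurable_alive:
  assumes t: "0 \<le> t"
  shows "Measurable.pred (completion M) (alive t y)"
    and "(\<lambda>w. if alive t y w then zo t y w else 0) \<in> borel_measurable (completion M)"
proof -
  have [measurable]: "Measurable.pred (completion M) (away (1 / real (Suc k)) t y)"
    "(\<lambda>w. if away (1 / real (Suc k)) t y w then zo t y w else 0) \<in> borel_measurable (completion M)" for k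
    using t by (auto intro: measurable_away)
  show "Measurable.pred (completion M) (alive t y)"
    unfolding alive_iff[abs_def] by measurable
  show "(\<lambda>w. if alive t y w then zo t y w else 0) \<in> borel_measurable (completion M)"
  proof (rule borel_measurable_LIMSEQ_metric)
    fix w
    show "(\<lambda>k. if away (1 / real (Suc k)) t y w then zo t y w else 0) \<longlonglongrightarrow> (if alive t y w then zo t y w else 0)"
    proof (cases "alive t y w")
      case True
      then obtain k where k: "away (1 / real (Suc k)) t y w" by (auto simp: alive_iff)
      have "away (1 / real (Suc j)) t y w" if "k \<le> j" for j
        by (rule away_antimono[OF _ k]) (use that in \<open>simp add: field_simps\<close>)
      with True show ?thesis by (intro tendsto_eventually) (auto simp: eventually_sequentially)
    qed (auto simp: alive_iff)
  qed measurable
qed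

end

section \<open>The symmetric semigroup on nonnegative functions\<close>

context interface_process
begin

text \<open>The integrals are taken over the completion of \<open>M\<close>: paths are cadlag only almost surely, so events
  about a whole path need not lie in \<open>M\<close>. Killing here means leaving \<open>away\<close> resp. \<open>alive\<close>.\<close>

definition Qd :: "real \<Rightarrow> real \<Rightarrow> (real \<Rightarrow> ennreal) \<Rightarrow> real \<Rightarrow> ennreal" where
  "Qd d t f y = (\<integral>\<^sup>+w. (if away d t y w then f (zo t y w) else 0) \<partial>completion M)"

definition Q :: "real \<Rightarrow> (real \<Rightarrow> ennreal) \<Rightarrow> real \<Rightarrow> ennreal" where
  "Q t f y = (\<integral>\<^sup>+w. (if alive t y w then f (zo t y w) else 0) \<partial>completion M)"

lemma measurable_away_value [measurable]:
  "0 < d \<Longrightarrow> 0 \<le> t \<Longrightarrow> f \<in> borel_measurable borel \<Longrightarrow>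
    (\<lambda>w. if away d t y w then f (zo t y w) else 0 :: ennreal) \<in> borel_measurable (completion M)"
  by (rule measurable_if_compose[OF measurable_away]) auto

lemma measurable_alive_value [measurable]:
  "0 \<le> t \<Longrightarrow> f \<in> borel_measurable borel \<Longrightarrow>
    (\<lambda>w. if alive t y w then f (zo t y w) else 0 :: ennreal) \<in> borel_measurable (completion M)"
  by (rule measurable_if_compose[OF measurable_alive]) auto

lemma emeasure_completion_space: "emeasure (completion M) (space M) = 1"
  by (simp add: emeasure_space_1)

lemma Qd_near_0: "0 \<le> t \<Longrightarrow> \<bar>y\<bar> < d \<Longrightarrow> Qd d t f y = 0"
proof -
  assume t: "0 \<le> t" "\<bar>y\<bar> < d"
  have "AE w in completion M. (if away d t y w then f (zo t y w) else 0) = 0"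
    using AE_completion[OF AE_good_path]
  proof eventually_elim
    case (elim w)
    then show ?case using away_start[OF elim t(1), of d y] t(2) by auto
  qed
  then show ?thesis unfolding Qd_def by (subst nn_integral_cong_AE) auto
qed

text \<open>The function may vary with \<open>n\<close>: in the semigroup law the chain over the
  second time interval takes its place. Pointwise convergence of \<open>F n\<close> suffices, since
  the grid value is eventually \<open>F n\<close> at the true end point.\<close>

lemma chain_tendsto_Qd:
  assumes g: "mesh_to_0 g N t" and t: "0 \<le> t" and d: "0 < d"
    and F: "\<And>n. F n \<in> borel_measurable borel" "\<And>n x. F n x \<le> c" "c < \<infinity>" "\<And>x. (\<lambda>n. F n x) \<longlonglongrightarrow> f x"
  shows "(\<lambda>n. chain p q d (step_laws (g n)) (N n) (F n) y) \<longlonglongrightarrow> Qd d t f y"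
proof -
  have gn: "mono (g n)" "g n 0 = 0" "0 < N n" for n using g by (auto simp: mesh_to_0_def)
  note F(1)[measurable]
  have f [measurable]: "f \<in> borel_measurable borel"
    by (rule borel_measurable_LIMSEQ_order[OF F(4) F(1)])
  show ?thesis
  proof (cases "d \<le> \<bar>y\<bar>")
    \<comment> \<open>A start within \<open>d\<close> of 0 is killed at once on both sides; a chain
      with at least one step sees this.\<close>
    case False
    then show ?thesis using Qd_near_0[OF t, of y d f] chain_near_0[of y d] gn by simp
  next
    case True
    have "(\<lambda>n. \<integral>\<^sup>+w. grid_value (g n) (N n) d (F n) y w \<partial>completion M) \<longlonglongrightarrow> Qd d t f y"
      unfolding Qd_def
    proof (rule nn_integral_dominated_convergence[where w="\<lambda>_. c"])
      show "grid_value (g n) (N n) d (F n) y \<in> borel_measurable (completion M)" for n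
        by (intro measurable_completion measurable_grid_value gn F)
      show "(\<lambda>w. if away d t y w then f (zo t y w) else 0) \<in> borel_measurable (completion M)"
        using d t f by (rule measurable_away_value)
      show "AE w in completion M. grid_value (g n) (N n) d (F n) y w \<le> c" for n
        using F(2) by (auto simp: grid_value_def)
      show "(\<integral>\<^sup>+w. c \<partial>completion M) < \<infinity>" using F(3) by (simp add: emeasure_completion_space)
      show "AE w in completion M. (\<lambda>n. grid_value (g n) (N n) d (F n) y w) \<longlonglongrightarrow> (if away d t y w then f (zo t y w) else 0)"
        using AE_completion[OF AE_good_path]
      proof eventually_elim
        case (elim w)
        have "(\<lambda>n. if away d t y w then F n (zo t y w) else 0) \<longlonglongrightarrow> (if away d t y w then f (zo t y w) else 0)"
          using F(4) by simp
        then show ?case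
          by (rule Lim_transform_eventually)
            (use grid_value_eventually[OF elim d t g, of y] in eventually_elim, simp)
      qed
    qed simp
    then show ?thesis
      by (simp add: nn_integral_completion nn_integral_grid_value[OF gn d True F(1)])
  qed
qed

lemma uniform_chain: "chain p q d (step_laws (uniform_grid t n)) N f = chain p q d (\<lambda>_. law (t / real (Suc n))) N f"
  by (rule chain_cong) (simp add: step_laws_def uniform_grid_diff)

lemma joined_chain:
  "chain p q d (step_laws (joined_grid s t n)) (Suc n + Suc n) f =
   chain p q d (step_laws (uniform_grid s n)) (Suc n) (chain p q d (step_laws (uniform_grid t n)) (Suc n) f)"
proof -
  have 1: "chain p q d (step_laws (joined_grid s t n)) (Suc n) h = chain p q d (step_laws (uniform_grid s n)) (Suc n) h" for h
    by (rule chain_cong) (simp add: step_laws_def uniform_grid_diff joined_grid_diff)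
  have 2: "chain p q d (\<lambda>i. step_laws (joined_grid s t n) (Suc n + i)) (Suc n) h = chain p q d (step_laws (uniform_grid t n)) (Suc n) h" for h
    by (rule chain_cong) (simp add: step_laws_def uniform_grid_diff joined_grid_diff)
  show ?thesis unfolding chain_add 1 2 ..
qed

lemma grid_chain_measurable:
  "mono g \<Longrightarrow> f \<in> borel_measurable borel \<Longrightarrow> chain p q d (step_laws g) N f \<in> borel_measurable borel"
  by (intro chain_measurable step_laws)

lemma grid_chain_le: "mono g \<Longrightarrow> (\<And>y. f y \<le> c) \<Longrightarrow> chain p q d (step_laws g) N f y \<le> c"
  by (intro chain_le step_laws pq)

lemma uniform_chain_tendsto:
  assumes "0 \<le> t" "0 < d" "f \<in> borel_measurable borel" "\<And>y. f y \<le> c" "c < \<infinity>"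
  shows "(\<lambda>n. chain p q d (step_laws (uniform_grid t n)) (Suc n) f y) \<longlonglongrightarrow> Qd d t f y"
  using assms by (intro chain_tendsto_Qd[OF mesh_uniform_grid]) auto

lemma Qd_measurable:
  assumes t: "0 \<le> t" "0 < d" and f: "f \<in> borel_measurable borel" "\<And>y. f y \<le> c" "c < \<infinity>"
  shows "Qd d t f \<in> borel_measurable borel"
  by (rule borel_measurable_LIMSEQ_order[OF uniform_chain_tendsto[OF t f]])
    (intro grid_chain_measurable mono_uniform_grid t f)

lemma Qd_semigroup:
  assumes s: "0 \<le> s" and t: "0 \<le> t" and d: "0 < d" and f: "f \<in> borel_measurable borel" "\<And>y. f y \<le> c" "c < \<infinity>"
  shows "Qd d (s + t) f y = Qd d s (Qd d t f) y"
proof -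
  have "(\<lambda>n. chain p q d (step_laws (joined_grid s t n)) (Suc n + Suc n) f y) \<longlonglongrightarrow> Qd d (s + t) f y"
    using s t d f by (intro chain_tendsto_Qd[OF mesh_joined_grid]) auto
  moreover have "(\<lambda>n. chain p q d (step_laws (uniform_grid s n)) (Suc n)
      (chain p q d (step_laws (uniform_grid t n)) (Suc n) f) y) \<longlonglongrightarrow> Qd d s (Qd d t f) y"
    by (intro chain_tendsto_Qd[OF mesh_uniform_grid[OF s] s d, of _ c] grid_chain_measurable grid_chain_le
          mono_uniform_grid t f uniform_chain_tendsto[OF t d f])
  ultimately show ?thesis unfolding joined_chain by (rule LIMSEQ_unique)
qed

lemma Qd_le:
  assumes "\<And>y. f y \<le> c"
  shows "Qd d t f y \<le> c"
proof -
  have "Qd d t f y \<le> (\<integral>\<^sup>+w. c \<partial>completion M)"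
    unfolding Qd_def using assms by (intro nn_integral_mono) auto
  then show ?thesis by (simp add: emeasure_completion_space)
qed

lemma Q_le:
  assumes "\<And>y. f y \<le> c"
  shows "Q t f y \<le> c"
proof -
  have "Q t f y \<le> (\<integral>\<^sup>+w. c \<partial>completion M)"
    unfolding Q_def using assms by (intro nn_integral_mono) auto
  then show ?thesis by (simp add: emeasure_completion_space)
qed

lemma nn_integral_product_tendsto:
  assumes lim: "\<And>y. (\<lambda>n. F n y) \<longlonglongrightarrow> f y" and F: "\<And>n. F n \<in> borel_measurable borel" "\<And>n y. F n y \<le> c" "c < \<infinity>"
    and h: "h \<in> borel_measurable borel" "(\<integral>\<^sup>+y. h y \<partial>lborel) < \<infinity>" "\<And>y::real. h y < \<infinity>"
  shows "(\<lambda>n. \<integral>\<^sup>+y. F n y * h y \<partial>lborel) \<longlonglongrightarrow> (\<integral>\<^sup>+y. f y * h y \<partial>lborel)"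
proof (rule nn_integral_dominated_convergence[where w="\<lambda>y. c * h y"])
  note F(1)[measurable] h(1)[measurable]
  have [measurable]: "f \<in> borel_measurable borel" by (rule borel_measurable_LIMSEQ_order[OF lim F(1)])
  show "(\<lambda>y. F n y * h y) \<in> borel_measurable lborel" "(\<lambda>y. f y * h y) \<in> borel_measurable lborel"
    "(\<lambda>y. c * h y) \<in> borel_measurable lborel" for n by measurable
  show "(\<integral>\<^sup>+y. c * h y \<partial>lborel) < \<infinity>"
    using F(3) h(2) by (simp add: nn_integral_cmult ennreal_mult_less_top)
  show "AE y in lborel. (\<lambda>n. F n y * h y) \<longlonglongrightarrow> f y * h y"
  proof (rule AE_I2)
    fix y
    have "f y \<le> c" using F(2) by (intro LIMSEQ_le_const2[OF lim]) auto
    \<comment> \<open>Extended multiplication is not continuous at 0 times infinity, hence the care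
      about finite values.\<close>
    then have "f y \<noteq> \<top>" "h y \<noteq> \<top>" using F(3) h(3)[of y] by auto
    then show "(\<lambda>n. F n y * h y) \<longlonglongrightarrow> f y * h y"
      by (intro tendsto_mult_ennreal lim tendsto_const) auto
  qed
qed (use F in \<open>auto intro!: mult_right_mono\<close>)

lemma Qd_symmetric:
  assumes t: "0 \<le> t" and d: "0 < d"
    and f: "f \<in> borel_measurable borel" "\<And>y. f y \<le> c" "c < \<infinity>" "(\<integral>\<^sup>+y. f y \<partial>lborel) < \<infinity>"
    and h: "h \<in> borel_measurable borel" "\<And>y. h y \<le> c" "(\<integral>\<^sup>+y. h y \<partial>lborel) < \<infinity>"
  shows "(\<integral>\<^sup>+y. Qd d t f y * h y \<partial>lborel) = (\<integral>\<^sup>+y. Qd d t h y * f y \<partial>lborel)"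
proof -
  have fin: "f y < \<infinity>" "h y < \<infinity>" for y using f(2,3) h(2) le_less_trans by blast+
  have lim: "(\<lambda>n. \<integral>\<^sup>+y. chain p q d (step_laws (uniform_grid t n)) (Suc n) u y * v y \<partial>lborel) \<longlonglongrightarrow>
      (\<integral>\<^sup>+y. Qd d t u y * v y \<partial>lborel)"
    if "u \<in> borel_measurable borel" "\<And>y. u y \<le> c" "v \<in> borel_measurable borel" "(\<integral>\<^sup>+y. v y \<partial>lborel) < \<infinity>" "\<And>y. v y < \<infinity>"
    for u v
    by (rule nn_integral_product_tendsto[where c=c])
      (intro uniform_chain_tendsto[where c=c] grid_chain_measurable grid_chain_le mono_uniform_grid t d that f)+
  have "(\<integral>\<^sup>+y. chain p q d (step_laws (uniform_grid t n)) (Suc n) f y * h y \<partial>lborel) =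
      (\<integral>\<^sup>+y. chain p q d (step_laws (uniform_grid t n)) (Suc n) h y * f y \<partial>lborel)" for n
    unfolding uniform_chain using t
    by (subst chain_const_symmetric) (auto intro!: prob_space_law law_symmetric f h simp: mult.commute)
  with lim[OF f(1,2) h(1,3) fin(2)] lim[OF h(1,2) f(1,4) fin(1)] show ?thesis
    by (simp add: LIMSEQ_unique)
qed

text \<open>For each path the killing distance \<open>1 / Suc k\<close> is eventually irrelevant if
  the path is alive, and always kills otherwise. The functions vary with \<open>k\<close> so that
  the inner operator in the semigroup law can have its own limit.\<close>

lemma Qd_tendsto_Q:
  assumes t: "0 \<le> t"
    and F: "\<And>k. F k \<in> borel_measurable borel" "\<And>k x. F k x \<le> c" "c < \<infinity>" "\<And>x. (\<lambda>k. F k x) \<longlonglongrightarrow> f x"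
  shows "(\<lambda>k. Qd (1 / real (Suc k)) t (F k) y) \<longlonglongrightarrow> Q t f y"
  unfolding Qd_def Q_def
proof (rule nn_integral_dominated_convergence[where w="\<lambda>_. c"])
  have f: "f \<in> borel_measurable borel"
    by (rule borel_measurable_LIMSEQ_order[OF F(4) F(1)])
  show "(\<lambda>w. if away (1 / real (Suc k)) t y w then F k (zo t y w) else 0) \<in> borel_measurable (completion M)" for k
    by (rule measurable_away_value) (use t F in auto)
  show "(\<lambda>w. if alive t y w then f (zo t y w) else 0) \<in> borel_measurable (completion M)"
    using t f by (rule measurable_alive_value)
  show "(\<integral>\<^sup>+w. c \<partial>completion M) < \<infinity>" using F(3) by (simp add: emeasure_completion_space)
  show "AE w in completion M. (\<lambda>k. if away (1 / real (Suc k)) t y w then F k (zo t y w) else 0) \<longlonglongrightarrow>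
      (if alive t y w then f (zo t y w) else 0)"
  proof (rule AE_I2)
    fix w
    show "(\<lambda>k. if away (1 / real (Suc k)) t y w then F k (zo t y w) else 0) \<longlonglongrightarrow>
      (if alive t y w then f (zo t y w) else 0)"
    proof (cases "alive t y w")
      case True
      then obtain k where k: "away (1 / real (Suc k)) t y w" by (auto simp: alive_iff)
      have ev: "\<forall>\<^sub>F j in sequentially. away (1 / real (Suc j)) t y w"
        unfolding eventually_sequentially
      proof (intro exI allI impI)
        fix j assume "k \<le> j"
        then show "away (1 / real (Suc j)) t y w"
          by (intro away_antimono[OF _ k]) (simp add: field_simps)
      qed
      have "(\<lambda>k. F k (zo t y w)) \<longlonglongrightarrow> (if alive t y w then f (zo t y w) else 0)"
        using F(4) True by simp
      then show ?thesis
        by (rule Lim_transform_eventually) (use ev in eventually_elim, simp)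
    qed (auto simp: alive_iff)
  qed
qed (use F in auto)

lemma Q_measurable_bounded:
  assumes t: "0 \<le> t" and f: "f \<in> borel_measurable borel" "\<And>y. f y \<le> c" "c < \<infinity>"
  shows "Q t f \<in> borel_measurable borel"
proof (rule borel_measurable_LIMSEQ_order)
  show "(\<lambda>k. Qd (1 / real (Suc k)) t f y) \<longlonglongrightarrow> Q t f y" for y
    using t f by (intro Qd_tendsto_Q) auto
  show "Qd (1 / real (Suc k)) t f \<in> borel_measurable borel" for k
    using t f by (intro Qd_measurable) auto
qed

lemma Q_semigroup_bounded:
  assumes s: "0 \<le> s" and t: "0 \<le> t" and f: "f \<in> borel_measurable borel" "\<And>y. f y \<le> c" "c < \<infinity>"
  shows "Q (s + t) f y = Q s (Q t f) y"
proof -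
  have d: "0 < 1 / real (Suc k)" for k by simp
  have lim: "(\<lambda>k. Qd (1 / real (Suc k)) t f y) \<longlonglongrightarrow> Q t f y" if "0 \<le> t" for t y
    using that f by (intro Qd_tendsto_Q) auto
  have "(\<lambda>k. Qd (1 / real (Suc k)) s (Qd (1 / real (Suc k)) t f) y) \<longlonglongrightarrow> Q s (Q t f) y"
    by (rule Qd_tendsto_Q[OF s Qd_measurable[OF t d f] Qd_le[OF f(2)] f(3) lim[OF t]])
  moreover have "(\<lambda>k. Qd (1 / real (Suc k)) (s + t) f y) \<longlonglongrightarrow> Q (s + t) f y"
    using lim[of "s + t"] s t by simp
  ultimately show ?thesis
    unfolding Qd_semigroup[OF s t d f] by (intro LIMSEQ_unique)
qed

lemma Q_symmetric_bounded:
  assumes t: "0 \<le> t"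
    and f: "f \<in> borel_measurable borel" "\<And>y. f y \<le> c" "c < \<infinity>" "(\<integral>\<^sup>+y. f y \<partial>lborel) < \<infinity>"
    and h: "h \<in> borel_measurable borel" "\<And>y. h y \<le> c" "(\<integral>\<^sup>+y. h y \<partial>lborel) < \<infinity>"
  shows "(\<integral>\<^sup>+y. Q t f y * h y \<partial>lborel) = (\<integral>\<^sup>+y. Q t h y * f y \<partial>lborel)"
proof -
  have d: "0 < 1 / real (Suc k)" for k by simp
  have fin: "f y < \<infinity>" "h y < \<infinity>" for y using f(2,3) h(2) le_less_trans by blast+
  have lim: "(\<lambda>k. \<integral>\<^sup>+y. Qd (1 / real (Suc k)) t u y * v y \<partial>lborel) \<longlonglongrightarrow> (\<integral>\<^sup>+y. Q t u y * v y \<partial>lborel)"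
    if "u \<in> borel_measurable borel" "\<And>y. u y \<le> c" "v \<in> borel_measurable borel" "(\<integral>\<^sup>+y. v y \<partial>lborel) < \<infinity>" "\<And>y. v y < \<infinity>"
    for u v
  proof (rule nn_integral_product_tendsto[where c=c])
    show "(\<lambda>k. Qd (1 / real (Suc k)) t u y) \<longlonglongrightarrow> Q t u y" for y
      using t that(1,2) f(3) by (intro Qd_tendsto_Q) auto
    show "Qd (1 / real (Suc k)) t u \<in> borel_measurable borel" for k
      by (rule Qd_measurable[OF t d that(1,2) f(3)])
    show "Qd (1 / real (Suc k)) t u y \<le> c" for k y by (rule Qd_le[OF that(2)])
  qed (use that f in auto)
  show ?thesis
    by (rule LIMSEQ_unique[OF lim[OF f(1,2) h(1,3) fin(2), unfolded Qd_symmetric[OF t d f h]] lim[OF h(1,2) f(1,4) fin(1)]])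
qed

section \<open>From bounded integrable to all nonnegative functions\<close>

definition trunc :: "nat \<Rightarrow> (real \<Rightarrow> ennreal) \<Rightarrow> real \<Rightarrow> ennreal" where
  "trunc j f y = min (f y) (of_nat j) * indicator {- real j..real j} y"

lemma trunc_measurable: "f \<in> borel_measurable borel \<Longrightarrow> trunc j f \<in> borel_measurable borel"
  unfolding trunc_def
  by (intro borel_measurable_times_ennreal borel_measurable_min borel_measurable_const borel_measurable_indicator) auto

lemma trunc_le: "trunc j f y \<le> of_nat j"
  by (auto simp: trunc_def indicator_def)

lemma trunc_mono: "i \<le> j \<Longrightarrow> trunc i f y \<le> trunc j f y"
  by (auto simp: trunc_def indicator_def min_le_iff_disj)

lemma trunc_incseq: "incseq (\<lambda>j. trunc j f)"
  by (auto simp: incseq_def le_fun_def intro: trunc_mono)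

lemma trunc_SUP: "(SUP j. trunc j f y) = f y"
proof (rule LIMSEQ_unique)
  show "(\<lambda>j. trunc j f y) \<longlonglongrightarrow> (SUP j. trunc j f y)"
    using trunc_incseq[of f] by (intro LIMSEQ_SUP) (auto simp: incseq_def le_fun_def)
  have "(\<lambda>j. min (f y) (of_nat j)) \<longlonglongrightarrow> min (f y) \<top>"
    by (intro tendsto_min tendsto_const of_nat_tendsto_top_ennreal)
  moreover have "\<forall>\<^sub>F j in sequentially. min (f y) (of_nat j) = trunc j f y"
    using eventually_ge_at_top[of "nat \<lceil>\<bar>y\<bar>\<rceil>"]
  proof eventually_elim
    case (elim j)
    then have "\<bar>y\<bar> \<le> real j" by linarith
    then show ?case by (simp add: trunc_def indicator_def abs_le_iff)
  qed
  ultimately have "(\<lambda>j. trunc j f y) \<longlonglongrightarrow> min (f y) \<top>"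
    by (rule Lim_transform_eventually)
  then show "(\<lambda>j. trunc j f y) \<longlonglongrightarrow> f y" by simp
qed

lemma trunc_integrable: "(\<integral>\<^sup>+y. trunc j f y \<partial>lborel) < \<infinity>"
proof -
  have "(\<integral>\<^sup>+y. trunc j f y \<partial>lborel) \<le> (\<integral>\<^sup>+y. of_nat j * indicator {- real j..real j} y \<partial>lborel)"
    by (intro nn_integral_mono) (auto simp: trunc_def indicator_def)
  also have "\<dots> < \<infinity>" by (simp add: nn_integral_cmult_indicator ennreal_mult_less_top of_nat_less_top)
  finally show ?thesis .
qed

lemma Q_SUP:
  assumes t: "0 \<le> t" and F: "incseq F" "\<And>j. F j \<in> borel_measurable borel"
  shows "Q t (\<lambda>x. SUP j. F j x) y = (SUP j. Q t (F j) y)"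
proof -
  have "Q t (\<lambda>x. SUP j. F j x) y = (\<integral>\<^sup>+w. (SUP j. if alive t y w then F j (zo t y w) else 0) \<partial>completion M)"
    unfolding Q_def by (intro nn_integral_cong) auto
  also have "\<dots> = (SUP j. Q t (F j) y)"
    unfolding Q_def using F t
    by (intro nn_integral_monotone_convergence_SUP measurable_alive_value) (auto simp: incseq_def le_fun_def)
  finally show ?thesis .
qed

lemma Q_mono: "(\<And>x. f x \<le> h x) \<Longrightarrow> Q t f y \<le> Q t h y"
  unfolding Q_def by (intro nn_integral_mono) auto

lemma Q_eq_SUP_trunc: "0 \<le> t \<Longrightarrow> f \<in> borel_measurable borel \<Longrightarrow> Q t f y = (SUP j. Q t (trunc j f) y)"
  using Q_SUP[OF _ trunc_incseq trunc_measurable, of t f y] by (simp add: trunc_SUP)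

lemma Q_measurable_trunc: "0 \<le> t \<Longrightarrow> f \<in> borel_measurable borel \<Longrightarrow> Q t (trunc j f) \<in> borel_measurable borel"
  by (rule Q_measurable_bounded[OF _ trunc_measurable trunc_le]) (auto simp: of_nat_less_top)

lemma Q_measurable [measurable]:
  assumes "0 \<le> t" "f \<in> borel_measurable borel"
  shows "Q t f \<in> borel_measurable borel"
proof -
  have "(\<lambda>y. SUP j. Q t (trunc j f) y) \<in> borel_measurable borel"
    by (intro borel_measurable_SUP Q_measurable_trunc assms) auto
  then show ?thesis by (simp add: Q_eq_SUP_trunc[OF assms, symmetric])
qed

lemma Q_trunc_incseq: "incseq (\<lambda>j. Q t (trunc j f))"
  by (auto simp: incseq_def le_fun_def intro!: Q_mono trunc_mono)

lemma Q_semigroup: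
  assumes s: "0 \<le> s" and t: "0 \<le> t" and f: "f \<in> borel_measurable borel"
  shows "Q (s + t) f y = Q s (Q t f) y"
proof -
  have "Q (s + t) f y = (SUP j. Q s (Q t (trunc j f)) y)"
    using s t f Q_semigroup_bounded[OF s t trunc_measurable[OF f] trunc_le]
    by (simp add: Q_eq_SUP_trunc[of "s + t"] ennreal_of_nat_eq_real_of_nat)
  also have "\<dots> = Q s (\<lambda>y. SUP j. Q t (trunc j f) y) y"
    by (intro Q_SUP[symmetric] Q_trunc_incseq Q_measurable_trunc s t f)
  also have "\<dots> = Q s (Q t f) y" by (simp add: Q_eq_SUP_trunc[OF t f, symmetric])
  finally show ?thesis .
qed

lemma nn_integral_SUP_mult:
  assumes F: "incseq F" "\<And>j. F j \<in> borel_measurable borel" and h: "h \<in> borel_measurable borel"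
  shows "(\<integral>\<^sup>+y. (SUP j. F j y) * h y \<partial>lborel) = (SUP j. \<integral>\<^sup>+y. F j y * h y \<partial>(lborel :: real measure))"
proof -
  note F(2)[measurable] h[measurable]
  have "(\<integral>\<^sup>+y. (SUP j. F j y) * h y \<partial>lborel) = (\<integral>\<^sup>+y. (SUP j. F j y * h y) \<partial>(lborel :: real measure))"
    by (simp add: SUP_mult_right_ennreal)
  also have "\<dots> = (SUP j. \<integral>\<^sup>+y. F j y * h y \<partial>lborel)"
    using F by (intro nn_integral_monotone_convergence_SUP) (auto simp: incseq_def le_fun_def intro!: mult_right_mono)
  finally show ?thesis .
qed

text \<open>Two monotone limits, taken one after the other: the truncation of \<open>f\<close> is
  removed with that of \<open>h\<close> in place, then the truncation of \<open>h\<close>. No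
  integrability remains, so the constant 1 is admissible later.\<close>

lemma Q_symmetric:
  assumes t: "0 \<le> t" and f: "f \<in> borel_measurable borel" and h: "h \<in> borel_measurable borel"
  shows "(\<integral>\<^sup>+y. Q t f y * h y \<partial>lborel) = (\<integral>\<^sup>+y. f y * Q t h y \<partial>lborel)"
proof -
  have 1: "(\<integral>\<^sup>+y. Q t f y * trunc i h y \<partial>lborel) = (\<integral>\<^sup>+y. Q t (trunc i h) y * f y \<partial>lborel)" for i
  proof -
    have "(\<integral>\<^sup>+y. Q t f y * trunc i h y \<partial>lborel) = (SUP j. \<integral>\<^sup>+y. Q t (trunc j f) y * trunc i h y \<partial>lborel)"
      unfolding Q_eq_SUP_trunc[OF t f]
      by (intro nn_integral_SUP_mult Q_trunc_incseq Q_measurable_trunc trunc_measurable t f h)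
    also have "\<dots> = (SUP j. \<integral>\<^sup>+y. trunc j f y * Q t (trunc i h) y \<partial>lborel)"
    proof (rule SUP_cong[OF refl])
      fix j
      have "trunc j f y \<le> of_nat (max i j)" "trunc i h y \<le> of_nat (max i j)" for y
        using trunc_le[of j f y] trunc_le[of i h y] by (auto intro: order_trans)
      then show "(\<integral>\<^sup>+y. Q t (trunc j f) y * trunc i h y \<partial>lborel) = (\<integral>\<^sup>+y. trunc j f y * Q t (trunc i h) y \<partial>lborel)"
        \<comment> \<open>The bounded version takes one bound for both functions, hence the
          maximum.\<close>
        by (subst Q_symmetric_bounded[where c="of_nat (max i j)"])
          (auto simp: t trunc_measurable f h trunc_integrable[unfolded infinity_ennreal_def] of_nat_less_top mult.commute simp del: of_nat_max)
    qed
    also have "\<dots> = (\<integral>\<^sup>+y. (SUP j. trunc j f y) * Q t (trunc i h) y \<partial>lborel)"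
      by (intro nn_integral_SUP_mult[symmetric] trunc_incseq Q_measurable_trunc trunc_measurable t f h)
    finally show ?thesis by (simp add: trunc_SUP mult.commute)
  qed
  have "(\<integral>\<^sup>+y. Q t f y * h y \<partial>lborel) = (\<integral>\<^sup>+y. (SUP i. trunc i h y) * Q t f y \<partial>lborel)"
    by (simp add: trunc_SUP mult.commute)
  also have "\<dots> = (SUP i. \<integral>\<^sup>+y. trunc i h y * Q t f y \<partial>lborel)"
    by (intro nn_integral_SUP_mult trunc_incseq trunc_measurable h Q_measurable t f)
  also have "\<dots> = (SUP i. \<integral>\<^sup>+y. Q t (trunc i h) y * f y \<partial>lborel)"
    by (subst mult.commute) (simp only: 1)
  also have "\<dots> = (\<integral>\<^sup>+y. (SUP i. Q t (trunc i h) y) * f y \<partial>lborel)"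
    by (intro nn_integral_SUP_mult[symmetric] Q_trunc_incseq Q_measurable_trunc t f h)
  finally show ?thesis by (simp add: Q_eq_SUP_trunc[OF t h, symmetric] mult.commute)
qed

end

section \<open>The semigroup on square-integrable functions\<close>

lemma L2_measurable [measurable_dest]: "u \<in> L2 \<Longrightarrow> u \<in> borel_measurable borel"
  by (simp add: L2_def)

lemma L2_integrable: "u \<in> L2 \<Longrightarrow> integrable lborel (\<lambda>x. (u x)\<^sup>2)"
  by (simp add: L2_def)

lemma L2_bound:
  assumes "u \<in> L2" "v \<in> borel_measurable borel" "\<And>x. (v x)\<^sup>2 \<le> C * (u x)\<^sup>2"
  shows "v \<in> L2"
proof -
  note assms(2)[measurable]
  have "integrable lborel (\<lambda>x. (v x)\<^sup>2)"
  proof (rule Bochner_Integration.integrable_bound)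
    show "integrable lborel (\<lambda>x. C * (u x)\<^sup>2)" using L2_integrable[OF assms(1)] by simp
    show "AE x in lborel. norm ((v x)\<^sup>2) \<le> norm (C * (u x)\<^sup>2)"
      using assms(3) by (auto intro: order_trans[OF _ abs_ge_self])
  qed measurable
  then show ?thesis using assms(2) by (simp add: L2_def)
qed

lemma L2_mult_integrable:
  assumes "u \<in> L2" "v \<in> L2"
  shows "integrable lborel (\<lambda>x. u x * v x)"
proof (rule Bochner_Integration.integrable_bound)
  note assms[THEN L2_measurable, measurable]
  show "integrable lborel (\<lambda>x. (u x)\<^sup>2 + (v x)\<^sup>2)" using assms by (simp add: L2_integrable)
  have "\<bar>a * b\<bar> \<le> a\<^sup>2 + b\<^sup>2" for a b :: real
  proof -
    have "2 * (\<bar>a\<bar> * \<bar>b\<bar>) \<le> \<bar>a\<bar>\<^sup>2 + \<bar>b\<bar>\<^sup>2" using sum_squares_bound[of "\<bar>a\<bar>" "\<bar>b\<bar>"] by simp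
    moreover have "0 \<le> \<bar>a\<bar> * \<bar>b\<bar>" by simp
    ultimately show ?thesis unfolding abs_mult power2_abs by linarith
  qed
  then show "AE x in lborel. norm (u x * v x) \<le> norm ((u x)\<^sup>2 + (v x)\<^sup>2)"
    by (auto intro: order_trans[OF _ abs_ge_self])
qed (use assms[THEN L2_measurable] in measurable)

lemma L2_lincomb:
  assumes "u \<in> L2" "v \<in> L2"
  shows "(\<lambda>x. a * u x + b * v x) \<in> L2"
proof -
  note assms[THEN L2_measurable, measurable]
  have "integrable lborel (\<lambda>x. a\<^sup>2 * (u x)\<^sup>2 + (2 * a * b) * (u x * v x) + b\<^sup>2 * (v x)\<^sup>2)"
    using assms by (intro Bochner_Integration.integrable_add integrable_mult_right L2_integrable L2_mult_integrable)
  also have "(\<lambda>x. a\<^sup>2 * (u x)\<^sup>2 + (2 * a * b) * (u x * v x) + b\<^sup>2 * (v x)\<^sup>2) = (\<lambda>x. (a * u x + b * v x)\<^sup>2)"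
    by (auto simp: power2_eq_square algebra_simps)
  finally have "integrable lborel (\<lambda>x. (a * u x + b * v x)\<^sup>2)" .
  moreover have "(\<lambda>x. a * u x + b * v x) \<in> borel_measurable borel" by measurable
  ultimately show ?thesis by (simp add: L2_def)
qed

lemma L2_diff: "u \<in> L2 \<Longrightarrow> v \<in> L2 \<Longrightarrow> (\<lambda>x. u x - v x) \<in> L2"
  using L2_lincomb[of u v 1 "-1"] by simp

lemma L2_nn_integral: "u \<in> L2 \<Longrightarrow> (\<integral>\<^sup>+x. ennreal ((u x)\<^sup>2) \<partial>lborel) = ennreal (LINT x|lborel. (u x)\<^sup>2)"
  by (intro nn_integral_eq_integral L2_integrable) auto

lemma L2_I:
  assumes [measurable]: "u \<in> borel_measurable borel" and "(\<integral>\<^sup>+x. ennreal ((u x)\<^sup>2) \<partial>lborel) < \<infinity>"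
  shows "u \<in> L2"
  unfolding L2_def using assms by (auto intro!: integrableI_nonneg)

lemma L2_pos_part: "u \<in> L2 \<Longrightarrow> (\<lambda>x. max 0 (u x)) \<in> L2"
proof (rule L2_bound[where C=1])
  assume "u \<in> L2"
  then show "(\<lambda>x. max 0 (u x)) \<in> borel_measurable borel" by (intro borel_measurable_max) (auto simp: L2_def)
  show "(max 0 (u x))\<^sup>2 \<le> 1 * (u x)\<^sup>2" for x by (auto simp: max_def)
qed

lemma L2_neg_part: "u \<in> L2 \<Longrightarrow> (\<lambda>x. max 0 (- u x)) \<in> L2"
  using L2_pos_part[of "\<lambda>x. - u x"] L2_lincomb[of u u "-1" 0] by simp

context interface_process
begin

text \<open>Right-continuity at time 0 keeps the path on its side and away from 0 for a while; up to
  then the only sign used is \<open>\<sigma> 0\<close>, which is 1.\<close>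

lemma zo_initial:
  assumes w: "good_path w" and y: "y \<noteq> 0"
  obtains b where "0 < b" "\<And>t. 0 \<le> t \<Longrightarrow> t < b \<Longrightarrow> alive t y w \<and> zo t y w = y + \<zeta> t w"
proof -
  have z: "cadlag_path (\<lambda>t. \<zeta> t w)" "\<zeta> 0 w = 0" "w \<in> space M" using w by (auto simp: good_path_def)
  obtain b where b: "b > 0" "\<And>r. 0 \<le> r \<Longrightarrow> r < b \<Longrightarrow> \<bar>(y + \<zeta> r w) - (y + \<zeta> 0 w)\<bar> < \<bar>y\<bar> / 2"
    using right_ball[OF z(1), of 0 "\<bar>y\<bar> / 2" y] y by auto
  have near: "\<bar>\<zeta> r w\<bar> < \<bar>y\<bar> / 2" if "0 \<le> r" "r < b" for r using b(2)[OF that] z(2) by simp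
  have pos: "0 < y * (y + \<zeta> r w)" if "0 \<le> r" "r < b" for r
    using near[OF that] y by (auto simp: zero_less_mult_iff abs_if split: if_splits)
  have T1: "ereal b \<le> crossing_time (\<lambda>s. \<zeta> s w) y (Suc 0)"
    unfolding crossing_time.simps
  proof (intro Inf_greatest, clarify)
    fix r assume r: "0 < ereal r" "(- 1) ^ 0 * y * (y + \<zeta> r w) < 0"
    with pos[of r] show "ereal b \<le> ereal r" by (cases "r < b") auto
  qed
  show thesis
  proof (rule that[OF b(1)])
    fix t assume t: "0 \<le> t" "t < b"
    have aw: "away (\<bar>y\<bar> / 2) t y w"
      unfolding away_def
    proof
      fix s assume "s \<in> {0..t}"
      then have "\<bar>\<zeta> s w\<bar> < \<bar>y\<bar> / 2" using near[of s] t by auto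
      then show "\<bar>y\<bar> / 2 \<le> \<bar>y + \<zeta> s w\<bar>" by (auto simp: abs_if split: if_splits)
    qed
    have "crossing_time (\<lambda>s. \<zeta> s w) y 0 \<le> ereal t" using t by simp
    moreover have "ereal t < crossing_time (\<lambda>s. \<zeta> s w) y (Suc 0)" using t T1 by (meson ereal_less(2) less_ereal.simps(1) less_le_trans)
    ultimately have "zo t y w = sign_prod 0 w * (y + \<zeta> t w)"
      using zo_eq[OF w _ aw t(1)] y by simp
    then show "alive t y w \<and> zo t y w = y + \<zeta> t w"
      using aw y sign_0[OF z(3)] by (auto simp: alive_def sign_prod_def intro!: exI[of _ "\<bar>y\<bar> / 2"])
  qed
qed

lemma AE_good_completion: "AE w in completion M. good_path w"
  by (rule AE_completion[OF AE_good_path])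

lemma Q_0: "y \<noteq> 0 \<Longrightarrow> Q 0 f y = f y"
proof -
  assume y: "y \<noteq> 0"
  have "Q 0 f y = (\<integral>\<^sup>+w. f y \<partial>completion M)"
    unfolding Q_def
  proof (rule nn_integral_cong_AE, use AE_good_completion in eventually_elim)
    case (elim w)
    then obtain b where "0 < b" "\<And>t. 0 \<le> t \<Longrightarrow> t < b \<Longrightarrow> alive t y w \<and> zo t y w = y + \<zeta> t w"
      using zo_initial[OF elim y] by metis
    from this(2)[of 0] this(1) elim show ?case by (simp add: good_path_def)
  qed
  then show ?thesis by (simp add: emeasure_completion_space)
qed

lemma not_alive_at_0: "good_path w \<Longrightarrow> 0 \<le> t \<Longrightarrow> \<not> alive t 0 w"
  using away_start[of w t _ 0] by (force simp: alive_def)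

lemma Q_at_0: "0 \<le> t \<Longrightarrow> Q t f 0 = 0"
  unfolding Q_def by (subst nn_integral_cong_AE[where v="\<lambda>_. 0"])
    (use AE_good_completion in \<open>auto elim!: eventually_mono simp: not_alive_at_0\<close>)

text \<open>Reflection preserves the modulus, so \<open>f\<close> at the end point is at most the
  sum of \<open>f\<close> at \<open>y + \<zeta> t\<close> and at its mirror image. The bounded
  density then makes the expectation finite at every \<open>y\<close>, not just at almost every
  one.\<close>

lemma Q_finite_pos_time:
  assumes t: "0 < t" and f [measurable]: "f \<in> borel_measurable borel" and fin: "(\<integral>\<^sup>+x. f x \<partial>lborel) < \<infinity>"
  shows "Q t f y < \<infinity>"
proof -
  have [measurable]: "\<zeta> t \<in> borel_measurable M" using t by simp
  define F where "F x = f (y + x) + f (- (y + x))" for x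
  have [measurable]: "F \<in> borel_measurable borel" unfolding F_def by measurable
  have "Q t f y \<le> (\<integral>\<^sup>+w. F (\<zeta> t w) \<partial>completion M)"
    unfolding Q_def
  proof (rule nn_integral_mono_AE, use AE_good_completion in eventually_elim)
    case (elim w)
    show ?case using zo_abs[OF elim, of t y] t by (cases "alive t y w") (auto simp: F_def)
  qed
  also have "\<dots> = (\<integral>\<^sup>+x. F x \<partial>law t)"
    unfolding nn_integral_completion law_def by (subst nn_integral_distr) auto
  also have "\<dots> \<le> ennreal (density_bound * t powr (- 1 / \<alpha>)) * (\<integral>\<^sup>+x. F x \<partial>lborel)"
    by (rule nn_integral_law_le[OF t]) measurable
  also have "(\<integral>\<^sup>+x. F x \<partial>lborel) = (\<integral>\<^sup>+x. f x \<partial>lborel) + (\<integral>\<^sup>+x. f x \<partial>lborel)"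
    unfolding F_def using nn_integral_translate[OF f, of y] nn_integral_reflect[OF f, of y]
    by (subst nn_integral_add) (auto simp: add.commute)
  also have "ennreal (density_bound * t powr (- 1 / \<alpha>)) * \<dots> < \<infinity>"
    using fin by (simp add: ennreal_mult_less_top)
  finally show ?thesis .
qed

lemma Q_square_finite:
  assumes t: "0 \<le> t" and u: "u \<in> L2"
  shows "Q t (\<lambda>x. ennreal ((u x)\<^sup>2)) y < \<infinity>"
proof -
  note L2_measurable[OF u, measurable]
  consider "0 < t" | "t = 0" "y \<noteq> 0" | "y = 0" using t by linarith
  then show ?thesis
  proof cases
    case 1
    then show ?thesis by (rule Q_finite_pos_time) (auto simp: L2_nn_integral[OF u])
  qed (auto simp: Q_0 Q_at_0 t)
qed

section \<open>The operators on square-integrable functions\<close>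

definition X :: "real \<Rightarrow> (real \<Rightarrow> real) \<Rightarrow> real \<Rightarrow> 'w \<Rightarrow> real" where
  "X t u y w = (if alive t y w then u (zo t y w) else 0)"

definition P :: "real \<Rightarrow> (real \<Rightarrow> real) \<Rightarrow> real \<Rightarrow> real" where
  "P t u y = (LINT w|completion M. X t u y w)"

lemma X_measurable: "0 \<le> t \<Longrightarrow> u \<in> borel_measurable borel \<Longrightarrow> X t u y \<in> borel_measurable (completion M)"
  unfolding X_def[abs_def] by (rule measurable_if_compose[OF measurable_alive]) auto

lemma X_lincomb: "X t (\<lambda>x. a * u x + b * v x) y w = a * X t u y w + b * X t v y w"
  by (simp add: X_def)

lemma X_square: "(\<integral>\<^sup>+w. ennreal ((X t u y w)\<^sup>2) \<partial>completion M) = Q t (\<lambda>x. ennreal ((u x)\<^sup>2)) y"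
  unfolding Q_def by (intro nn_integral_cong) (simp add: X_def)

lemma X_square_integrable:
  assumes "0 \<le> t" "u \<in> L2"
  shows "integrable (completion M) (\<lambda>w. (X t u y w)\<^sup>2)"
proof (rule integrableI_nonneg)
  show "(\<lambda>w. (X t u y w)\<^sup>2) \<in> borel_measurable (completion M)"
    by (intro borel_measurable_power X_measurable assms L2_measurable)
  show "(\<integral>\<^sup>+w. ennreal ((X t u y w)\<^sup>2) \<partial>completion M) < \<infinity>"
    unfolding X_square by (rule Q_square_finite[OF assms])
qed auto

lemma X_integrable:
  assumes "0 \<le> t" "u \<in> L2"
  shows "integrable (completion M) (X t u y)"
proof -
  interpret C: prob_space "completion M" by (rule prob_space_completion)
  show ?thesis
    by (rule C.square_integrable_imp_integrable[OF X_measurable X_square_integrable])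
      (use assms in \<open>auto dest: L2_measurable\<close>)
qed

text \<open>Jensen's inequality for the square, read off from the nonnegativity of the
  variance.\<close>

lemma P_square_le:
  assumes "0 \<le> t" "u \<in> L2"
  shows "ennreal ((P t u y)\<^sup>2) \<le> Q t (\<lambda>x. ennreal ((u x)\<^sup>2)) y"
proof -
  interpret C: prob_space "completion M" by (rule prob_space_completion)
  have "(P t u y)\<^sup>2 \<le> (LINT w|completion M. (X t u y w)\<^sup>2)"
    using C.variance_positive[of "X t u y"] C.variance_eq[OF X_integrable[OF assms] X_square_integrable[OF assms]]
    by (simp add: P_def)
  then have "ennreal ((P t u y)\<^sup>2) \<le> ennreal (LINT w|completion M. (X t u y w)\<^sup>2)" by (rule ennreal_leI)
  also have "\<dots> = (\<integral>\<^sup>+w. ennreal ((X t u y w)\<^sup>2) \<partial>completion M)"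
    by (rule nn_integral_eq_integral[symmetric, OF X_square_integrable[OF assms]]) auto
  finally show ?thesis by (simp add: X_square)
qed

lemma P_lincomb:
  assumes "0 \<le> t" "u \<in> L2" "v \<in> L2"
  shows "P t (\<lambda>x. a * u x + b * v x) y = a * P t u y + b * P t v y"
  unfolding P_def X_lincomb using X_integrable[OF assms(1)] assms(2,3) by simp

lemma P_diff: "0 \<le> t \<Longrightarrow> u \<in> L2 \<Longrightarrow> v \<in> L2 \<Longrightarrow> P t (\<lambda>x. u x - v x) y = P t u y - P t v y"
  using P_lincomb[of t u v 1 "-1" y] by simp

lemma P_eq_Q:
  assumes "0 \<le> t" "u \<in> L2" "\<And>x. 0 \<le> u x"
  shows "ennreal (P t u y) = Q t (\<lambda>x. ennreal (u x)) y"
proof -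
  have "ennreal (P t u y) = (\<integral>\<^sup>+w. ennreal (X t u y w) \<partial>completion M)"
    unfolding P_def using assms(3)
    by (intro nn_integral_eq_integral[symmetric] X_integrable assms) (simp add: X_def)
  also have "\<dots> = Q t (\<lambda>x. ennreal (u x)) y"
    unfolding Q_def by (intro nn_integral_cong) (simp add: X_def)
  finally show ?thesis .
qed

lemma P_nonneg: "(\<And>x. 0 \<le> u x) \<Longrightarrow> 0 \<le> P t u y"
  unfolding P_def by (intro Bochner_Integration.integral_nonneg) (simp add: X_def)

lemma P_bound:
  assumes "0 \<le> t" "u \<in> L2" "\<And>x. \<bar>u x\<bar> \<le> B"
  shows "\<bar>P t u y\<bar> \<le> B"
proof -
  interpret C: prob_space "completion M" by (rule prob_space_completion)
  have "\<bar>P t u y\<bar> \<le> (LINT w|completion M. \<bar>X t u y w\<bar>)"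
    unfolding P_def by (rule integral_abs_bound)
  also have "\<dots> \<le> (LINT w|completion M. B)"
  proof (rule integral_mono)
    show "integrable (completion M) (\<lambda>w. \<bar>X t u y w\<bar>)"
      by (intro integrable_abs X_integrable assms)
    show "\<bar>X t u y w\<bar> \<le> B" for w
      using assms(3) order_trans[OF abs_ge_zero assms(3)] by (simp add: X_def)
  qed simp
  finally show ?thesis using C.prob_space by simp
qed

text \<open>On nonnegative functions \<open>P\<close> agrees with \<open>Q\<close>; this
  decomposition carries measurability, symmetry and the semigroup law over to signed
  functions.\<close>

lemma P_split:
  assumes "0 \<le> t" "u \<in> L2"
  shows "P t u = (\<lambda>y. P t (\<lambda>x. max 0 (u x)) y - P t (\<lambda>x. max 0 (- u x)) y)"
proof
  fix y
  have "P t u y = P t (\<lambda>x. max 0 (u x) - max 0 (- u x)) y"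
    by (rule arg_cong[where f="\<lambda>u. P t u y"]) (auto simp: max_def)
  then show "P t u y = P t (\<lambda>x. max 0 (u x)) y - P t (\<lambda>x. max 0 (- u x)) y"
    using assms by (simp add: P_diff L2_pos_part L2_neg_part)
qed

lemma P_measurable:
  assumes "0 \<le> t" "u \<in> L2"
  shows "P t u \<in> borel_measurable borel"
proof -
  have pos: "P t v \<in> borel_measurable borel" if v: "v \<in> L2" "\<And>x. 0 \<le> v x" for v
  proof -
    have "P t v = (\<lambda>y. enn2real (Q t (\<lambda>x. ennreal (v x)) y))"
      by (rule ext) (simp add: P_eq_Q[OF assms(1) v, symmetric] P_nonneg v)
    moreover have "Q t (\<lambda>x. ennreal (v x)) \<in> borel_measurable borel"
      using assms(1) L2_measurable[OF v(1)] by (intro Q_measurable) auto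
    ultimately show ?thesis by simp
  qed
  show ?thesis
    unfolding P_split[OF assms]
    by (intro borel_measurable_diff pos L2_pos_part L2_neg_part assms) auto
qed

lemma P_L2_contraction:
  assumes "0 \<le> t" "u \<in> L2"
  shows "P t u \<in> L2" "(LINT y|lborel. (P t u y)\<^sup>2) \<le> (LINT y|lborel. (u y)\<^sup>2)"
proof -
  note L2_measurable[OF assms(2), measurable]
  have "(\<integral>\<^sup>+y. ennreal ((P t u y)\<^sup>2) \<partial>lborel) \<le> (\<integral>\<^sup>+y. Q t (\<lambda>x. ennreal ((u x)\<^sup>2)) y * 1 \<partial>lborel)"
    using P_square_le[OF assms] by (intro nn_integral_mono) simp
  \<comment> \<open>Symmetry against the constant 1, which is not integrable; the loss of mass in
    \<open>Q t (\<lambda>_. 1) \<le> 1\<close> then gives the contraction.\<close>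
  also have "\<dots> = (\<integral>\<^sup>+y. ennreal ((u y)\<^sup>2) * Q t (\<lambda>_. 1) y \<partial>lborel)"
    using assms(1) by (intro Q_symmetric) auto
  also have "\<dots> \<le> (\<integral>\<^sup>+y. ennreal ((u y)\<^sup>2) * 1 \<partial>lborel)"
    by (intro nn_integral_mono mult_left_mono Q_le) auto
  also have "\<dots> = ennreal (LINT y|lborel. (u y)\<^sup>2)" using L2_nn_integral[OF assms(2)] by simp
  finally have le: "(\<integral>\<^sup>+y. ennreal ((P t u y)\<^sup>2) \<partial>lborel) \<le> ennreal (LINT y|lborel. (u y)\<^sup>2)" .
  show L2: "P t u \<in> L2"
    by (rule L2_I[OF P_measurable[OF assms]]) (use le in \<open>auto intro: le_less_trans\<close>)
  show "(LINT y|lborel. (P t u y)\<^sup>2) \<le> (LINT y|lborel. (u y)\<^sup>2)"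
    using le unfolding L2_nn_integral[OF L2] by (subst (asm) ennreal_le_iff) auto
qed

lemma P_semigroup:
  assumes s: "0 \<le> s" and t: "0 \<le> t" and u: "u \<in> L2"
  shows "P (s + t) u y = P s (P t u) y"
proof -
  have pos: "P (s + t) v y = P s (P t v) y" if v: "v \<in> L2" "\<And>x. 0 \<le> v x" for v
  proof -
    have "ennreal (P s (P t v) y) = Q s (\<lambda>x. ennreal (P t v x)) y"
      by (intro P_eq_Q s P_L2_contraction t v P_nonneg)
    also have "\<dots> = Q s (Q t (\<lambda>x. ennreal (v x))) y" by (simp add: P_eq_Q[OF t v])
    also have "\<dots> = Q (s + t) (\<lambda>x. ennreal (v x)) y"
      using L2_measurable[OF v(1)] by (intro Q_semigroup[symmetric] s t) auto
    also have "\<dots> = ennreal (P (s + t) v y)" using s t by (intro P_eq_Q[symmetric] v) auto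
    finally show ?thesis using P_nonneg[OF v(2)] P_nonneg[OF P_nonneg[OF v(2)]] by simp
  qed
  have st: "0 \<le> s + t" using s t by simp
  let ?u1 = "\<lambda>x. max 0 (u x)" and ?u2 = "\<lambda>x. max 0 (- u x)"
  have L: "?u1 \<in> L2" "?u2 \<in> L2" by (intro L2_pos_part L2_neg_part u)+
  have "P s (P t u) y = P s (P t ?u1) y - P s (P t ?u2) y"
    unfolding P_split[OF t u] by (rule P_diff[OF s]) (intro P_L2_contraction t L)+
  also have "\<dots> = P (s + t) u y"
    unfolding P_split[OF st u] by (simp add: pos[OF L(1)] pos[OF L(2)])
  finally show ?thesis by simp
qed

lemma P_symmetric:
  assumes t: "0 \<le> t" and u: "u \<in> L2" and v: "v \<in> L2"
  shows "(LINT y|lborel. P t u y * v y) = (LINT y|lborel. u y * P t v y)"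
proof -
  have pos: "(LINT y|lborel. P t u y * v y) = (LINT y|lborel. u y * P t v y)"
    if u: "u \<in> L2" "\<And>x. 0 \<le> u x" and v: "v \<in> L2" "\<And>x. 0 \<le> v x" for u v
  proof -
    note [measurable] = L2_measurable[OF u(1)] L2_measurable[OF v(1)] P_measurable[OF t u(1)] P_measurable[OF t v(1)]
    have "(LINT y|lborel. P t u y * v y) = enn2real (\<integral>\<^sup>+y. ennreal (P t u y * v y) \<partial>lborel)"
      using P_nonneg[OF u(2)] v(2) by (intro integral_eq_nn_integral) auto
    also have "(\<integral>\<^sup>+y. ennreal (P t u y * v y) \<partial>lborel) = (\<integral>\<^sup>+y. Q t (\<lambda>x. ennreal (u x)) y * ennreal (v y) \<partial>lborel)"
      using P_nonneg[OF u(2)] v(2) by (simp add: ennreal_mult P_eq_Q[OF t u])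
    also have "\<dots> = (\<integral>\<^sup>+y. ennreal (u y) * Q t (\<lambda>x. ennreal (v x)) y \<partial>lborel)"
      by (intro Q_symmetric t) auto
    also have "\<dots> = (\<integral>\<^sup>+y. ennreal (u y * P t v y) \<partial>lborel)"
      using P_nonneg[OF v(2)] u(2) by (simp add: ennreal_mult P_eq_Q[OF t v])
    also have "enn2real \<dots> = (LINT y|lborel. u y * P t v y)"
      using P_nonneg[OF v(2)] u(2) by (intro integral_eq_nn_integral[symmetric]) auto
    finally show ?thesis .
  qed
  define u1 u2 v1 v2 where d: "u1 = (\<lambda>x. max 0 (u x))" "u2 = (\<lambda>x. max 0 (- u x))"
    "v1 = (\<lambda>x. max 0 (v x))" "v2 = (\<lambda>x. max 0 (- v x))"
  have L: "u1 \<in> L2" "u2 \<in> L2" "v1 \<in> L2" "v2 \<in> L2"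
    unfolding d by (intro L2_pos_part L2_neg_part u v)+
  have nn: "0 \<le> u1 x" "0 \<le> u2 x" "0 \<le> v1 x" "0 \<le> v2 x" for x by (auto simp: d)
  have PL: "P t u1 \<in> L2" "P t u2 \<in> L2" "P t v1 \<in> L2" "P t v2 \<in> L2"
    by (intro P_L2_contraction t L)+
  have e: "u y = u1 y - u2 y" "v y = v1 y - v2 y" for y by (auto simp: d max_def)
  have Pe: "P t u y = P t u1 y - P t u2 y" "P t v y = P t v1 y - P t v2 y" for y
    using P_split[OF t u] P_split[OF t v] by (simp_all add: d)
  have expand: "(LINT y|lborel. (a y - b y) * (c y - e y)) =
      (LINT y|lborel. a y * c y) - (LINT y|lborel. a y * e y) - (LINT y|lborel. b y * c y) + (LINT y|lborel. b y * e y)"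
    if "a \<in> L2" "b \<in> L2" "c \<in> L2" "e \<in> L2" for a b c e
    using that by (simp add: algebra_simps L2_mult_integrable)
  show ?thesis
    unfolding e Pe
    by (subst (1 2) expand) (auto simp: L PL pos[OF L(1) nn(1) L(3) nn(3)] pos[OF L(1) nn(1) L(4) nn(4)]
        pos[OF L(2) nn(2) L(3) nn(3)] pos[OF L(2) nn(2) L(4) nn(4)])
qed

lemma P_0: "y \<noteq> 0 \<Longrightarrow> u \<in> L2 \<Longrightarrow> P 0 u y = u y"
proof -
  assume y: "y \<noteq> 0" and u: "u \<in> L2"
  have pos: "P 0 v y = v y" if v: "v \<in> L2" "\<And>x. 0 \<le> v x" for v
    using P_eq_Q[OF order_refl v, of y] Q_0[OF y] P_nonneg[where t=0 and y=y, OF v(2)] v(2)[of y] by simp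
  have "P 0 (\<lambda>x. max 0 (u x)) y = max 0 (u y)" "P 0 (\<lambda>x. max 0 (- u x)) y = max 0 (- u y)"
    by (rule pos[OF L2_pos_part[OF u]] pos[OF L2_neg_part[OF u]], simp)+
  then show ?thesis unfolding P_split[OF order_refl u] by (simp add: max_def)
qed

text \<open>The difference is 0 in norm, and the contraction keeps it so.\<close>

lemma P_respects_AE:
  assumes t: "0 \<le> t" and u: "u \<in> L2" and v: "v \<in> L2" and eq: "AE y in lborel. u y = v y"
  shows "AE y in lborel. P t u y = P t v y"
proof -
  define d where "d = (\<lambda>x. u x - v x)"
  have d: "d \<in> L2" unfolding d_def by (rule L2_diff[OF u v])
  note L2_measurable[OF d, measurable]
  have "(LINT y|lborel. (d y)\<^sup>2) = (LINT y|(lborel :: real measure). 0)"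
    using eq by (intro integral_cong_AE) (auto simp: d_def elim!: eventually_mono, use d in \<open>auto simp: d_def dest: L2_measurable\<close>)
  then have "(LINT y|lborel. (P t d y)\<^sup>2) \<le> 0" using P_L2_contraction(2)[OF t d] by simp
  moreover have "0 \<le> (LINT y|lborel. (P t d y)\<^sup>2)" by simp
  ultimately have "(LINT y|lborel. (P t d y)\<^sup>2) = 0" by simp
  then have "AE y in lborel. (P t d y)\<^sup>2 = 0"
    using integral_nonneg_eq_0_iff_AE[OF L2_integrable[OF P_L2_contraction(1)[OF t d]]] by simp
  then show ?thesis by eventually_elim (simp add: d_def P_diff[OF t u v])
qed

text \<open>Clamping to the unit interval yields a representative with bounds everywhere, as
  expectations need them.\<close>

lemma P_sub_markov:
  assumes t: "0 \<le> t" and u: "u \<in> L2" and le: "AE y in lborel. 0 \<le> u y \<and> u y \<le> 1"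
  shows "AE y in lborel. 0 \<le> P t u y \<and> P t u y \<le> 1"
proof -
  define v where "v x = max 0 (min 1 (u x))" for x
  have v: "v \<in> L2"
  proof (rule L2_bound[OF u, where C=1])
    show "v \<in> borel_measurable borel" unfolding v_def[abs_def] using L2_measurable[OF u] by measurable
    show "(v x)\<^sup>2 \<le> 1 * (u x)\<^sup>2" for x
      unfolding v_def mult_1 abs_le_square_iff[symmetric] by (auto simp: max_def min_def)
  qed
  have "AE y in lborel. u y = v y" using le by eventually_elim (auto simp: v_def)
  from P_respects_AE[OF t u v this] show ?thesis
  proof eventually_elim
    case (elim y)
    moreover have "0 \<le> P t v y" by (rule P_nonneg) (simp add: v_def)
    moreover have "\<bar>P t v y\<bar> \<le> 1" by (rule P_bound[OF t v]) (auto simp: v_def)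
    ultimately show ?case by simp
  qed
qed

end

section \<open>Strong continuity and conclusion\<close>

definition compactly_supported :: "real \<Rightarrow> (real \<Rightarrow> real) \<Rightarrow> bool" where
  "compactly_supported B u \<longleftrightarrow> continuous_on UNIV u \<and> (\<forall>x. \<bar>u x\<bar> \<le> B * indicator {-B..B} x)"

lemma compactly_supported_L2:
  assumes "compactly_supported B u"
  shows "u \<in> L2"
proof (rule L2_bound[where C=1])
  have B: "\<bar>u x\<bar> \<le> B * indicator {-B..B} x" for x using assms by (auto simp: compactly_supported_def)
  show "u \<in> borel_measurable borel"
    using assms by (auto simp: compactly_supported_def intro: borel_measurable_continuous_onI)
  show "(u x)\<^sup>2 \<le> 1 * (B * indicator {-B..B} x)\<^sup>2" for x
    unfolding mult_1 abs_le_square_iff[symmetric] using B[of x] by linarith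
  have "integrable lborel (\<lambda>x. B\<^sup>2 * indicator {-B..B} x)"
    by (intro integrable_mult_right integrable_real_indicator) (auto simp: emeasure_lborel_Icc_eq)
  also have "(\<lambda>x. B\<^sup>2 * indicator {-B..B} x) = (\<lambda>x. (B * indicator {-B..B} x)\<^sup>2)"
    by (auto simp: indicator_def)
  finally show "(\<lambda>x. B * indicator {-B..B} x) \<in> L2" by (simp add: L2_def)
qed

lemma compactly_supported_bound:
  assumes "compactly_supported B u"
  shows "\<bar>u x\<bar> \<le> B * indicator {-B..B} x" "\<bar>u x\<bar> \<le> \<bar>B\<bar>"
proof -
  show 1: "\<bar>u x\<bar> \<le> B * indicator {-B..B} x" using assms by (simp add: compactly_supported_def)
  then show "\<bar>u x\<bar> \<le> \<bar>B\<bar>" by (cases "x \<in> {-B..B}") auto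
qed

lemma L2_triangle:
  assumes "u \<in> L2" "v \<in> L2"
  shows "(LINT x|lborel. (u x + v x)\<^sup>2) \<le> 2 * (LINT x|lborel. (u x)\<^sup>2) + 2 * (LINT x|lborel. (v x)\<^sup>2)"
proof -
  have "(LINT x|lborel. (u x + v x)\<^sup>2) \<le> (LINT x|lborel. 2 * (u x)\<^sup>2 + 2 * (v x)\<^sup>2)"
  proof (rule integral_mono)
    show "integrable lborel (\<lambda>x. (u x + v x)\<^sup>2)" using L2_integrable[OF L2_lincomb[OF assms, of 1 1]] by simp
    show "integrable lborel (\<lambda>x. 2 * (u x)\<^sup>2 + 2 * (v x)\<^sup>2)" using assms by (simp add: L2_integrable)
    show "(u x + v x)\<^sup>2 \<le> 2 * (u x)\<^sup>2 + 2 * (v x)\<^sup>2" for x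
      using zero_le_power2[of "u x - v x"] by (simp add: power2_eq_square algebra_simps)
  qed
  then show ?thesis using assms by (simp add: L2_integrable)
qed

lemma L2_truncation:
  assumes u: "u \<in> L2" and e: "0 < e"
  obtains n :: nat where "(LINT x|lborel. (u x - max (- real n) (min (real n) (u x)) * indicator {-real n..real n} x)\<^sup>2) < e"
proof -
  note L2_measurable[OF u, measurable]
  define v where "v n x = max (- real n) (min (real n) (u x)) * indicator {-real n..real n} x" for n x
  have "(\<lambda>n. LINT x|lborel. (u x - v n x)\<^sup>2) \<longlonglongrightarrow> (LINT x|(lborel :: real measure). 0)"
  proof (rule integral_dominated_convergence[where w="\<lambda>x. (u x)\<^sup>2"])
    show "AE x in lborel. (\<lambda>n. (u x - v n x)\<^sup>2) \<longlonglongrightarrow> 0"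
    proof (rule AE_I2, rule tendsto_eventually)
      fix x
      show "\<forall>\<^sub>F n in sequentially. (u x - v n x)\<^sup>2 = 0"
        using eventually_ge_at_top[of "nat \<lceil>max \<bar>x\<bar> \<bar>u x\<bar>\<rceil>"]
      proof eventually_elim
        case (elim n)
        then have "max \<bar>x\<bar> \<bar>u x\<bar> \<le> real n" by linarith
        then have "\<bar>x\<bar> \<le> real n" "\<bar>u x\<bar> \<le> real n" by auto
        then show ?case by (simp add: v_def abs_le_iff max_def min_def)
      qed
    qed
    show "AE x in lborel. norm ((u x - v n x)\<^sup>2) \<le> (u x)\<^sup>2" for n
    proof (rule AE_I2)
      fix x
      have "\<bar>u x - v n x\<bar> \<le> \<bar>u x\<bar>" by (auto simp: v_def indicator_def max_def min_def)
      then show "norm ((u x - v n x)\<^sup>2) \<le> (u x)\<^sup>2" by (simp add: abs_le_square_iff)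
    qed
  qed (auto simp: v_def[abs_def] L2_integrable[OF u])
  then have "\<forall>\<^sub>F n in sequentially. (LINT x|lborel. (u x - v n x)\<^sup>2) < e"
    using e by (intro order_tendstoD(2)) auto
  then show thesis using that unfolding v_def by (meson eventually_happens sequentially_bot)
qed

text \<open>Off a negligible set \<open>v\<close> is a limit of continuous functions. Clamping them
  to \<open>{-B..B}\<close> and multiplying by a continuous cut-off, equal to 1 on
  \<open>{-B..B}\<close> and to 0 outside \<open>{-(B+1)..B+1}\<close>, provides an integrable
  majorant and leaves the limit unchanged.\<close>

lemma bounded_L2_approx:
  assumes v [measurable]: "v \<in> borel_measurable borel" and B: "0 \<le> B" "\<And>x. \<bar>v x\<bar> \<le> B * indicator {-B..B} x" and e: "0 < e"
  obtains g where "compactly_supported (B + 1) g" "(LINT x|lborel. (v x - g x)\<^sup>2) < e"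
proof -
  have "v measurable_on UNIV"
    using measurable_on_iff_borel_measurable[of UNIV v] v
    by (auto simp: lebesgue_on_UNIV_eq intro: measurable_completion)
  then obtain N F where N: "negligible N" and F: "\<And>n. continuous_on UNIV (F n)"
    "\<And>x. x \<notin> N \<Longrightarrow> (\<lambda>n. F n x) \<longlonglongrightarrow> v x"
    by (auto simp: measurable_on_def)
  define cut where "cut x = max 0 (min 1 (B + 1 - \<bar>x\<bar>))" for x :: real
  define g where "g n x = max (- B) (min B (F n x)) * cut x" for n x
  have gb: "\<bar>g n x\<bar> \<le> (B + 1) * indicator {-(B + 1)..B + 1} x" for n x
  proof (cases "\<bar>x\<bar> \<le> B + 1")
    case True
    have "\<bar>g n x\<bar> \<le> B * 1" unfolding g_def abs_mult
      using B(1) by (intro mult_mono) (auto simp: cut_def)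
    with True show ?thesis by (simp add: indicator_def abs_le_iff)
  next
    case False
    then have "cut x = 0" by (simp add: cut_def)
    then show ?thesis using B(1) by (simp add: g_def)
  qed
  have cg: "continuous_on UNIV (g n)" for n
    unfolding g_def cut_def by (intro continuous_intros F)
  have cs: "compactly_supported (B + 1) (g n)" for n
    using gb cg by (simp add: compactly_supported_def)
  have [measurable]: "g n \<in> borel_measurable borel" for n by (rule borel_measurable_continuous_onI[OF cg])
  have "(\<lambda>n. LINT x|lborel. (v x - g n x)\<^sup>2) \<longlonglongrightarrow> (LINT x|(lborel :: real measure). 0)"
  proof (rule integral_dominated_convergence[where w="\<lambda>x. (2 * (B + 1))\<^sup>2 * indicator {-(B + 1)..B + 1} x"])
    have "AE x in lebesgue. x \<notin> N" using N by (auto simp: negligible_iff_null_sets intro: AE_not_in)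
    then have "AE x in lborel. x \<notin> N" by (simp add: AE_completion_iff)
    then show "AE x in lborel. (\<lambda>n. (v x - g n x)\<^sup>2) \<longlonglongrightarrow> 0"
    proof eventually_elim
      case (elim x)
      have "(\<lambda>n. (v x - g n x)\<^sup>2) \<longlonglongrightarrow> (v x - max (- B) (min B (v x)) * cut x)\<^sup>2"
        unfolding g_def by (intro tendsto_intros F elim)
      also have "max (- B) (min B (v x)) * cut x = v x"
      proof (cases "x \<in> {-B..B}")
        case True
        then have "cut x = 1" by (auto simp: cut_def)
        with True B(2)[of x] show ?thesis by (auto simp: abs_le_iff max_def min_def)
      next
        case False
        with B(2)[of x] B(1) show ?thesis by simp
      qed
      finally show ?case by simp
    qed
    show "AE x in lborel. norm ((v x - g n x)\<^sup>2) \<le> (2 * (B + 1))\<^sup>2 * indicator {-(B + 1)..B + 1} x" for n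
    proof (rule AE_I2)
      fix x
      have "\<bar>v x\<bar> \<le> (B + 1) * indicator {-(B + 1)..B + 1} x"
        using B(2)[of x] B(1)
        by (cases "x \<in> {-B..B}"; cases "x \<in> {-(B + 1)..B + 1}") auto
      with gb[of n x] have "\<bar>v x - g n x\<bar> \<le> \<bar>2 * (B + 1) * indicator {-(B + 1)..B + 1} x\<bar>"
        by linarith
      then have "(v x - g n x)\<^sup>2 \<le> (2 * (B + 1) * indicator {-(B + 1)..B + 1} x)\<^sup>2"
        by (simp only: abs_le_square_iff)
      also have "\<dots> = (2 * (B + 1))\<^sup>2 * indicator {-(B + 1)..B + 1} x" by (simp add: indicator_def)
      finally show "norm ((v x - g n x)\<^sup>2) \<le> (2 * (B + 1))\<^sup>2 * indicator {-(B + 1)..B + 1} x" by simp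
    qed
  qed (auto intro!: integrable_mult_right integrable_real_indicator simp: emeasure_lborel_Icc_eq)
  then have "\<forall>\<^sub>F n in sequentially. (LINT x|lborel. (v x - g n x)\<^sup>2) < e"
    using e by (intro order_tendstoD(2)) auto
  then show thesis using that cs by (meson eventually_happens sequentially_bot)
qed

lemma compactly_supported_dense:
  assumes u: "u \<in> L2" and e: "0 < e"
  obtains B g where "compactly_supported B g" "(LINT x|lborel. (u x - g x)\<^sup>2) < e"
proof -
  \<comment> \<open>A quarter for each of the two errors, as \<open>L2_triangle\<close> doubles
    both.\<close>
  obtain n :: nat where n: "(LINT x|lborel. (u x - max (- real n) (min (real n) (u x)) * indicator {-real n..real n} x)\<^sup>2) < e / 4"
    using L2_truncation[OF u, of "e / 4"] e by auto
  define v where "v x = max (- real n) (min (real n) (u x)) * indicator {-real n..real n} x" for x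
  note L2_measurable[OF u, measurable]
  have [measurable]: "v \<in> borel_measurable borel" unfolding v_def by measurable
  have "\<bar>v x\<bar> \<le> real n * indicator {-real n..real n} x" for x
    by (auto simp: v_def indicator_def max_def min_def)
  then obtain g where g: "compactly_supported (real n + 1) g" "(LINT x|lborel. (v x - g x)\<^sup>2) < e / 4"
    using bounded_L2_approx[of v "real n" "e / 4"] e by auto
  have v: "v \<in> L2"
  proof (rule L2_bound[OF u, where C=1])
    show "(v x)\<^sup>2 \<le> 1 * (u x)\<^sup>2" for x
      unfolding mult_1 abs_le_square_iff[symmetric] by (auto simp: v_def indicator_def max_def min_def)
  qed measurable
  have gL: "g \<in> L2" by (rule compactly_supported_L2[OF g(1)])
  have "(LINT x|lborel. (u x - g x)\<^sup>2) = (LINT x|lborel. ((u x - v x) + (v x - g x))\<^sup>2)" by simp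
  also have "\<dots> \<le> 2 * (LINT x|lborel. (u x - v x)\<^sup>2) + 2 * (LINT x|lborel. (v x - g x)\<^sup>2)"
    by (intro L2_triangle L2_diff u v gL)
  also have "\<dots> < e" using n g(2) by (simp add: v_def)
  finally show thesis using that[OF g(1)] by simp
qed

context interface_process
begin

section \<open>Continuity at time 0\<close>

lemma P_tendsto_pointwise:
  assumes g: "compactly_supported B g" and y: "y \<noteq> 0" and S: "\<And>n. 0 < S n" "S \<longlonglongrightarrow> 0"
  shows "(\<lambda>n. P (S n) g y) \<longlonglongrightarrow> g y"
proof -
  interpret C: prob_space "completion M" by (rule prob_space_completion)
  have gm: "g \<in> borel_measurable borel" using compactly_supported_L2[OF g] by (rule L2_measurable)
  note gB = compactly_supported_bound(2)[OF g]
  have "(\<lambda>n. P (S n) g y) \<longlonglongrightarrow> (LINT w|completion M. g y)"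
    unfolding P_def
  proof (rule integral_dominated_convergence[where w="\<lambda>_. \<bar>B\<bar>"])
    show "X (S n) g y \<in> borel_measurable (completion M)" for n
      using S(1)[of n] by (intro X_measurable gm) auto
    show "AE w in completion M. norm (X (S n) g y w) \<le> \<bar>B\<bar>" for n using gB by (auto simp: X_def)
    show "AE w in completion M. (\<lambda>n. X (S n) g y w) \<longlonglongrightarrow> g y"
      using AE_good_completion
    proof eventually_elim
      case (elim w)
      obtain b where b: "0 < b" "\<And>t. 0 \<le> t \<Longrightarrow> t < b \<Longrightarrow> alive t y w \<and> zo t y w = y + \<zeta> t w"
        using zo_initial[OF elim y] by metis
      have ev: "\<forall>\<^sub>F n in sequentially. g (y + \<zeta> (S n) w) = X (S n) g y w"
        using order_tendstoD(2)[OF S(2) b(1)]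
      proof eventually_elim
        case (elim n)
        then show ?case using b(2)[of "S n"] S(1)[of n] by (simp add: X_def)
      qed
      have "((\<lambda>t. y + \<zeta> t w) \<longlongrightarrow> y + \<zeta> 0 w) (at_right 0)"
        using elim by (intro cadlag_right) (auto simp: good_path_def)
      moreover have "filterlim S (at_right 0) sequentially"
        using S by (auto simp: filterlim_at less_imp_neq[symmetric] intro!: always_eventually)
      ultimately have "(\<lambda>n. y + \<zeta> (S n) w) \<longlonglongrightarrow> y + \<zeta> 0 w"
        by (rule filterlim_compose)
      then have "(\<lambda>n. y + \<zeta> (S n) w) \<longlonglongrightarrow> y" using elim by (simp add: good_path_def)
      moreover have "isCont g y" using g by (simp add: compactly_supported_def continuous_on_eq_continuous_at)
      ultimately have "(\<lambda>n. g (y + \<zeta> (S n) w)) \<longlonglongrightarrow> g y" by (rule isCont_tendsto_compose[rotated])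
      then show ?case by (rule Lim_transform_eventually[OF _ ev])
    qed
  qed auto
  then show ?thesis using C.prob_space by simp
qed

text \<open>Expanding the square and using the contraction leaves twice the squared norm of
  \<open>g\<close> minus twice the inner product with \<open>P t g\<close>. The inner product only
  sees the support of \<open>g\<close>, where dominated convergence applies; no control of
  \<open>P t g\<close> far out is needed.\<close>

lemma P_continuous_compactly_supported:
  assumes g: "compactly_supported B g"
  shows "((\<lambda>t. LINT y|lborel. (P t g y - g y)\<^sup>2) \<longlongrightarrow> 0) (at_right 0)"
proof (rule tendsto_at_right_sequentially[where b=1])
  fix S :: "nat \<Rightarrow> real" assume S: "\<And>n. 0 < S n" "S \<longlonglongrightarrow> 0"
  have gL: "g \<in> L2" by (rule compactly_supported_L2[OF g])
  have PL: "P (S n) g \<in> L2" for n using S(1)[of n] by (intro P_L2_contraction gL) auto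
  note [measurable] = L2_measurable[OF gL] L2_measurable[OF PL]
  note gB = compactly_supported_bound(1)[OF g] and gB' = compactly_supported_bound(2)[OF g]
  have "(\<lambda>n. LINT y|lborel. P (S n) g y * g y) \<longlonglongrightarrow> (LINT y|lborel. g y * g y)"
  proof (rule integral_dominated_convergence[where w="\<lambda>x. \<bar>B\<bar> * (B * indicator {-B..B} x)"])
    show "integrable lborel (\<lambda>x. \<bar>B\<bar> * (B * indicator {-B..B} x))"
      by (intro integrable_mult_right integrable_real_indicator) (auto simp: emeasure_lborel_Icc_eq)
    have "AE y in lborel. y \<noteq> (0::real)" by (rule AE_lborel_singleton)
    then show "AE y in lborel. (\<lambda>n. P (S n) g y * g y) \<longlonglongrightarrow> g y * g y"
      by eventually_elim (intro tendsto_intros P_tendsto_pointwise[OF g _ S])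
    show "AE y in lborel. norm (P (S n) g y * g y) \<le> \<bar>B\<bar> * (B * indicator {-B..B} y)" for n
    proof (rule AE_I2)
      fix y
      have "\<bar>P (S n) g y\<bar> \<le> \<bar>B\<bar>" using S(1)[of n] by (intro P_bound gL gB') auto
      then show "norm (P (S n) g y * g y) \<le> \<bar>B\<bar> * (B * indicator {-B..B} y)"
        unfolding real_norm_def abs_mult using gB by (intro mult_mono) auto
    qed
  qed measurable
  then have "(\<lambda>n. 2 * (LINT y|lborel. (g y)\<^sup>2) - 2 * (LINT y|lborel. P (S n) g y * g y)) \<longlonglongrightarrow>
      2 * (LINT y|lborel. (g y)\<^sup>2) - 2 * (LINT y|lborel. g y * g y)"
    by (intro tendsto_intros)
  then have lim: "(\<lambda>n. 2 * (LINT y|lborel. (g y)\<^sup>2) - 2 * (LINT y|lborel. P (S n) g y * g y)) \<longlonglongrightarrow> 0"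
    by (simp add: power2_eq_square)
  show "(\<lambda>n. LINT y|lborel. (P (S n) g y - g y)\<^sup>2) \<longlonglongrightarrow> 0"
  proof (rule tendsto_sandwich[OF _ _ tendsto_const lim])
    show "\<forall>\<^sub>F n in sequentially. (LINT y|lborel. (P (S n) g y - g y)\<^sup>2) \<le>
       2 * (LINT y|lborel. (g y)\<^sup>2) - 2 * (LINT y|lborel. P (S n) g y * g y)"
    proof (intro always_eventually allI)
      fix n
      have "(LINT y|lborel. (P (S n) g y - g y)\<^sup>2) =
         (LINT y|lborel. (P (S n) g y)\<^sup>2 - 2 * (P (S n) g y * g y) + (g y)\<^sup>2)"
        by (simp add: power2_eq_square algebra_simps)
      also have "\<dots> = (LINT y|lborel. (P (S n) g y)\<^sup>2) - 2 * (LINT y|lborel. P (S n) g y * g y) + (LINT y|lborel. (g y)\<^sup>2)"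
        using L2_integrable[OF PL] L2_integrable[OF gL] L2_mult_integrable[OF PL gL] by simp
      also have "(LINT y|lborel. (P (S n) g y)\<^sup>2) \<le> (LINT y|lborel. (g y)\<^sup>2)"
        using S(1)[of n] by (intro P_L2_contraction gL) auto
      finally show "(LINT y|lborel. (P (S n) g y - g y)\<^sup>2) \<le>
         2 * (LINT y|lborel. (g y)\<^sup>2) - 2 * (LINT y|lborel. P (S n) g y * g y)" by simp
    qed
  qed auto
qed simp

lemma P_strongly_continuous:
  assumes u: "u \<in> L2"
  shows "((\<lambda>t. LINT y|lborel. (P t u y - u y)\<^sup>2) \<longlongrightarrow> 0) (at_right 0)"
proof (rule tendstoI)
  fix e :: real assume e: "0 < e"
  \<comment> \<open>The two triangle inequalities below produce ten such errors in total, so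
    sixteenths suffice.\<close>
  obtain B g where g: "compactly_supported B g" "(LINT x|lborel. (u x - g x)\<^sup>2) < e / 16"
    using compactly_supported_dense[OF u, of "e / 16"] e by auto
  have gL: "g \<in> L2" by (rule compactly_supported_L2[OF g(1)])
  have ugL: "(\<lambda>x. u x - g x) \<in> L2" by (rule L2_diff[OF u gL])
  have "\<forall>\<^sub>F t in at_right 0. (LINT y|lborel. (P t g y - g y)\<^sup>2) < e / 16"
    using order_tendstoD(2)[OF P_continuous_compactly_supported[OF g(1)], of "e / 16"] e by simp
  moreover have "\<forall>\<^sub>F t in at_right 0. 0 < (t :: real)" by (rule eventually_at_right_less)
  ultimately show "\<forall>\<^sub>F t in at_right 0. dist (LINT y|lborel. (P t u y - u y)\<^sup>2) 0 < e"
  proof eventually_elim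
    case (elim t)
    then have t: "0 \<le> t" by simp
    have PL: "P t u \<in> L2" "P t g \<in> L2" "P t (\<lambda>x. u x - g x) \<in> L2" by (intro P_L2_contraction t u gL ugL)+
    let ?I = "\<lambda>v. LINT y|lborel. (v y)\<^sup>2"
    have "(\<lambda>y. P t u y - u y) = (\<lambda>y. P t (\<lambda>x. u x - g x) y + ((P t g y - g y) + (g y - u y)))"
      by (rule ext) (simp add: P_diff[OF t u gL])
    then have "?I (\<lambda>y. P t u y - u y) = ?I (\<lambda>y. P t (\<lambda>x. u x - g x) y + ((P t g y - g y) + (g y - u y)))"
      by (rule arg_cong[where f="?I"])
    also have "\<dots> \<le> 2 * ?I (P t (\<lambda>x. u x - g x)) + 2 * ?I (\<lambda>y. (P t g y - g y) + (g y - u y))"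
    proof (rule L2_triangle[OF PL(3)])
      show "(\<lambda>y. (P t g y - g y) + (g y - u y)) \<in> L2"
        using L2_diff[OF PL(2) u] by simp
    qed
    also have "?I (\<lambda>y. (P t g y - g y) + (g y - u y)) \<le> 2 * ?I (\<lambda>y. P t g y - g y) + 2 * ?I (\<lambda>y. g y - u y)"
      by (intro L2_triangle L2_diff PL gL u)
    also have "?I (P t (\<lambda>x. u x - g x)) \<le> ?I (\<lambda>y. u y - g y)" by (rule P_L2_contraction(2)[OF t ugL])
    also have "?I (\<lambda>y. g y - u y) = ?I (\<lambda>y. u y - g y)" by (simp add: power2_commute)
    finally have "?I (\<lambda>y. P t u y - u y) < e" using g(2) elim(1) e by simp
    moreover have "0 \<le> ?I (\<lambda>y. P t u y - u y)" by simp
    ultimately show ?case by (simp add: dist_real_def)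
  qed
qed

lemma symmetric_markov_semigroup_P: "symmetric_markov_semigroup P"
proof
  show "AE y in lborel. P 0 u y = u y" if "u \<in> L2" for u
  proof -
    have "AE y in lborel. y \<noteq> (0::real)" by (rule AE_lborel_singleton)
    then show ?thesis by eventually_elim (rule P_0[OF _ that])
  qed
  show "AE y in lborel. P t u y = P t v y"
    if "0 \<le> t" "u \<in> L2" "v \<in> L2" "AE y in lborel. u y = v y" for t u v
    using that by (rule P_respects_AE)
  show "AE y in lborel. 0 \<le> P t u y \<and> P t u y \<le> 1"
    if "0 \<le> t" "u \<in> L2" "AE y in lborel. 0 \<le> u y \<and> u y \<le> 1" for t u
    using that by (rule P_sub_markov)
qed (auto simp: P_L2_contraction P_lincomb P_semigroup P_symmetric P_strongly_continuous)

section \<open>Killing on approach against killing at the hitting time\<close>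

lemma AE_alive_iff_before_hitting:
  assumes t: "0 \<le> t" and y: "y \<noteq> 0"
  shows "AE w in M. alive t y w \<longleftrightarrow> ereal t < hitting_time (\<lambda>s. \<zeta> s w) y"
proof -
  have "AE w in M. \<not> (\<exists>s. 0 < s \<and> s \<le> t \<and> ((\<lambda>r. y + \<zeta> r w) \<longlongrightarrow> 0) (at_left s) \<and> y + \<zeta> s w \<noteq> 0)"
    using no_jump_from_0[of t y] t by (cases "t = 0") auto
  with AE_good_path show ?thesis
  proof eventually_elim
    case (elim w)
    have z: "cadlag_path (\<lambda>t. \<zeta> t w)" "\<zeta> 0 w = 0" using elim by (auto simp: good_path_def)
    show ?case
    proof
      assume "alive t y w"
      then show "ereal t < hitting_time (\<lambda>s. \<zeta> s w) y"
        using less_hitting_time[OF z(1) _ _ t] by (auto simp: alive_def away_def)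
    next
      assume hit: "ereal t < hitting_time (\<lambda>s. \<zeta> s w) y"
      show "alive t y w"
      proof (rule ccontr)
        assume "\<not> alive t y w"
        then have "\<exists>s\<in>{0..t}. \<bar>y + \<zeta> s w\<bar> < d" if "0 < d" for d
          using that by (auto simp: alive_def away_def not_le)
        from jump_from_0_if_near_0[OF z y t hit this] elim(2) show False by blast
      qed
    qed
  qed
qed

lemma interface_semigroup:
  assumes t: "0 \<le> t" and u: "u \<in> L2" and y: "y \<noteq> 0"
  defines "Z \<equiv> \<lambda>w. u (interface_path (\<lambda>s. \<zeta> s w) (\<lambda>m. \<sigma> m w) t y) *
      indicator {w. ereal t < hitting_time (\<lambda>s. \<zeta> s w) y} w"
  shows "integrable (completion M) Z" "P t u y = (LINT w|completion M. Z w)"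
proof -
  have eq: "AE w in M. X t u y w = Z w"
    using AE_alive_iff_before_hitting[OF t y] by eventually_elim (simp add: X_def Z_def zo_def)
  have XZ: "AE w in completion M. X t u y w = Z w" by (rule AE_completion[OF eq])
  have mX: "X t u y \<in> borel_measurable (completion M)"
    by (rule X_measurable[OF t L2_measurable[OF u]])
  \<comment> \<open>The hitting event is not measurable a priori; in the completion \<open>Z\<close>
    inherits measurability from the almost surely equal \<open>X t u y\<close>.\<close>
  then have mZ: "Z \<in> borel_measurable (completion M)"
    by (rule measurable_completion_AE_eq[OF _ eq]) simp
  show "integrable (completion M) Z"
    using X_integrable[OF t u] integrable_cong_AE[OF mX mZ XZ] by simp
  show "P t u y = (LINT w|completion M. Z w)"
    unfolding P_def by (rule integral_cong_AE[OF mX mZ XZ])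
qed

end

context kinetic_model
begin

text \<open>A positive value at 0 would, by continuity, let the diverging power of the logarithm
  drive the product to infinity, against the finite lower limit.\<close>

lemma p_zero_at_0: "p_zero 0 = 0"
proof (rule ccontr)
  assume nz: "p_zero 0 \<noteq> 0"
  have p: "continuous_on UNIV p_zero" "\<And>k. 0 \<le> p_zero k" using p_torus[of p_zero] by auto
  then have pos: "0 < p_zero 0" using nz by (simp add: less_le)
  obtain \<kappa> where \<kappa>: "0 < \<kappa>" "Liminf (at 0) (\<lambda>k. ereal (ln (inverse \<bar>k\<bar>) powr \<kappa> * p_zero k)) \<in> {0<..<\<infinity>}"
    using p_zero_liminf by blast
  have "filterlim (\<lambda>k::real. ln (inverse \<bar>k\<bar>)) at_top (at 0)"
  proof (rule filterlim_compose[OF ln_at_top])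
    have "filterlim (\<lambda>k::real. \<bar>k\<bar>) (at_right 0) (at 0)"
      unfolding filterlim_at
      by (auto intro!: tendsto_eq_intros simp: eventually_at_filter)
    then show "filterlim (\<lambda>k::real. inverse \<bar>k\<bar>) at_top (at 0)"
      by (rule filterlim_compose[OF filterlim_inverse_at_top_right])
  qed
  from filterlim_compose[OF real_powr_at_top[OF \<kappa>(1)] this]
  have "filterlim (\<lambda>k. ln (inverse \<bar>k\<bar>) powr \<kappa>) at_top (at 0)" .
  moreover have "(p_zero \<longlongrightarrow> p_zero 0) (at 0)"
    using p(1) by (simp add: continuous_on_eq_continuous_at isCont_def)
  ultimately have "filterlim (\<lambda>k. ln (inverse \<bar>k\<bar>) powr \<kappa> * p_zero k) at_top (at 0)"
    using filterlim_tendsto_pos_mult_at_top[of p_zero "p_zero 0" "at 0" "\<lambda>k. ln (inverse \<bar>k\<bar>) powr \<kappa>"] pos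
    by (simp add: mult.commute)
  then have "((\<lambda>k. ereal (ln (inverse \<bar>k\<bar>) powr \<kappa> * p_zero k)) \<longlongrightarrow> \<infinity>) (at 0)"
    by (simp add: tendsto_PInfty_eq_at_top)
  then have "Liminf (at 0) (\<lambda>k. ereal (ln (inverse \<bar>k\<bar>) powr \<kappa> * p_zero k)) = \<infinity>"
    by (intro lim_imp_Liminf) auto
  with \<kappa>(2) show False by simp
qed

lemma jump_intensity_pos: "0 < jump_intensity \<gamma> disp R1 R2 \<beta>2 \<beta>3"
proof -
  obtain l1 where l1: "0 < l1" "((\<lambda>k. R2 k / \<bar>k\<bar> powr \<beta>2) \<longlongrightarrow> l1) (at 0)" using R_limit[of R2 \<beta>2] by auto
  obtain l2 where l2: "0 < l2" "((\<lambda>k. \<bar>k\<bar> powr \<beta>3 * \<bar>jump_fun \<gamma> disp R1 k\<bar>) \<longlongrightarrow> l2) (at 0)" using S_limit by auto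
  obtain l3 where l3: "0 < l3" "((\<lambda>k. \<bar>k\<bar> powr (1 + \<beta>3) * \<bar>deriv (jump_fun \<gamma> disp R1) k\<bar>) \<longlongrightarrow> l3) (at 0)"
    using S_deriv_limit by auto
  have "0 < stable_const ((1 + \<beta>2) / \<beta>3)" using alpha_range by (intro stable_const_pos) auto
  moreover have "0 < Gamma ((1 + \<beta>2) / \<beta>3 + 1)" using alpha_range by (intro Gamma_real_pos) auto
  ultimately show ?thesis
    using l1(1) l2(1) l3(1)
    by (simp add: jump_intensity_def Let_def tendsto_Lim[OF _ l1(2)] tendsto_Lim[OF _ l2(2)] tendsto_Lim[OF _ l3(2)])
qed

end

theorem proposition5p3:
  fixes \<gamma> \<beta>1 \<beta>2 \<beta>3 :: real
    and p_plus p_minus p_zero disp R1 R2 :: "real \<Rightarrow> real"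
    and M :: "'w measure"
    and \<zeta> :: "real \<Rightarrow> 'w \<Rightarrow> real"
    and \<sigma> :: "nat \<Rightarrow> 'w \<Rightarrow> real"
  assumes "kinetic_model \<gamma> p_plus p_minus p_zero disp R1 R2 \<beta>1 \<beta>2 \<beta>3"
    and "symmetric_stable_process M \<zeta> ((1 + \<beta>2) / \<beta>3) (jump_intensity \<gamma> disp R1 R2 \<beta>2 \<beta>3)"
    and "interface_signs M \<zeta> \<sigma> (p_plus 0) (p_minus 0)"
  defines "\<zeta>o \<equiv> \<lambda>t y w. interface_path (\<lambda>s. \<zeta> s w) (\<lambda>m. \<sigma> m w) t y"
    and "before_hit \<equiv> \<lambda>t y. {w. ereal t < hitting_time (\<lambda>s. \<zeta> s w) y}"
  shows "\<exists>P. symmetric_markov_semigroup P \<and>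
    (\<forall>t\<ge>0. \<forall>u\<in>L2. \<forall>y. y \<noteq> 0 \<longrightarrow>
      integrable (completion M) (\<lambda>w. u (\<zeta>o t y w) * indicator (before_hit t y) w) \<and>
      P t u y = (LINT w|completion M. u (\<zeta>o t y w) * indicator (before_hit t y) w))"
proof -
  interpret K: kinetic_model \<gamma> p_plus p_minus p_zero disp R1 R2 \<beta>1 \<beta>2 \<beta>3 by fact
  \<comment> \<open>With no absorption at 0, transmission and reflection exhaust all cases, so that
    the signs are almost surely 1 or -1.\<close>
  have "p_plus 0 + p_minus 0 = 1" using K.p_sum[of 0] K.p_zero_at_0 by simp
  then interpret I: interface_process M \<zeta> "(1 + \<beta>2) / \<beta>3" "jump_intensity \<gamma> disp R1 R2 \<beta>2 \<beta>3" \<sigma> "p_plus 0" "p_minus 0"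
    using assms(2,3) K.alpha_range K.jump_intensity_pos
    by (intro interface_process.intro nondegenerate_stable_process.intro
        nondegenerate_stable_process_axioms.intro interface_process_axioms.intro) auto
  show ?thesis
    using I.symmetric_markov_semigroup_P I.interface_semigroup
    unfolding \<zeta>o_def before_hit_def by (intro exI[of _ I.P]) auto
qed

end
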